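(* Let $a,b\in\mathbb{R}$ with $a>2b>0$. For $x\in(0,1)$ let $(f_x,g_x)$ denote the solution of the Cauchy problem $$ \left\{\begin{aligned} &f'+\frac{2}{r}f=g(f^2-a g^2+b),\\ &g'=f(1-g^2),\\ &f(0)=0,\quad g(0)=x. \end{aligned}\right. $$ There exists an increasing sequence $\{x_k\}_{k\ge 0}$ in $(0,1)$ such that for every integer $k\ge 0$: (1) the solution $(f_{x_k},g_{x_k})$ is global, i.e. defined for all $r\ge 0$; (2) both $f_{x_k}$ and $g_{x_k}$ have exactly $k$ zeros on $(0,+\infty)$; (3) $(f_{x_k}(r),g_{x_k}(r))$ converges exponentially to $(0,0)$ as $r\to+\infty$.
   Context: The unknowns $f,g$ are real-valued functions of $r\ge 0$. A solution of the Cauchy problem is a pair of $\mathcal{C}^1$ functions on an interval starting at $0$, satisfying the differential equations for $r>0$ and the initial conditions at $r=0$; it is taken on its maximal interval of existence. "Converges exponentially to $(0,0)$" means that there are constants $C,K>0$ with $|f(r)|+|g(r)|\le C e^{-Kr}$ for all $r\ge 0$. *)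

theory Defs
  imports "HOL-Analysis.Analysis"
begin

text \<open>
  Derivatives are taken relative to the interval \<open>I\<close>, so they are one-sided at an end point of \<open>I\<close>
  that belongs to \<open>I\<close> (in particular at \<open>0\<close>); the values of \<open>f\<close> outside \<open>I\<close> are irrelevant.
\<close>

definition C1_with_deriv :: "real set \<Rightarrow> (real \<Rightarrow> real) \<Rightarrow> (real \<Rightarrow> real) \<Rightarrow> bool" where
  "C1_with_deriv I f f' \<longleftrightarrow>
     (\<forall>r\<in>I. (f has_real_derivative f' r) (at r within I)) \<and> continuous_on I f'"

definition interval_from_0 :: "real set \<Rightarrow> bool" where
  "interval_from_0 I \<longleftrightarrow> is_interval I \<and> 0 \<in> I \<and> I \<subseteq> {0..} \<and> I \<noteq> {0}"

definition cauchy_solution ::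
  "real \<Rightarrow> real \<Rightarrow> real \<Rightarrow> real set \<Rightarrow> (real \<Rightarrow> real) \<Rightarrow> (real \<Rightarrow> real) \<Rightarrow> bool" where
  "cauchy_solution a b x I f g \<longleftrightarrow>
     interval_from_0 I \<and>
     (\<exists>f' g'. C1_with_deriv I f f' \<and> C1_with_deriv I g g' \<and>
        (\<forall>r\<in>I. r > 0 \<longrightarrow>
           f' r + 2 / r * f r = g r * ((f r)\<^sup>2 - a * (g r)\<^sup>2 + b) \<and>
           g' r = f r * (1 - (g r)\<^sup>2))) \<and>
     f 0 = 0 \<and> g 0 = x"

text \<open>A solution is maximal if no solution on a strictly larger interval extends it.\<close>

definition maximal_cauchy_solution ::
  "real \<Rightarrow> real \<Rightarrow> real \<Rightarrow> real set \<Rightarrow> (real \<Rightarrow> real) \<Rightarrow> (real \<Rightarrow> real) \<Rightarrow> bool" where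
  "maximal_cauchy_solution a b x I f g \<longleftrightarrow>
     cauchy_solution a b x I f g \<and>
     (\<forall>J F G. cauchy_solution a b x J F G \<and> I \<subseteq> J \<and> (\<forall>r\<in>I. F r = f r \<and> G r = g r) \<longrightarrow> J = I)"

definition has_exactly_pos_zeros :: "nat \<Rightarrow> (real \<Rightarrow> real) \<Rightarrow> bool" where
  "has_exactly_pos_zeros k h \<longleftrightarrow> finite {r. r > 0 \<and> h r = 0} \<and> card {r. r > 0 \<and> h r = 0} = k"

definition converges_exponentially_to_0 :: "(real \<Rightarrow> real) \<Rightarrow> (real \<Rightarrow> real) \<Rightarrow> bool" where
  "converges_exponentially_to_0 f g \<longleftrightarrow>
     (\<exists>C K. C > 0 \<and> K > 0 \<and> (\<forall>r\<ge>0. \<bar>f r\<bar> + \<bar>g r\<bar> \<le> C * exp (- K * r)))"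

end

theory Submission
  imports Defs
begin

text \<open>
  The function \<open>energy f g = f^2 (1 - g^2) / 2 + a g^4 / 4 - b g^2 / 2\<close> is the Hamiltonian of the
  system without the term \<open>2 f / r\<close>, and along a solution with \<open>\<bar>g\<bar> < 1\<close> its derivative is
  \<open>- 2 f^2 (1 - g^2) / r \<le> 0\<close>.  Since \<open>a > 2 b\<close>, every point \<open>(0, x)\<close> with \<open>0 < x < 1\<close> has energy below
  that of \<open>(0, 1)\<close>, and this sublevel set inside the strip \<open>\<bar>g\<bar> < 1\<close> is bounded.  So all solutions
  are global (\<open>global_solution_exists\<close>), and what has to be found are the values of \<open>x\<close> whose solution
  tends to the saddle \<open>(0, 0)\<close>.

  The energy is a double well.  Once it is negative, \<open>g\<close> can no longer vanish.  While it is positive,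
  the solution rotates around the origin: at a zero of \<open>f\<close> one has \<open>a g^2 > 2 b\<close>, which fixes the
  direction of crossing, so zeros of \<open>f\<close> and zeros of \<open>g\<close> alternate.  If the energy stays positive and
  \<open>g\<close> has finitely many zeros, then \<open>f\<close> stops changing sign, \<open>g\<close> becomes monotone, both functions
  converge, and the limit can only be \<open>(0, 0)\<close>; near the saddle the convergence is exponential and
  \<open>f\<close> has as many zeros as \<open>g\<close> (\<open>positive_energy_orbit_decays\<close>, \<open>f_has_as_many_zeros\<close>).

  For each \<open>k\<close>, let \<open>few_zeros k\<close> be the set of \<open>x\<close> for which \<open>g\<close> has at most \<open>k\<close> zeros, and let \<open>x k\<close> be
  its supremum.

  \<^item> The set is nonempty, since at \<open>x = sqrt (b / a)\<close> the energy is negative from the start.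
  \<^item> It stays away from \<open>1\<close> (\<open>shots_near_1_have_many_zeros\<close>): for \<open>x\<close> near \<open>1\<close> the solution keeps
    almost the energy of \<open>(0, 1)\<close> up to a large radius \<open>R\<close>, and from then on each half turn costs only
    \<open>O(1 / R)\<close>.
  \<^item> It contains its supremum, because all zeros of \<open>g\<close> are simple and hence persist for nearby initial
    values (\<open>shot_g_zeros_lower_semicontinuous\<close>).
  \<^item> At \<open>x k\<close> the energy stays positive.  Otherwise it would become negative, also for all nearby
    initial values, and none of them could have more zeros than \<open>x k\<close>
    (\<open>negative_energy_stable\<close>), against the choice of \<open>x k\<close> as a supremum.
  \<^item> Therefore the solution at \<open>x k\<close> tends to \<open>(0, 0)\<close>, and nearby solutions have at most one zero more
    (\<open>positive_energy_gains_at_most_one_zero\<close>).  Points just above \<open>x k\<close> have more than \<open>k\<close> zeros,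
    so \<open>x k\<close> itself has exactly \<open>k\<close>.

  The sets \<open>few_zeros k\<close> increase with \<open>k\<close>, hence so do their suprema, and strictly, because the numbers of
  zeros differ.

  The delicate point is that a solution which misses the saddle gains only one zero.  Such a solution
  has a further zero of \<open>g\<close> at some radius \<open>s\<close>, with a tiny value \<open>p = - f s\<close>, and from then on its energy is
  at most \<open>p^2 / 2\<close>.  In the next half turn it loses an energy of order \<open>1 / t\<close>, where \<open>t\<close> is the radius
  at which \<open>\<bar>g\<bar>\<close> has grown back to \<open>sqrt (b / a)\<close>.  The saddle forces exponential rates both before and
  after \<open>s\<close>, and together they make \<open>p\<close> exponentially small in \<open>t\<close>.  So the loss exceeds the energy that
  is left, and \<open>g\<close> cannot vanish a second time (\<open>at_most_one_late_g_zero\<close>).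
\<close>

section \<open>Comparison, limits and counting on the real line\<close>

lemma exp_comparison_le:
  fixes h h' :: "real \<Rightarrow> real"
  assumes "s \<le> t" and cont: "continuous_on {s..t} h"
    and deriv: "\<And>r. s < r \<Longrightarrow> r < t \<Longrightarrow> (h has_real_derivative h' r) (at r)"
    and le: "\<And>r. s < r \<Longrightarrow> r < t \<Longrightarrow> h' r \<le> c * h r"
  shows "h t \<le> h s * exp (c * (t - s))"
proof -
  have "h t * exp (- c * t) \<le> h s * exp (- c * s)"
  proof (rule DERIV_nonpos_imp_decreasing_open[OF \<open>s \<le> t\<close>])
    fix r assume r: "s < r" "r < t"
    have "((\<lambda>r. h r * exp (- c * r)) has_real_derivative (h' r - c * h r) * exp (- c * r)) (at r)"
      by (auto intro!: derivative_eq_intros deriv r simp: algebra_simps)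
    moreover have "(h' r - c * h r) * exp (- c * r) \<le> 0"
      using le[OF r] by (simp add: mult_nonpos_nonneg)
    ultimately show "\<exists>y. ((\<lambda>r. h r * exp (- c * r)) has_real_derivative y) (at r) \<and> y \<le> 0"
      by blast
  qed (intro continuous_intros cont)
  then have "h t * exp (- c * t) * exp (c * t) \<le> h s * exp (- c * s) * exp (c * t)"
    by (intro mult_right_mono) auto
  then show ?thesis
    by (simp add: mult.assoc exp_add [symmetric] algebra_simps)
qed

lemma exp_comparison_ge:
  fixes h h' :: "real \<Rightarrow> real"
  assumes "s \<le> t" and cont: "continuous_on {s..t} h"
    and deriv: "\<And>r. s < r \<Longrightarrow> r < t \<Longrightarrow> (h has_real_derivative h' r) (at r)"
    and ge: "\<And>r. s < r \<Longrightarrow> r < t \<Longrightarrow> c * h r \<le> h' r"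
  shows "h s * exp (c * (t - s)) \<le> h t"
proof -
  have "- h t \<le> - h s * exp (c * (t - s))"
    by (rule exp_comparison_le[where h = "\<lambda>r. - h r" and h' = "\<lambda>r. - h' r"])
      (use assms in \<open>auto intro!: derivative_eq_intros continuous_intros\<close>)
  then show ?thesis by simp
qed

lemma first_hit:
  fixes h :: "real \<Rightarrow> real"
  assumes "s \<le> t" and cont: "continuous_on {s..t} h" and "h s < c" and "c \<le> h t"
  obtains r where "s < r" "r \<le> t" "h r = c" "\<And>q. s \<le> q \<Longrightarrow> q < r \<Longrightarrow> h q < c"
proof -
  define A where "A = {s..t} \<inter> h -` {c..}"
  have "closed A"
    unfolding A_def by (intro continuous_closed_preimage cont) auto
  moreover have "bounded A"
    unfolding A_def by (intro bounded_Int) auto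
  ultimately have "compact A" by (simp add: compact_eq_bounded_closed)
  moreover have "t \<in> A" using assms by (auto simp: A_def)
  ultimately obtain r where r: "r \<in> A" "\<And>q. q \<in> A \<Longrightarrow> r \<le> q"
    using compact_attains_inf[of A] by blast
  have below: "h q < c" if "s \<le> q" "q < r" for q
    using r(2)[of q] r(1) that by (force simp: A_def)
  have "\<exists>q\<ge>s. q \<le> r \<and> h q = c"
    by (rule IVT') (use r(1) assms in \<open>auto simp: A_def intro: continuous_on_subset\<close>)
  then obtain q where q: "s \<le> q" "q \<le> r" "h q = c" by blast
  have "q = r" using below[of q] q by force
  moreover have "s \<noteq> r" using r(1) assms q \<open>q = r\<close> by auto
  ultimately show ?thesis using that[of r] below r(1) q by (auto simp: A_def)
qed

lemma first_zero:
  fixes h :: "real \<Rightarrow> real"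
  assumes "s \<le> t" and "continuous_on {s..t} h" and "h s \<noteq> 0" and "h t = 0"
  obtains r where "s < r" "r \<le> t" "h r = 0" "\<And>q. s \<le> q \<Longrightarrow> q < r \<Longrightarrow> h q \<noteq> 0"
proof -
  have "continuous_on {s..t} (\<lambda>r. - \<bar>h r\<bar>)"
    by (intro continuous_intros assms)
  then obtain r where r: "s < r" "r \<le> t" "- \<bar>h r\<bar> = 0" "\<And>q. s \<le> q \<Longrightarrow> q < r \<Longrightarrow> - \<bar>h q\<bar> < 0"
    using first_hit[of s t "\<lambda>r. - \<bar>h r\<bar>" 0] assms by auto
  show ?thesis using that[of r] r by force
qed

lemma nonvanishing_sign:
  fixes h :: "real \<Rightarrow> real"
  assumes S: "is_interval S" and cont: "continuous_on S h" and nz: "\<And>r. r \<in> S \<Longrightarrow> h r \<noteq> 0"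
  shows "(\<forall>r\<in>S. h r < 0) \<or> (\<forall>r\<in>S. h r > 0)"
proof (rule ccontr)
  assume "\<not> ?thesis"
  then obtain u v where uv: "u \<in> S" "v \<in> S" "h u > 0" "h v < 0"
    using nz by (meson linorder_neqE_linordered_idom)
  have "is_interval (h ` S)"
    using S cont connected_continuous_image is_interval_connected_1 by blast
  then have "0 \<in> h ` S"
    using mem_is_interval_1_I[of "h ` S" "h v" "h u" 0] uv by auto
  then show False using nz by auto
qed

text \<open>
  By the mean value theorem \<open>h (r + 1) - h r\<close> is a value of \<open>h'\<close> at a point beyond \<open>r\<close>, and it tends to
  \<open>c - c\<close>.
\<close>
lemma derivative_limit_zero:
  fixes h h' :: "real \<Rightarrow> real"
  assumes h: "(h \<longlongrightarrow> c) at_top" and h': "(h' \<longlongrightarrow> L) at_top"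
    and deriv: "\<And>r. r > R \<Longrightarrow> (h has_real_derivative h' r) (at r)"
  shows "L = 0"
proof -
  have "\<exists>z>r. z < r + 1 \<and> h (r + 1) - h r = h' z" if "r > R" for r
    using MVT2[of r "r + 1" h h'] deriv that by force
  then obtain z where z: "\<And>r. r > R \<Longrightarrow> z r > r \<and> h (r + 1) - h r = h' (z r)"
    by metis
  have big: "\<forall>\<^sub>F r in at_top. r > R" by (rule eventually_gt_at_top)
  have "filterlim z at_top at_top"
    by (rule filterlim_at_top_mono[OF filterlim_ident eventually_mono[OF big]])
      (use z in \<open>force intro: less_imp_le\<close>)
  then have "((\<lambda>r. h' (z r)) \<longlongrightarrow> L) at_top"
    by (rule filterlim_compose[OF h'])
  then have "((\<lambda>r. h (r + 1) - h r) \<longlongrightarrow> L) at_top"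
    by (rule Lim_transform_eventually[OF _ eventually_mono[OF big]]) (simp add: z)
  moreover have "((\<lambda>r. h (r + 1)) \<longlongrightarrow> c) at_top"
    by (rule filterlim_compose[OF h], rule filterlim_at_top_mono[OF filterlim_ident]) auto
  then have "((\<lambda>r. h (r + 1) - h r) \<longlongrightarrow> c - c) at_top"
    by (intro tendsto_diff h)
  ultimately show ?thesis
    using tendsto_unique[OF trivial_limit_at_top_linorder] by fastforce
qed

lemma antimono_bounded_tendsto_at_top:
  fixes h :: "real \<Rightarrow> real"
  assumes anti: "\<And>r s. R < r \<Longrightarrow> r \<le> s \<Longrightarrow> h s \<le> h r" and bdd: "\<And>r. R < r \<Longrightarrow> B \<le> h r"
  obtains l where "(h \<longlongrightarrow> l) at_top" "\<And>r. R < r \<Longrightarrow> l \<le> h r" "B \<le> l"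
proof -
  define l where "l = Inf (h ` {R<..})"
  have bb: "bdd_below (h ` {R<..})" using bdd by (auto intro: bdd_belowI[of _ B])
  have ne: "h ` {R<..} \<noteq> {}" by auto
  have lle: "l \<le> h r" if "R < r" for r
    unfolding l_def using bb that by (auto intro: cInf_lower)
  have "(h \<longlongrightarrow> l) at_top"
  proof (rule decreasing_tendsto)
    show "\<forall>\<^sub>F r in at_top. l \<le> h r"
      by (rule eventually_mono[OF eventually_gt_at_top[of R]]) (rule lle)
    fix y assume "l < y"
    then obtain q where q: "R < q" "h q < y"
      using cInf_lessD[OF ne] unfolding l_def by auto
    show "\<forall>\<^sub>F r in at_top. h r < y"
      using eventually_ge_at_top[of q] by eventually_elim (use anti[OF q(1)] q in force)
  qed
  moreover have "B \<le> l" unfolding l_def using bdd by (intro cInf_greatest[OF ne]) auto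
  ultimately show ?thesis using that lle by blast
qed

text \<open>
  Counting the elements of \<open>B\<close> below a point is strictly increasing on \<open>A\<close>, hence injective, with values
  in \<open>{0..card B}\<close>.
\<close>
lemma interlaced_card:
  fixes A B :: "real set"
  assumes "finite B" and "\<And>u v. u \<in> A \<Longrightarrow> v \<in> A \<Longrightarrow> u < v \<Longrightarrow> \<exists>b\<in>B. u < b \<and> b < v"
  shows "finite A \<and> card A \<le> card B + 1"
proof -
  define n where "n u = card {b \<in> B. b < u}" for u
  have less: "n u < n v" if uv: "u \<in> A" "v \<in> A" "u < v" for u v
  proof -
    obtain b where "b \<in> B" "u < b" "b < v" using assms(2)[OF uv] by blast
    then have "{b \<in> B. b < u} \<subseteq> {b \<in> B. b < v}" "b \<in> {b \<in> B. b < v} - {b \<in> B. b < u}"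
      by auto
    then have "{b \<in> B. b < u} \<subset> {b \<in> B. b < v}" by blast
    then show ?thesis unfolding n_def using \<open>finite B\<close> by (intro psubset_card_mono) auto
  qed
  have "inj_on n A"
    by (rule inj_onI) (metis less less_irrefl linorder_neqE_linordered_idom)
  moreover have "n ` A \<subseteq> {..card B}"
    unfolding n_def using \<open>finite B\<close> by (auto intro: card_mono)
  ultimately show ?thesis
    using inj_on_finite[of n A "{..card B}"] card_inj_on_le[of n A "{..card B}"] by auto
qed

lemma tanh_lipschitz: "\<bar>tanh u - tanh v\<bar> \<le> \<bar>u - v\<bar>" for u v :: real
proof -
  have "norm (tanh u - tanh v) \<le> 1 * norm (u - v)"
  proof (rule field_differentiable_bound[of UNIV tanh "\<lambda>x. 1 - tanh x ^ 2"])
    fix z :: real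
    show "(tanh has_field_derivative 1 - tanh z ^ 2) (at z within UNIV)"
      by (auto intro!: derivative_eq_intros)
    have "tanh z ^ 2 \<le> 1"
      using tanh_real_bounds[of z] by (simp add: abs_square_le_1 abs_le_iff)
    then show "norm (1 - tanh z ^ 2) \<le> 1" by simp
  qed auto
  then show ?thesis by simp
qed

lemma square_growth_bound:
  fixes x y p q L :: real
  assumes "0 \<le> L" "\<bar>p\<bar> \<le> L * (\<bar>x\<bar> + \<bar>y\<bar>)" "\<bar>q\<bar> \<le> L * (\<bar>x\<bar> + \<bar>y\<bar>)"
  shows "\<bar>2 * x * p + 2 * y * q\<bar> \<le> 4 * L * (x\<^sup>2 + y\<^sup>2)"
proof -
  let ?s = "\<bar>x\<bar> + \<bar>y\<bar>"
  have "\<bar>2 * x * p + 2 * y * q\<bar> \<le> 2 * (\<bar>x\<bar> * \<bar>p\<bar>) + 2 * (\<bar>y\<bar> * \<bar>q\<bar>)"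
    by (intro order_trans[OF abs_triangle_ineq]) (simp add: abs_mult)
  also have "\<dots> \<le> 2 * (\<bar>x\<bar> * (L * ?s)) + 2 * (\<bar>y\<bar> * (L * ?s))"
    using assms by (intro add_mono mult_left_mono) auto
  also have "\<dots> = 2 * L * ?s\<^sup>2" by (simp add: power2_eq_square algebra_simps)
  also have "\<dots> \<le> 2 * L * (2 * (x\<^sup>2 + y\<^sup>2))"
  proof (rule mult_left_mono)
    have "0 \<le> (\<bar>x\<bar> - \<bar>y\<bar>)\<^sup>2" by simp
    then show "?s\<^sup>2 \<le> 2 * (x\<^sup>2 + y\<^sup>2)" by (simp add: power2_eq_square algebra_simps)
  qed (use assms in simp)
  finally show ?thesis by (simp only: mult.assoc)
qed

lemma compact_nonvanishing_bound:
  fixes h :: "real \<Rightarrow> real"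
  assumes "compact K" "continuous_on K h" "\<And>r. r \<in> K \<Longrightarrow> h r \<noteq> 0"
  obtains c where "0 < c" "\<And>r. r \<in> K \<Longrightarrow> c \<le> \<bar>h r\<bar>"
proof (cases "K = {}")
  case True
  then show ?thesis using that[of 1] by simp
next
  case False
  have "continuous_on K (\<lambda>r. \<bar>h r\<bar>)" by (intro continuous_intros assms)
  then obtain r0 where "r0 \<in> K" "\<And>r. r \<in> K \<Longrightarrow> \<bar>h r0\<bar> \<le> \<bar>h r\<bar>"
    using continuous_attains_inf[OF assms(1) False] by blast
  then show ?thesis using that[of "\<bar>h r0\<bar>"] assms(3) by auto
qed

lemma finite_card_le_1I:
  assumes "\<And>u v :: real. u \<in> A \<Longrightarrow> v \<in> A \<Longrightarrow> u < v \<Longrightarrow> False"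
  shows "finite A \<and> card A \<le> 1"
proof -
  have eq: "u = v" if "u \<in> A" "v \<in> A" for u v using assms that by (metis linorder_neqE_linordered_idom)
  show ?thesis
  proof (cases "A = {}")
    case False
    then obtain u where "A = {u}" using eq by blast
    then show ?thesis by simp
  qed simp
qed

section \<open>The radial first-order operator\<close>

text \<open>
  The solution of \<open>u' + 2 u / r = h\<close> that is bounded at the origin, obtained from \<open>(r^2 u)' = r^2 h\<close>.
  It vanishes for \<open>r \<le> 0\<close>: for \<open>r < 0\<close> the interval is empty, and at \<open>r = 0\<close> the quotient is \<open>0 / 0 = 0\<close>.
  So it is continuous on the whole line.
\<close>
definition radial_primitive :: "(real \<Rightarrow> real) \<Rightarrow> real \<Rightarrow> real" where
  "radial_primitive h r = integral {0..r} (\<lambda>s. s\<^sup>2 * h s) / r\<^sup>2"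

lemma integral_from_0_derivative:
  fixes h :: "real \<Rightarrow> real"
  assumes "continuous_on {0..} h" "0 \<le> r"
  shows "((\<lambda>r. integral {0..r} h) has_real_derivative h r) (at r within {0..})"
proof -
  have "((\<lambda>r. integral {0..r} h) has_real_derivative h r) (at r within {0..r + 1})"
    using assms by (intro integral_has_real_derivative) (auto intro: continuous_on_subset)
  moreover have "at r within {0..r + 1} = at r within {0..}"
    by (rule at_within_nhd[of _ "{..<r + 1}"]) auto
  ultimately show ?thesis by simp
qed

lemma integral_from_0_continuous:
  fixes h :: "real \<Rightarrow> real"
  assumes "continuous_on {0..} h"
  shows "continuous_on {0..} (\<lambda>r. integral {0..r} h)"
  using integral_from_0_derivative[OF assms]
  by (meson DERIV_continuous atLeast_iff continuous_on_eq_continuous_within)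

lemma integral_from_0_exp:
  fixes c :: real
  assumes "0 < c" "0 \<le> r"
  shows "integral {0..r} (\<lambda>s. exp (c * s)) = (exp (c * r) - 1) / c"
proof -
  have "((\<lambda>s. exp (c * s)) has_integral exp (c * r) / c - exp (c * 0) / c) {0..r}"
    using assms
    by (intro fundamental_theorem_of_calculus)
      (auto intro!: derivative_eq_intros simp flip: has_real_derivative_iff_has_vector_derivative)
  then show ?thesis by (simp add: integral_unique diff_divide_distrib)
qed

lemma radial_primitive_nonpos [simp]: "r \<le> 0 \<Longrightarrow> radial_primitive h r = 0"
  by (cases "r = 0") (auto simp: radial_primitive_def)

lemma radial_primitive_diff:
  assumes "continuous_on {0..r} h1" "continuous_on {0..r} h2"
  shows "radial_primitive (\<lambda>s. h1 s - h2 s) r = radial_primitive h1 r - radial_primitive h2 r"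
proof -
  have "(\<lambda>s. s\<^sup>2 * h1 s) integrable_on {0..r}" "(\<lambda>s. s\<^sup>2 * h2 s) integrable_on {0..r}"
    by (intro integrable_continuous_real continuous_intros assms)+
  then show ?thesis
    by (simp add: radial_primitive_def right_diff_distrib integral_diff diff_divide_distrib)
qed

lemma radial_primitive_const:
  assumes "0 \<le> r"
  shows "radial_primitive (\<lambda>s. c) r = c * r / 3"
proof -
  have "((\<lambda>s. s\<^sup>2 * c) has_integral r ^ 3 * c / 3 - 0 ^ 3 * c / 3) {0..r}"
    using assms
    by (intro fundamental_theorem_of_calculus)
      (auto intro!: derivative_eq_intros simp flip: has_real_derivative_iff_has_vector_derivative)
  then have "integral {0..r} (\<lambda>s. s\<^sup>2 * c) = r ^ 3 * c / 3"
    by (simp only: integral_unique) simp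
  then show ?thesis
    by (simp only: radial_primitive_def) (simp add: power2_eq_square power3_eq_cube)
qed

text \<open>
  The weight \<open>s^2 / r^2\<close> is at most \<open>1\<close> on \<open>{0..r}\<close>.
\<close>
lemma radial_primitive_abs_le_integral:
  assumes "continuous_on {0..r} h" "continuous_on {0..r} k" "\<And>s. 0 \<le> s \<Longrightarrow> s \<le> r \<Longrightarrow> \<bar>h s\<bar> \<le> k s"
  shows "\<bar>radial_primitive h r\<bar> \<le> integral {0..r} k"
proof (cases "r > 0")
  case True
  have "\<bar>integral {0..r} (\<lambda>s. s\<^sup>2 * h s)\<bar> \<le> integral {0..r} (\<lambda>s. r\<^sup>2 * k s)"
    unfolding real_norm_def[symmetric]
  proof (rule integral_norm_bound_integral)
    show "(\<lambda>s. s\<^sup>2 * h s) integrable_on {0..r}" "(\<lambda>s. r\<^sup>2 * k s) integrable_on {0..r}"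
      by (intro integrable_continuous_real continuous_intros assms)+
    fix s assume s: "s \<in> {0..r}"
    then have "s\<^sup>2 \<le> r\<^sup>2" by (intro power_mono) auto
    then show "norm (s\<^sup>2 * h s) \<le> r\<^sup>2 * k s"
      using assms(3)[of s] s by (auto simp: abs_mult intro!: mult_mono)
  qed
  also have "\<dots> = r\<^sup>2 * integral {0..r} k" by simp
  finally show ?thesis
    using True by (simp add: radial_primitive_def abs_divide divide_simps mult.commute)
next
  case False
  have "integral {0..r} k = 0"
  proof (cases "r = 0")
    case True then show ?thesis by simp
  next
    case False with \<open>\<not> r > 0\<close> show ?thesis by simp
  qed
  then show ?thesis using False by simp
qed

lemma radial_primitive_abs_le:
  assumes "continuous_on {0..r} h" "\<And>s. 0 \<le> s \<Longrightarrow> s \<le> r \<Longrightarrow> \<bar>h s\<bar> \<le> C" "0 \<le> r"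
  shows "\<bar>radial_primitive h r\<bar> \<le> C * r"
  using radial_primitive_abs_le_integral[of r h "\<lambda>_. C"] assms by (simp add: mult.commute)

lemma radial_primitive_derivative:
  assumes cont: "continuous_on {0..} h" and "0 < r"
  shows "(radial_primitive h has_real_derivative h r - 2 / r * radial_primitive h r) (at r)"
proof -
  let ?W = "\<lambda>r. integral {0..r} (\<lambda>s. s\<^sup>2 * h s)"
  have "(?W has_real_derivative r\<^sup>2 * h r) (at r within {0..})"
    using \<open>0 < r\<close> by (intro integral_from_0_derivative continuous_intros cont) auto
  moreover have "at r within {0..} = at r"
    using \<open>0 < r\<close> by (intro at_within_interior) auto
  ultimately have "(?W has_real_derivative r\<^sup>2 * h r) (at r)" by simp
  then have "((\<lambda>r. ?W r / r\<^sup>2) has_real_derivative h r - 2 / r * (?W r / r\<^sup>2)) (at r)"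
    using \<open>0 < r\<close>
    by (auto intro!: derivative_eq_intros simp: field_simps power2_eq_square power3_eq_cube)
  then show ?thesis
    by (simp add: radial_primitive_def [abs_def])
qed

text \<open>
  The one-sided derivative at the singular point \<open>r = 0\<close>: for a constant \<open>h\<close> the quotient is exactly \<open>h / 3\<close>, and
  near \<open>0\<close> the function \<open>h\<close> is almost constant.
\<close>
lemma radial_primitive_ratio_tendsto:
  assumes cont: "continuous_on {0..} h"
  shows "((\<lambda>r. radial_primitive h r / r) \<longlongrightarrow> h 0 / 3) (at 0 within {0..})"
proof (rule tendstoI)
  fix e :: real assume "0 < e"
  then obtain d where d: "d > 0" "\<And>s. 0 \<le> s \<Longrightarrow> s < d \<Longrightarrow> \<bar>h s - h 0\<bar> < e / 2"
    using cont[unfolded continuous_on_iff, rule_format, of 0 "e / 2"] by (auto simp: dist_real_def)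
  have "dist (radial_primitive h r / r) (h 0 / 3) < e" if r: "0 < r" "r < d" for r
  proof -
    have c: "continuous_on {0..r} h" using cont by (rule continuous_on_subset) auto
    have "\<bar>radial_primitive (\<lambda>s. h s - h 0) r\<bar> \<le> e / 2 * r"
      using r d by (intro radial_primitive_abs_le continuous_intros c) (auto intro!: less_imp_le d(2))
    moreover have "radial_primitive (\<lambda>s. h s - h 0) r = radial_primitive h r - h 0 * r / 3"
      using r c by (subst radial_primitive_diff) (auto simp: radial_primitive_const)
    moreover have "radial_primitive h r / r - h 0 / 3 = (radial_primitive h r - h 0 * r / 3) / r"
      using r by (simp add: field_simps)
    ultimately have "\<bar>radial_primitive h r / r - h 0 / 3\<bar> \<le> e / 2"
      using r by (simp add: abs_divide divide_simps)
    then show ?thesis using \<open>0 < e\<close> by (simp add: dist_real_def)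
  qed
  then show "\<forall>\<^sub>F r in at 0 within {0..}. dist (radial_primitive h r / r) (h 0 / 3) < e"
    unfolding eventually_at using d(1) by (auto simp: dist_real_def intro!: exI[of _ d])
qed

lemma radial_primitive_C1:
  assumes cont: "continuous_on {0..} h"
  shows "C1_with_deriv {0..} (radial_primitive h)
    (\<lambda>r. if r = 0 then h 0 / 3 else h r - 2 / r * radial_primitive h r)" (is "C1_with_deriv _ _ ?h'")
  unfolding C1_with_deriv_def
proof (intro conjI ballI)
  fix r :: real assume r: "r \<in> {0..}"
  show "(radial_primitive h has_real_derivative ?h' r) (at r within {0..})"
  proof (cases "r = 0")
    case True
    then show ?thesis
      using radial_primitive_ratio_tendsto[OF cont] by (simp add: has_field_derivative_iff)
  next
    case False
    then show ?thesis
      using radial_primitive_derivative[OF cont, of r] r by (auto intro: has_field_derivative_at_within)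
  qed
next
  show "continuous_on {0..} ?h'"
    unfolding continuous_on_def
  proof
    fix r :: real assume r: "r \<in> {0..}"
    show "(?h' \<longlongrightarrow> ?h' r) (at r within {0..})"
    proof (cases "r = 0")
      case True
      have "((\<lambda>r. h r - 2 * (radial_primitive h r / r)) \<longlongrightarrow> h 0 - 2 * (h 0 / 3)) (at 0 within {0..})"
        using cont by (intro tendsto_intros radial_primitive_ratio_tendsto) (auto simp: continuous_on_def)
      then have "(?h' \<longlongrightarrow> h 0 - 2 * (h 0 / 3)) (at 0 within {0..})"
        by (rule Lim_transform_eventually) (auto simp: eventually_at intro!: exI[of _ 1])
      then show ?thesis using True by simp
    next
      case False
      then have "0 < r" using r by simp
      have "(radial_primitive h \<longlongrightarrow> radial_primitive h r) (at r within {0..})"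
        using radial_primitive_derivative[OF cont \<open>0 < r\<close>]
        by (meson DERIV_isCont continuous_at_imp_continuous_at_within continuous_within)
      then have "((\<lambda>r. h r - 2 / r * radial_primitive h r) \<longlongrightarrow> h r - 2 / r * radial_primitive h r) (at r within {0..})"
        using cont r False by (intro tendsto_intros) (auto simp: continuous_on_def)
      then have "(?h' \<longlongrightarrow> h r - 2 / r * radial_primitive h r) (at r within {0..})"
        by (rule Lim_transform_eventually)
          (use \<open>0 < r\<close> in \<open>auto simp: eventually_at dist_real_def intro!: exI[of _ r]\<close>)
      then show ?thesis using False by simp
    qed
  qed
qed

lemma C1_with_deriv_continuous: "C1_with_deriv I f f' \<Longrightarrow> continuous_on I f"
  unfolding C1_with_deriv_def
  by (meson DERIV_continuous continuous_on_eq_continuous_within)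

lemma radial_primitive_continuous_UNIV:
  assumes "continuous_on {0..} h"
  shows "continuous_on UNIV (radial_primitive h)"
proof -
  have "continuous_on ({0..} \<union> {..0}) (radial_primitive h)"
  proof (rule continuous_on_closed_Un)
    show "continuous_on {0..} (radial_primitive h)"
      using radial_primitive_C1[OF assms] by (rule C1_with_deriv_continuous)
    show "continuous_on {..0} (radial_primitive h)"
      by (rule continuous_on_eq[of _ "\<lambda>_. 0"]) auto
  qed auto
  moreover have "{0..} \<union> {..0} = (UNIV :: real set)" by auto
  ultimately show ?thesis by simp
qed

section \<open>A nonlocal integral equation\<close>

text \<open>
  The map \<open>f \<mapsto> radial_primitive (k (f, c + \<integral> f))\<close> is a contraction for the weighted norm
  \<open>sup exp (- m r) \<bar>f r\<bar>\<close> when \<open>m\<close> is large, because integrating \<open>exp (m s)\<close> gains a factor \<open>1 / m\<close>.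
  The weight makes a single fixed point argument yield a solution on the whole half line.
\<close>
lemma radial_integral_equation_solvable:
  fixes k :: "real \<Rightarrow> real \<Rightarrow> real"
  assumes lip: "\<And>u w u' w'. \<bar>k u w - k u' w'\<bar> \<le> L * (\<bar>u - u'\<bar> + \<bar>w - w'\<bar>)"
    and bdd: "\<And>u w. \<bar>k u w\<bar> \<le> C"
    and kcont: "continuous_on UNIV (\<lambda>p. k (fst p) (snd p))"
    and "0 \<le> L"
  shows "\<exists>f. continuous_on UNIV f \<and>
    (\<forall>r. f r = radial_primitive (\<lambda>s. k (f s) (c + integral {0..s} f)) r)"
proof -
  define m where "m = 4 * L + 1"
  have m: "1 \<le> m" "2 * L / m \<le> 1 / 2" using \<open>0 \<le> L\<close> by (auto simp: m_def field_simps)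
  define F :: "(real \<Rightarrow>\<^sub>C real) \<Rightarrow> real \<Rightarrow> real" where "F u s = exp (m * s) * u s" for u s
  define W where "W u s = c + integral {0..s} (F u)" for u s
  define H where "H u s = k (F u s) (W u s)" for u s
  define T where "T u = Bcontfun (\<lambda>r. exp (- m * r) * radial_primitive (H u) r)" for u
  have Fcont: "continuous_on S (F u)" for u S
    unfolding F_def by (intro continuous_intros) auto
  have Wcont: "continuous_on {0..} (W u)" for u
    unfolding W_def by (intro continuous_intros integral_from_0_continuous Fcont)
  have Hcont: "continuous_on {0..} (H u)" for u
    unfolding H_def
    using continuous_on_compose2[OF kcont continuous_on_Pair[OF Fcont Wcont]] by simp
  have Hcont': "continuous_on {0..r} (H u)" for u r
    using Hcont by (rule continuous_on_subset) auto
  have "0 \<le> C" using bdd[of 0 0] by linarith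
  have Tmem: "(\<lambda>r. exp (- m * r) * radial_primitive (H u) r) \<in> bcontfun" for u
    unfolding bcontfun_def
  proof (intro CollectI conjI)
    show "continuous_on UNIV (\<lambda>r. exp (- m * r) * radial_primitive (H u) r)"
      by (intro continuous_intros radial_primitive_continuous_UNIV Hcont)
    have "\<bar>exp (- m * r) * radial_primitive (H u) r\<bar> \<le> C" for r
    proof (cases "r > 0")
      case True
      have "r \<le> exp (m * r)"
      proof -
        have "r \<le> m * r" using m True by simp
        also have "\<dots> \<le> exp (m * r)" using exp_ge_add_one_self[of "m * r"] by linarith
        finally show ?thesis .
      qed
      then have "C * r \<le> C * exp (m * r)" using \<open>0 \<le> C\<close> by (rule mult_left_mono)
      moreover have "\<bar>radial_primitive (H u) r\<bar> \<le> C * r"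
        using True bdd by (intro radial_primitive_abs_le Hcont') (auto simp: H_def)
      ultimately have "\<bar>radial_primitive (H u) r\<bar> \<le> C * exp (m * r)" by linarith
      then show ?thesis
        by (simp add: abs_mult exp_minus field_simps)
    qed (use \<open>0 \<le> C\<close> in simp)
    then show "bounded (range (\<lambda>r. exp (- m * r) * radial_primitive (H u) r))"
      by (auto simp: bounded_iff)
  qed
  have Tapp: "T u r = exp (- m * r) * radial_primitive (H u) r" for u r
    unfolding T_def using Bcontfun_inverse[OF Tmem] by simp
  have contr: "dist (T u) (T v) \<le> 1 / 2 * dist u v" for u v
  proof (rule dist_bound)
    fix r
    let ?D = "dist u v"
    show "dist (T u r) (T v r) \<le> 1 / 2 * ?D"
    proof (cases "r > 0")
      case True
      have Fd: "\<bar>F u s - F v s\<bar> \<le> ?D * exp (m * s)" for s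
      proof -
        have "\<bar>F u s - F v s\<bar> = exp (m * s) * \<bar>u s - v s\<bar>"
          by (simp add: F_def abs_mult flip: right_diff_distrib)
        also have "\<dots> \<le> exp (m * s) * ?D"
          using dist_bounded[of u s v] by (intro mult_left_mono) (auto simp: dist_real_def)
        finally show ?thesis by (simp add: mult.commute)
      qed
      have Wd: "\<bar>W u s - W v s\<bar> \<le> ?D * exp (m * s)" if "0 \<le> s" for s
      proof -
        have "W u s - W v s = integral {0..s} (\<lambda>t. F u t - F v t)"
          unfolding W_def
          by (simp add: integral_diff[OF integrable_continuous_real[OF Fcont] integrable_continuous_real[OF Fcont]])
        then have "\<bar>W u s - W v s\<bar> \<le> integral {0..s} (\<lambda>t. ?D * exp (m * t))"
          by (simp only: real_norm_def[symmetric])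
            (intro integral_norm_bound_integral integrable_continuous_real continuous_intros Fcont,
              use Fd in auto)
        also have "\<dots> = ?D * ((exp (m * s) - 1) / m)"
          using that m by (simp add: integral_from_0_exp)
        also have "\<dots> \<le> ?D * exp (m * s)"
          using m by (intro mult_left_mono) (auto simp: divide_simps intro: order_trans[of _ "exp (m * s)"])
        finally show ?thesis .
      qed
      have Hd: "\<bar>H u s - H v s\<bar> \<le> 2 * L * ?D * exp (m * s)" if "0 \<le> s" for s
      proof -
        have "\<bar>H u s - H v s\<bar> \<le> L * (\<bar>F u s - F v s\<bar> + \<bar>W u s - W v s\<bar>)"
          unfolding H_def by (rule lip)
        also have "\<dots> \<le> L * (?D * exp (m * s) + ?D * exp (m * s))"
          using \<open>0 \<le> L\<close> Fd Wd[OF that] by (intro mult_left_mono add_mono) auto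
        finally show ?thesis by simp
      qed
      have "\<bar>radial_primitive (H u) r - radial_primitive (H v) r\<bar> = \<bar>radial_primitive (\<lambda>s. H u s - H v s) r\<bar>"
        by (simp add: radial_primitive_diff Hcont')
      also have "\<dots> \<le> integral {0..r} (\<lambda>s. 2 * L * ?D * exp (m * s))"
      proof (rule radial_primitive_abs_le_integral)
        show "continuous_on {0..r} (\<lambda>s. H u s - H v s)" by (intro continuous_intros Hcont')
        show "continuous_on {0..r} (\<lambda>s. 2 * L * ?D * exp (m * s))" by (intro continuous_intros)
      qed (use Hd in auto)
      also have "\<dots> = 2 * L * ?D * ((exp (m * r) - 1) / m)"
        using True m by (simp add: integral_from_0_exp)
      also have "\<dots> \<le> 2 * L * ?D * (exp (m * r) / m)"
        using m \<open>0 \<le> L\<close> by (intro mult_left_mono divide_right_mono) auto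
      also have "\<dots> = (2 * L / m) * (?D * exp (m * r))" by simp
      also have "\<dots> \<le> 1 / 2 * (?D * exp (m * r))"
        using m by (intro mult_right_mono) auto
      finally have "\<bar>radial_primitive (H u) r - radial_primitive (H v) r\<bar> \<le> 1 / 2 * ?D * exp (m * r)"
        by simp
      then have "exp (- m * r) * \<bar>radial_primitive (H u) r - radial_primitive (H v) r\<bar> \<le> 1 / 2 * ?D"
        by (simp add: exp_minus field_simps)
      then show ?thesis
        by (simp add: Tapp dist_real_def abs_mult flip: right_diff_distrib)
    qed (simp add: Tapp)
  qed
  have "\<exists>!u. T u = u"
    by (rule banach_fix_type[of "1 / 2"]) (use contr in auto)
  then obtain u where u: "T u = u" by blast
  have "F u r = radial_primitive (\<lambda>s. k (F u s) (c + integral {0..s} (F u))) r" for r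
  proof -
    have "F u r = exp (m * r) * (exp (- m * r) * radial_primitive (H u) r)"
      using Tapp[of u r] u by (simp add: F_def)
    also have "\<dots> = radial_primitive (H u) r"
      by (simp add: exp_minus)
    finally show ?thesis by (simp add: H_def [abs_def] W_def)
  qed
  then show ?thesis using Fcont by blast
qed

section \<open>The vector field and its energy\<close>

locale mean_field =
  fixes a b :: real
  assumes a_gt: "2 * b < a" and b_pos: "0 < b"
begin

definition force :: "real \<Rightarrow> real \<Rightarrow> real" where
  "force f g = g * (f\<^sup>2 - a * g\<^sup>2 + b)"

definition energy :: "real \<Rightarrow> real \<Rightarrow> real" where
  "energy f g = f\<^sup>2 * (1 - g\<^sup>2) / 2 + a * g ^ 4 / 4 - b * g\<^sup>2 / 2"

text \<open>
  Solutions from radius \<open>R\<close> on that stay in the strip, lie below the energy of \<open>(0, 1)\<close> and are not the zero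
  solution.  Such orbits remain orbits when they are restricted to a later radius (\<open>orbit_later\<close>) or when
  both signs are flipped (\<open>orbit_uminus\<close>); each argument below is carried out for one sign and then
  transferred by the flip.
\<close>
definition orbit :: "real \<Rightarrow> (real \<Rightarrow> real) \<Rightarrow> (real \<Rightarrow> real) \<Rightarrow> bool" where
  "orbit R f g \<longleftrightarrow> 0 \<le> R \<and> continuous_on {R..} f \<and> continuous_on {R..} g \<and>
    (\<forall>r>R. (f has_real_derivative force (f r) (g r) - 2 / r * f r) (at r)) \<and>
    (\<forall>r>R. (g has_real_derivative f r * (1 - (g r)\<^sup>2)) (at r)) \<and>
    (\<forall>r\<ge>R. \<bar>g r\<bar> < 1) \<and> energy (f R) (g R) < energy 0 1 \<and> (f R \<noteq> 0 \<or> g R \<noteq> 0)"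

lemma a_pos: "0 < a" using a_gt b_pos by linarith

lemma force_lipschitz:
  assumes "\<bar>f1\<bar> \<le> N" "\<bar>f2\<bar> \<le> N" "\<bar>g1\<bar> \<le> N" "\<bar>g2\<bar> \<le> N"
  shows "\<bar>force f1 g1 - force f2 g2\<bar> \<le> ((2 + 3 * a) * N\<^sup>2 + b) * (\<bar>f1 - f2\<bar> + \<bar>g1 - g2\<bar>)"
proof -
  have prod_le: "\<bar>x * y\<bar> \<le> N\<^sup>2" if "\<bar>x\<bar> \<le> N" "\<bar>y\<bar> \<le> N" for x y :: real
    using mult_mono[OF that] that by (simp add: abs_mult power2_eq_square)
  have eq: "force f1 g1 - force f2 g2 = (g2 * f1 + g2 * f2) * (f1 - f2)
      + (f1 * f1 - a * (g1 * g1 + g1 * g2 + g2 * g2) + b) * (g1 - g2)"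
    by (simp add: force_def power2_eq_square algebra_simps)
  have A: "\<bar>g2 * f1 + g2 * f2\<bar> \<le> 2 * N\<^sup>2"
    using prod_le[of g2 f1] prod_le[of g2 f2] assms by linarith
  define X where "X = a * (g1 * g1 + g1 * g2 + g2 * g2)"
  have "\<bar>g1 * g1 + g1 * g2 + g2 * g2\<bar> \<le> 3 * N\<^sup>2"
    using prod_le[of g1 g1] prod_le[of g1 g2] prod_le[of g2 g2] assms by linarith
  then have "\<bar>X\<bar> \<le> a * (3 * N\<^sup>2)"
    unfolding X_def using a_pos by (subst abs_mult) (auto intro!: mult_left_mono)
  moreover have "(1 + 3 * a) * N\<^sup>2 + b = N\<^sup>2 + a * (3 * N\<^sup>2) + b"
    by (simp add: algebra_simps)
  ultimately have B: "\<bar>f1 * f1 - a * (g1 * g1 + g1 * g2 + g2 * g2) + b\<bar> \<le> (1 + 3 * a) * N\<^sup>2 + b"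
    using prod_le[of f1 f1] assms b_pos unfolding X_def [symmetric] by linarith
  let ?L = "(2 + 3 * a) * N\<^sup>2 + b"
  have le: "2 * N\<^sup>2 \<le> ?L" "(1 + 3 * a) * N\<^sup>2 + b \<le> ?L"
    using a_pos b_pos by (auto simp: algebra_simps intro!: add_nonneg_nonneg)
  have "\<bar>force f1 g1 - force f2 g2\<bar> \<le> ?L * \<bar>f1 - f2\<bar> + ?L * \<bar>g1 - g2\<bar>"
    unfolding eq using A B le
    by (intro order_trans[OF abs_triangle_ineq] add_mono) (auto simp: abs_mult intro!: mult_right_mono)
  then show ?thesis by (simp add: algebra_simps)
qed

lemma force_bound:
  assumes "\<bar>f\<bar> \<le> N" "\<bar>g\<bar> \<le> 1"
  shows "\<bar>force f g\<bar> \<le> N\<^sup>2 + a + b"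
proof -
  have "f\<^sup>2 \<le> N\<^sup>2" "g\<^sup>2 \<le> 1" using assms by (auto simp: abs_le_square_iff[symmetric] abs_square_le_1)
  moreover have "0 \<le> a * g\<^sup>2" "a * g\<^sup>2 \<le> a" using a_pos \<open>g\<^sup>2 \<le> 1\<close> by auto
  ultimately have "\<bar>f\<^sup>2 - a * g\<^sup>2 + b\<bar> \<le> N\<^sup>2 + a + b"
    using b_pos zero_le_power2[of f] zero_le_power2[of N] by linarith
  then have "\<bar>g\<bar> * \<bar>f\<^sup>2 - a * g\<^sup>2 + b\<bar> \<le> 1 * (N\<^sup>2 + a + b)"
    using assms by (intro mult_mono) auto
  then show ?thesis by (simp add: force_def abs_mult)
qed

lemma energy_derivative:
  assumes "(f has_real_derivative (force (f r) (g r) - 2 / r * f r)) (at r)"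
    and "(g has_real_derivative (f r * (1 - (g r)\<^sup>2))) (at r)" and "r > 0"
  shows "((\<lambda>r. energy (f r) (g r)) has_real_derivative - (2 / r * (f r)\<^sup>2 * (1 - (g r)\<^sup>2))) (at r)"
  unfolding energy_def
  using assms
  by (auto intro!: derivative_eq_intros simp: force_def field_simps power2_eq_square power3_eq_cube power4_eq_xxxx)

text \<open>
  The level curve of the energy through \<open>(0, 1)\<close> consists of the lines \<open>g = 1\<close>, \<open>g = - 1\<close> and the curve
  \<open>f^2 = a (1 + g^2) / 2 - b\<close>.
\<close>
lemma energy_gap: "energy 0 1 - energy f g = (1 - g\<^sup>2) * (a * (1 + g\<^sup>2) / 2 - b - f\<^sup>2) / 2"
  by (simp add: energy_def field_simps power2_eq_square power4_eq_xxxx)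

lemma f_bound_of_energy:
  assumes "energy f g < energy 0 1" "\<bar>g\<bar> < 1"
  shows "f\<^sup>2 < a - b"
proof -
  have g: "g\<^sup>2 < 1" using assms by (simp add: abs_square_less_1)
  have "0 < (1 - g\<^sup>2) * (a * (1 + g\<^sup>2) / 2 - b - f\<^sup>2)"
    using assms energy_gap[of f g] by simp
  then have "0 < a * (1 + g\<^sup>2) / 2 - b - f\<^sup>2"
    using g by (simp add: zero_less_mult_iff)
  moreover have "a * (1 + g\<^sup>2) \<le> a * 2" using g a_pos by (intro mult_left_mono) auto
  ultimately show ?thesis by linarith
qed

lemma energy_axis_less:
  assumes "0 < x" "x < 1"
  shows "energy 0 x < energy 0 1"
proof -
  have "0 < (1 - x\<^sup>2) * (a * (1 + x\<^sup>2) / 2 - b - 0\<^sup>2) / 2"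
  proof -
    have "x\<^sup>2 < 1" using assms by (simp add: power_less_one_iff)
    moreover have "a * (1 + x\<^sup>2) \<ge> a" using a_pos by simp
    ultimately show ?thesis using a_gt by simp
  qed
  then show ?thesis using energy_gap[of 0 x] by linarith
qed

section \<open>Global existence\<close>

text \<open>
  The equation for \<open>g\<close> integrates to \<open>g = tanh (c + \<integral> f)\<close>, which keeps \<open>\<bar>g\<bar> < 1\<close> and leaves one integral
  equation for \<open>f\<close> alone.  It is solved with \<open>f\<close> truncated at a level \<open>B\<close> above the energy bound; the energy
  then shows that the truncation is never active.
\<close>
lemma global_solution_exists:
  assumes x: "0 < x" "x < 1"
  shows "\<exists>f g f' g'. C1_with_deriv {0..} f f' \<and> C1_with_deriv {0..} g g' \<and>
    (\<forall>r>0. f' r = force (f r) (g r) - 2 / r * f r) \<and>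
    (\<forall>r\<ge>0. g' r = f r * (1 - (g r)\<^sup>2)) \<and> f 0 = 0 \<and> g 0 = x \<and> orbit 0 f g"
proof -
  define B where "B = a - b + 1"
  have B: "1 < B" "a - b < B\<^sup>2"
  proof -
    show "1 < B" using a_gt b_pos by (simp add: B_def)
    then have "B * 1 < B * B" by (intro mult_strict_left_mono) auto
    then show "a - b < B\<^sup>2" by (simp add: B_def power2_eq_square)
  qed
  define cut where "cut u = max (- B) (min B u)" for u
  define k where "k u w = force (cut u) (tanh w)" for u w
  have cut: "\<bar>cut u\<bar> \<le> B" "\<bar>cut u - cut v\<bar> \<le> \<bar>u - v\<bar>" for u v
    using B by (auto simp: cut_def)
  have cut_id: "cut u = u" if "\<bar>u\<bar> \<le> B" for u using that by (auto simp: cut_def)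
  have th: "\<bar>tanh w\<bar> < 1" for w :: real using tanh_real_bounds[of w] by auto
  have th2: "\<bar>tanh w\<bar> \<le> B" for w :: real using th[of w] B by linarith
  let ?L = "(2 + 3 * a) * B\<^sup>2 + b"
  have L0: "0 \<le> ?L" using a_pos b_pos by simp
  have klip: "\<bar>k u w - k u' w'\<bar> \<le> ?L * (\<bar>u - u'\<bar> + \<bar>w - w'\<bar>)" for u w u' w'
  proof -
    have "\<bar>k u w - k u' w'\<bar> \<le> ?L * (\<bar>cut u - cut u'\<bar> + \<bar>tanh w - tanh w'\<bar>)"
      unfolding k_def by (intro force_lipschitz cut th2)
    also have "\<dots> \<le> ?L * (\<bar>u - u'\<bar> + \<bar>w - w'\<bar>)"
      by (intro mult_left_mono add_mono cut tanh_lipschitz L0)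
    finally show ?thesis .
  qed
  have kbdd: "\<bar>k u w\<bar> \<le> B\<^sup>2 + a + b" for u w
    unfolding k_def by (intro force_bound cut less_imp_le[OF th])
  have kcont: "continuous_on UNIV (\<lambda>p. k (fst p) (snd p))"
    unfolding k_def force_def cut_def
    by (intro continuous_intros) auto
  \<comment> \<open>The inverse hyperbolic tangent of \<open>x\<close>.\<close>
  define c where "c = ln (sqrt ((1 + x) / (1 - x)))"
  obtain f where f: "continuous_on UNIV f"
    "\<And>r. f r = radial_primitive (\<lambda>s. k (f s) (c + integral {0..s} f)) r"
    using radial_integral_equation_solvable[OF klip kbdd kcont L0] by meson
  define w where "w s = c + integral {0..s} f" for s
  define g where "g s = tanh (w s)" for s
  define h where "h s = k (f s) (w s)" for s
  have fh: "f = radial_primitive h" using f(2) unfolding h_def [abs_def] w_def [abs_def] by blast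
  have fcont: "continuous_on S f" for S using f(1) continuous_on_subset by blast
  have tanh_c: "tanh c = x"
    unfolding c_def using x by (subst tanh_ln_real) (auto simp: field_simps)
  have wder: "(w has_real_derivative f r) (at r within {0..})" if "0 \<le> r" for r
    unfolding w_def using that integral_from_0_derivative[OF fcont that]
    by (auto intro!: derivative_eq_intros)
  then have wcont: "continuous_on {0..} w"
    by (meson DERIV_continuous atLeast_iff continuous_on_eq_continuous_within)
  have gder: "(g has_real_derivative f r * (1 - (g r)\<^sup>2)) (at r within {0..})" if "0 \<le> r" for r
    unfolding g_def using wder[OF that] by (auto intro!: derivative_eq_intros)
  have gcont: "continuous_on {0..} g"
    unfolding g_def by (intro continuous_intros wcont) auto
  have g1: "\<bar>g r\<bar> < 1" for r unfolding g_def by (rule th)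
  have hcont: "continuous_on {0..} h"
    unfolding h_def
    using continuous_on_compose2[OF kcont continuous_on_Pair[OF fcont wcont]] by simp
  have f0: "f 0 = 0" by (simp add: fh)
  have g0: "g 0 = x" by (simp add: g_def w_def tanh_c)
  have gder': "(g has_real_derivative f r * (1 - (g r)\<^sup>2)) (at r)" if "0 < r" for r
    using gder[of r] that at_within_interior[of r "{0..}"] by auto
  have fder: "(f has_real_derivative h r - 2 / r * f r) (at r)" if "0 < r" for r
    using radial_primitive_derivative[OF hcont that] unfolding fh .
  have hforce: "h r = force (f r) (g r)" if "\<bar>f r\<bar> \<le> B" for r
    using that by (simp add: h_def k_def g_def cut_id)
  \<comment> \<open>Up to the first radius with \<open>\<bar>f\<bar> = B\<close> the truncated equation is the original one, so the energy
    decreases and forces \<open>f^2 < a - b < B^2\<close> at that radius.\<close>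
  have fB: "\<bar>f r\<bar> < B" if r0: "0 \<le> r" for r
  proof (rule ccontr)
    assume "\<not> \<bar>f r\<bar> < B"
    then have "B \<le> \<bar>f r\<bar>" by simp
    moreover have "continuous_on {0..r} (\<lambda>r. \<bar>f r\<bar>)" by (intro continuous_intros fcont)
    moreover have "\<bar>f 0\<bar> < B" using f0 B by simp
    ultimately obtain t where t: "0 < t" "\<bar>f t\<bar> = B" "\<And>q. 0 \<le> q \<Longrightarrow> q < t \<Longrightarrow> \<bar>f q\<bar> < B"
      using first_hit[OF r0, of "\<lambda>r. \<bar>f r\<bar>" B] by blast
    have "energy (f t) (g t) \<le> energy (f 0) (g 0)"
    proof (rule DERIV_nonpos_imp_decreasing_open[of 0 t "\<lambda>r. energy (f r) (g r)"])
      fix q assume q: "0 < q" "q < t"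
      have "((\<lambda>r. energy (f r) (g r)) has_real_derivative - (2 / q * (f q)\<^sup>2 * (1 - (g q)\<^sup>2))) (at q)"
        using fder[OF q(1)] gder'[OF q(1)] hforce[of q] t(3)[of q] q
        by (intro energy_derivative) auto
      moreover have "- (2 / q * (f q)\<^sup>2 * (1 - (g q)\<^sup>2)) \<le> 0"
        using q g1[of q] by (simp add: abs_square_less_1 less_imp_le)
      ultimately show "\<exists>y. ((\<lambda>r. energy (f r) (g r)) has_real_derivative y) (at q) \<and> y \<le> 0" by blast
    next
      show "continuous_on {0..t} (\<lambda>r. energy (f r) (g r))"
        unfolding energy_def
        by (intro continuous_intros fcont continuous_on_subset[OF gcont]) auto
    qed (use t in auto)
    then have "(f t)\<^sup>2 < a - b"
      using energy_axis_less[OF x] f0 g0 g1 by (intro f_bound_of_energy[of _ "g t"]) auto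
    moreover have "(f t)\<^sup>2 = B\<^sup>2" using t(2) by (metis power2_abs)
    ultimately show False using B by simp
  qed
  let ?f' = "\<lambda>r. if r = 0 then h 0 / 3 else h r - 2 / r * f r"
  have ode: "h r = force (f r) (g r)" if "0 \<le> r" for r
    using hforce fB[OF that] by simp
  show ?thesis
  proof (rule exI[of _ f], rule exI[of _ g], rule exI[of _ ?f'],
      rule exI[of _ "\<lambda>r. f r * (1 - (g r)\<^sup>2)"], intro conjI)
    show "C1_with_deriv {0..} f ?f'"
      using radial_primitive_C1[OF hcont] unfolding fh .
    show "C1_with_deriv {0..} g (\<lambda>r. f r * (1 - (g r)\<^sup>2))"
      unfolding C1_with_deriv_def using gder by (auto intro!: continuous_intros fcont gcont)
    show "orbit 0 f g"
      unfolding orbit_def using fder gder' ode g1 energy_axis_less[OF x] f0 g0 x fcont gcont by auto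
  qed (use ode f0 g0 in auto)
qed

section \<open>Uniqueness and continuous dependence\<close>

text \<open>
  A common Lipschitz constant of both components of the vector field on \<open>{- N..N} \<times> {- N..N}\<close>, with
  respect to the sum of absolute values.
\<close>
definition lip_const :: "real \<Rightarrow> real" where
  "lip_const N = (2 + 3 * a) * N\<^sup>2 + b + 1 + 3 * N\<^sup>2"

lemma lip_const_nonneg: "0 \<le> lip_const N"
  unfolding lip_const_def using a_pos b_pos by (intro add_nonneg_nonneg) auto

lemma vector_field_lipschitz:
  assumes bd: "\<bar>f1\<bar> \<le> N" "\<bar>f2\<bar> \<le> N" "\<bar>g1\<bar> \<le> N" "\<bar>g2\<bar> \<le> N"
  shows "\<bar>force f1 g1 - force f2 g2\<bar> \<le> lip_const N * (\<bar>f1 - f2\<bar> + \<bar>g1 - g2\<bar>)"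
    and "\<bar>f1 * (1 - g1\<^sup>2) - f2 * (1 - g2\<^sup>2)\<bar> \<le> lip_const N * (\<bar>f1 - f2\<bar> + \<bar>g1 - g2\<bar>)"
proof -
  let ?s = "\<bar>f1 - f2\<bar> + \<bar>g1 - g2\<bar>"
  have "\<bar>force f1 g1 - force f2 g2\<bar> \<le> ((2 + 3 * a) * N\<^sup>2 + b) * ?s"
    by (rule force_lipschitz) fact+
  also have "\<dots> \<le> lip_const N * ?s"
    unfolding lip_const_def by (intro mult_right_mono) auto
  finally show "\<bar>force f1 g1 - force f2 g2\<bar> \<le> lip_const N * ?s" .
  have prod_le: "\<bar>x * y\<bar> \<le> N\<^sup>2" if "\<bar>x\<bar> \<le> N" "\<bar>y\<bar> \<le> N" for x y :: real
    using mult_mono[OF that] that by (simp add: abs_mult power2_eq_square)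
  have eq: "f1 * (1 - g1\<^sup>2) - f2 * (1 - g2\<^sup>2)
      = (1 - g1 * g1) * (f1 - f2) + (- (f2 * g1) - f2 * g2) * (g1 - g2)"
    by (simp add: power2_eq_square algebra_simps)
  have A: "\<bar>1 - g1 * g1\<bar> \<le> 1 + 3 * N\<^sup>2"
    using prod_le[of g1 g1] bd by linarith
  have B: "\<bar>- (f2 * g1) - f2 * g2\<bar> \<le> 1 + 3 * N\<^sup>2"
    using prod_le[of f2 g1] prod_le[of f2 g2] bd by linarith
  have "\<bar>f1 * (1 - g1\<^sup>2) - f2 * (1 - g2\<^sup>2)\<bar> \<le> (1 + 3 * N\<^sup>2) * \<bar>f1 - f2\<bar> + (1 + 3 * N\<^sup>2) * \<bar>g1 - g2\<bar>"
    unfolding eq using A B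
    by (intro order_trans[OF abs_triangle_ineq] add_mono) (auto simp: abs_mult intro!: mult_right_mono)
  also have "\<dots> = (1 + 3 * N\<^sup>2) * ?s" by (simp add: algebra_simps)
  also have "\<dots> \<le> lip_const N * ?s"
    unfolding lip_const_def using a_pos b_pos by (intro mult_right_mono) auto
  finally show "\<bar>f1 * (1 - g1\<^sup>2) - f2 * (1 - g2\<^sup>2)\<bar> \<le> lip_const N * ?s" .
qed

text \<open>
  In the derivative of the squared distance the singular terms combine to \<open>- 4 (f1 - f2)^2 / r \<le> 0\<close>, so
  the Lipschitz estimate of the regular part suffices in spite of the singularity at \<open>r = 0\<close>.
\<close>
lemma solutions_diverge_at_most_exponentially:
  assumes "0 \<le> T"
    and cont: "continuous_on {0..T} f1" "continuous_on {0..T} g1" "continuous_on {0..T} f2" "continuous_on {0..T} g2"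
    and der: "\<And>r. 0 < r \<Longrightarrow> r < T \<Longrightarrow> (f1 has_real_derivative force (f1 r) (g1 r) - 2 / r * f1 r) (at r)"
      "\<And>r. 0 < r \<Longrightarrow> r < T \<Longrightarrow> (g1 has_real_derivative f1 r * (1 - (g1 r)\<^sup>2)) (at r)"
      "\<And>r. 0 < r \<Longrightarrow> r < T \<Longrightarrow> (f2 has_real_derivative force (f2 r) (g2 r) - 2 / r * f2 r) (at r)"
      "\<And>r. 0 < r \<Longrightarrow> r < T \<Longrightarrow> (g2 has_real_derivative f2 r * (1 - (g2 r)\<^sup>2)) (at r)"
    and bd: "\<And>r. 0 < r \<Longrightarrow> r < T \<Longrightarrow> \<bar>f1 r\<bar> \<le> N \<and> \<bar>f2 r\<bar> \<le> N \<and> \<bar>g1 r\<bar> \<le> N \<and> \<bar>g2 r\<bar> \<le> N"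
  shows "(f1 T - f2 T)\<^sup>2 + (g1 T - g2 T)\<^sup>2
    \<le> ((f1 0 - f2 0)\<^sup>2 + (g1 0 - g2 0)\<^sup>2) * exp (4 * lip_const N * T)"
proof -
  define D where "D r = (f1 r - f2 r)\<^sup>2 + (g1 r - g2 r)\<^sup>2" for r
  define p where "p r = force (f1 r) (g1 r) - force (f2 r) (g2 r)" for r
  define q where "q r = f1 r * (1 - (g1 r)\<^sup>2) - f2 r * (1 - (g2 r)\<^sup>2)" for r
  define D' where "D' r = 2 * (f1 r - f2 r) * p r + 2 * (g1 r - g2 r) * q r - 4 / r * (f1 r - f2 r)\<^sup>2" for r
  have "D T \<le> D 0 * exp (4 * lip_const N * (T - 0))"
  proof (rule exp_comparison_le)
    show "continuous_on {0..T} D" unfolding D_def by (intro continuous_intros cont)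
    fix r assume r: "0 < r" "r < T"
    show "(D has_real_derivative D' r) (at r)"
      unfolding D_def D'_def p_def q_def
      by (auto intro!: derivative_eq_intros der[OF r]
          simp: power2_eq_square algebra_simps add_divide_distrib diff_divide_distrib)
    have "\<bar>2 * (f1 r - f2 r) * p r + 2 * (g1 r - g2 r) * q r\<bar> \<le> 4 * lip_const N * D r"
      unfolding D_def p_def q_def using bd[OF r]
      by (intro square_growth_bound lip_const_nonneg vector_field_lipschitz) auto
    moreover have "0 \<le> 4 / r * (f1 r - f2 r)\<^sup>2" using r by simp
    ultimately show "D' r \<le> 4 * lip_const N * D r" unfolding D'_def by linarith
  qed fact
  then show ?thesis by (simp add: D_def)
qed

lemma cauchy_solution_unique:
  assumes sol: "cauchy_solution a b x I f g"
    and orb: "orbit 0 F G" and init: "F 0 = 0" "G 0 = x" and "r \<in> I"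
  shows "f r = F r \<and> g r = G r"
proof -
  obtain f' g' where I: "is_interval I" "0 \<in> I" "I \<subseteq> {0..}"
    and C1: "C1_with_deriv I f f'" "C1_with_deriv I g g'"
    and eq: "\<And>r. r \<in> I \<Longrightarrow> r > 0 \<Longrightarrow> f' r + 2 / r * f r = g r * ((f r)\<^sup>2 - a * (g r)\<^sup>2 + b)
        \<and> g' r = f r * (1 - (g r)\<^sup>2)"
    and init': "f 0 = 0" "g 0 = x"
    using sol unfolding cauchy_solution_def interval_from_0_def by blast
  have "0 \<le> r" using I \<open>r \<in> I\<close> by auto
  have sub: "{0..r} \<subseteq> I"
    using mem_is_interval_1_I[OF I(1,2) \<open>r \<in> I\<close>] by auto
  have cont: "continuous_on {0..r} f" "continuous_on {0..r} g"
    using C1[THEN C1_with_deriv_continuous] sub continuous_on_subset by blast+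
  have contF: "continuous_on {0..r} F" "continuous_on {0..r} G"
    using orb by (auto simp: orbit_def intro: continuous_on_subset)
  have "bounded (f ` {0..r} \<union> g ` {0..r} \<union> F ` {0..r} \<union> G ` {0..r})"
    by (intro bounded_Un[THEN iffD2] conjI compact_imp_bounded compact_continuous_image cont contF) auto
  then obtain N where N: "\<forall>y \<in> f ` {0..r} \<union> g ` {0..r} \<union> F ` {0..r} \<union> G ` {0..r}. norm y \<le> N"
    unfolding bounded_iff ..
  have bd: "\<bar>f q\<bar> \<le> N \<and> \<bar>F q\<bar> \<le> N \<and> \<bar>g q\<bar> \<le> N \<and> \<bar>G q\<bar> \<le> N" if "0 < q" "q < r" for q
    using N that by (simp add: ball_Un)
  have at: "at q within I = at q" if "0 < q" "q < r" for q
    using that sub by (intro at_within_interior interiorI[of "{0<..<r}"]) auto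
  have derf: "(f has_real_derivative force (f q) (g q) - 2 / q * f q) (at q)"
    and derg: "(g has_real_derivative f q * (1 - (g q)\<^sup>2)) (at q)" if "0 < q" "q < r" for q
  proof -
    have "q \<in> I" using that sub by auto
    then have "(f has_real_derivative f' q) (at q)" "(g has_real_derivative g' q) (at q)"
      using C1 at[OF that] unfolding C1_with_deriv_def by metis+
    moreover have "f' q = force (f q) (g q) - 2 / q * f q" "g' q = f q * (1 - (g q)\<^sup>2)"
      using eq[OF \<open>q \<in> I\<close>] that by (auto simp: force_def algebra_simps)
    ultimately show "(f has_real_derivative force (f q) (g q) - 2 / q * f q) (at q)"
      "(g has_real_derivative f q * (1 - (g q)\<^sup>2)) (at q)" by auto
  qed
  have "(f r - F r)\<^sup>2 + (g r - G r)\<^sup>2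
    \<le> ((f 0 - F 0)\<^sup>2 + (g 0 - G 0)\<^sup>2) * exp (4 * lip_const N * r)"
    by (rule solutions_diverge_at_most_exponentially[OF \<open>0 \<le> r\<close> cont contF derf derg _ _ bd])
      (use orb in \<open>simp_all add: orbit_def\<close>)
  then have "(f r - F r)\<^sup>2 + (g r - G r)\<^sup>2 \<le> 0" using init init' by simp
  then show ?thesis
    using sum_power2_le_zero_iff[of "f r - F r" "g r - G r"] by simp
qed

text \<open>
  Every solution coincides with the global one where it is defined, so the only maximal one is global.
\<close>
lemma orbit_is_maximal_solution:
  assumes x: "0 < x" "x < 1"
  shows "\<exists>F G. orbit 0 F G \<and> F 0 = 0 \<and> G 0 = x \<and> maximal_cauchy_solution a b x {0..} F G \<and>
    (\<forall>I f g. maximal_cauchy_solution a b x I f g \<longrightarrow>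
      I = {0..} \<and> (\<forall>r\<ge>0. f r = F r \<and> g r = G r))"
proof -
  obtain F G f' g' where FG: "C1_with_deriv {0..} F f'" "C1_with_deriv {0..} G g'"
    "\<forall>r>0. f' r = force (F r) (G r) - 2 / r * F r"
    "\<forall>r\<ge>0. g' r = F r * (1 - (G r)\<^sup>2)" "F 0 = 0" "G 0 = x" "orbit 0 F G"
    using global_solution_exists[OF x] by (elim exE conjE)
  have "{0..} \<noteq> {0 :: real}"
    by (metis atLeast_iff singleton_iff zero_le_one zero_neq_one)
  then have int: "interval_from_0 {0..}"
    unfolding interval_from_0_def by (auto simp: is_interval_1)
  have sol: "cauchy_solution a b x {0..} F G"
    unfolding cauchy_solution_def
    by (intro conjI int FG, rule exI[of _ f'], rule exI[of _ g'])
      (use FG in \<open>auto simp: force_def\<close>)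
  then have maxF: "maximal_cauchy_solution a b x {0..} F G"
    unfolding maximal_cauchy_solution_def cauchy_solution_def interval_from_0_def by auto
  have unique: "I = {0..} \<and> (\<forall>r\<ge>0. f r = F r \<and> g r = G r)"
    if max: "maximal_cauchy_solution a b x I f g" for I f g
  proof -
    have s: "cauchy_solution a b x I f g" using max by (simp add: maximal_cauchy_solution_def)
    then have "I \<subseteq> {0..}" by (simp add: cauchy_solution_def interval_from_0_def)
    moreover have agree: "\<forall>r\<in>I. F r = f r \<and> G r = g r"
      using cauchy_solution_unique[OF s FG(7,5,6)] by simp
    ultimately have "I = {0..}"
      using max sol unfolding maximal_cauchy_solution_def by metis
    then show ?thesis using agree by simp
  qed
  show ?thesis
  proof (rule exI[of _ F], rule exI[of _ G], intro conjI)
    show "\<forall>I f g. maximal_cauchy_solution a b x I f g \<longrightarrow>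
      I = {0..} \<and> (\<forall>r\<ge>0. f r = F r \<and> g r = G r)"
      using unique by (intro allI impI)
  qed (fact FG maxF)+
qed

section \<open>Orbits and the decay of their energy\<close>

definition fmax :: real where "fmax = sqrt (a - b)"

lemma fmax_pos: "0 < fmax"
  using a_gt b_pos by (simp add: fmax_def)

lemma orbitD:
  assumes "orbit R f g"
  shows "0 \<le> R" "continuous_on {R..} f" "continuous_on {R..} g"
    "\<And>r. R < r \<Longrightarrow> (f has_real_derivative force (f r) (g r) - 2 / r * f r) (at r)"
    "\<And>r. R < r \<Longrightarrow> (g has_real_derivative f r * (1 - (g r)\<^sup>2)) (at r)"
    "\<And>r. R \<le> r \<Longrightarrow> \<bar>g r\<bar> < 1" "energy (f R) (g R) < energy 0 1" "f R \<noteq> 0 \<or> g R \<noteq> 0"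
  using assms unfolding orbit_def by simp_all

lemma orbit_cont:
  assumes "orbit R f g" "R \<le> s"
  shows "continuous_on {s..t} f" "continuous_on {s..t} g" "continuous_on {s..t} (\<lambda>r. energy (f r) (g r))"
proof -
  have "{s..t} \<subseteq> {R..}" using assms(2) by auto
  then show *: "continuous_on {s..t} f" "continuous_on {s..t} g"
    using orbitD(2,3)[OF assms(1)] continuous_on_subset by metis+
  show "continuous_on {s..t} (\<lambda>r. energy (f r) (g r))"
    unfolding energy_def by (intro continuous_intros *) simp_all
qed

lemma one_minus_g2_pos: "\<bar>g\<bar> < 1 \<Longrightarrow> 0 < 1 - g\<^sup>2" for g :: real
  by (simp add: abs_square_less_1)

lemma energy_uminus [simp]: "energy (- f) (- g) = energy f g"
  by (simp add: energy_def)

lemma energy_0_uminus [simp]: "energy 0 (- g) = energy 0 g"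
  by (simp add: energy_def)

lemma force_uminus: "force (- f) (- g) = - force f g"
  by (simp add: force_def algebra_simps)

lemma orbit_uminus:
  assumes "orbit R f g"
  shows "orbit R (\<lambda>r. - f r) (\<lambda>r. - g r)"
  unfolding orbit_def
proof (intro conjI allI impI)
  show "continuous_on {R..} (\<lambda>r. - f r)" "continuous_on {R..} (\<lambda>r. - g r)"
    using orbitD(2,3)[OF assms] by (auto intro: continuous_intros)
  fix r assume "R < r"
  show "((\<lambda>r. - f r) has_real_derivative force (- f r) (- g r) - 2 / r * - f r) (at r)"
    using orbitD(4)[OF assms \<open>R < r\<close>] by (auto intro!: derivative_eq_intros simp: force_uminus)
  show "((\<lambda>r. - g r) has_real_derivative - f r * (1 - (- g r)\<^sup>2)) (at r)"
    using orbitD(5)[OF assms \<open>R < r\<close>] by (auto intro!: derivative_eq_intros)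
qed (use orbitD[OF assms] in auto)

lemma orbit_energy_derivative:
  assumes "orbit R f g" "R < r"
  shows "((\<lambda>r. energy (f r) (g r)) has_real_derivative - (2 / r * (f r)\<^sup>2 * (1 - (g r)\<^sup>2))) (at r)"
  using orbitD[OF assms(1)] assms(2) by (intro energy_derivative) auto

lemma energy_antimono:
  assumes "orbit R f g" "R \<le> s" "s \<le> t"
  shows "energy (f t) (g t) \<le> energy (f s) (g s)"
proof (rule DERIV_nonpos_imp_decreasing_open[of s t "\<lambda>r. energy (f r) (g r)"])
  fix q assume q: "s < q" "q < t"
  have "0 \<le> 2 / q * (f q)\<^sup>2 * (1 - (g q)\<^sup>2)"
    using orbitD(1)[OF assms(1)] orbitD(6)[OF assms(1), of q] q assms(2) one_minus_g2_pos[of "g q"]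
    by (intro mult_nonneg_nonneg) auto
  then show "\<exists>y. ((\<lambda>r. energy (f r) (g r)) has_real_derivative y) (at q) \<and> y \<le> 0"
    using orbit_energy_derivative[OF assms(1), of q] q assms(2) by force
qed (use assms orbit_cont(3)[OF assms(1,2)] in auto)

lemma energy_less_energy_0_1:
  assumes "orbit R f g" "R \<le> r"
  shows "energy (f r) (g r) < energy 0 1"
  using energy_antimono[OF assms(1) order_refl assms(2)] orbitD(7)[OF assms(1)] by linarith

lemma orbit_f_less:
  assumes "orbit R f g" "R \<le> r"
  shows "\<bar>f r\<bar> < fmax"
proof -
  have "(f r)\<^sup>2 < a - b"
    using f_bound_of_energy[OF energy_less_energy_0_1[OF assms] orbitD(6)[OF assms]] .
  then show ?thesis
    unfolding fmax_def by (intro real_less_rsqrt) simp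
qed

text \<open>
  Backward uniqueness at the equilibrium.  On \<open>{s..r}\<close> with \<open>s > 0\<close> the term \<open>2 f / r\<close> is Lipschitz, so
  \<open>f^2 + g^2\<close> decreases at most exponentially and a zero at \<open>r\<close> propagates down to every \<open>s > R\<close>; continuity
  then gives a zero at \<open>R\<close>, also when \<open>R = 0\<close>.
\<close>
lemma orbit_nontrivial:
  assumes orb: "orbit R f g" and "R \<le> r"
  shows "f r \<noteq> 0 \<or> g r \<noteq> 0"
proof (rule ccontr)
  assume "\<not> ?thesis"
  then have z: "f r = 0" "g r = 0" by auto
  then have "R < r" using orbitD(8)[OF orb] \<open>R \<le> r\<close> by (cases "R = r") auto
  define N where "N = fmax + 1"
  have vanish: "f s = 0 \<and> g s = 0" if s: "R < s" "s < r" for s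
  proof -
    define D where "D q = (f q)\<^sup>2 + (g q)\<^sup>2" for q
    define D' where "D' q = 2 * f q * force (f q) (g q) + 2 * g q * (f q * (1 - (g q)\<^sup>2)) - 4 / q * (f q)\<^sup>2" for q
    have "0 < s" using orbitD(1)[OF orb] s by simp
    have "D s * exp (- (4 * lip_const N + 4 / s) * (r - s)) \<le> D r"
    proof (rule exp_comparison_ge)
      show "continuous_on {s..r} D"
        unfolding D_def using s by (intro continuous_intros orbit_cont[OF orb]) auto
      fix q assume q: "s < q" "q < r"
      have "R < q" using s q by simp
      show "(D has_real_derivative D' q) (at q)"
        unfolding D_def D'_def
        by (auto intro!: derivative_eq_intros orbitD(4,5)[OF orb \<open>R < q\<close>]
            simp: power2_eq_square algebra_simps add_divide_distrib diff_divide_distrib)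
      have bd: "\<bar>f q\<bar> \<le> N" "\<bar>g q\<bar> \<le> N" "\<bar>0\<bar> \<le> N"
        using orbit_f_less[OF orb, of q] orbitD(6)[OF orb, of q] fmax_pos \<open>R < q\<close> by (auto simp: N_def)
      have "\<bar>2 * f q * force (f q) (g q) + 2 * g q * (f q * (1 - (g q)\<^sup>2))\<bar> \<le> 4 * lip_const N * D q"
        unfolding D_def
        using vector_field_lipschitz[of "f q" N 0 "g q" 0] bd
        by (intro square_growth_bound lip_const_nonneg) (auto simp: force_def)
      moreover have "4 / q * (f q)\<^sup>2 \<le> 4 / s * D q"
        unfolding D_def using q \<open>0 < s\<close> by (intro mult_mono divide_left_mono) auto
      moreover have "- (4 * lip_const N + 4 / s) * D q = - (4 * lip_const N * D q) - 4 / s * D q"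
        by (simp add: algebra_simps)
      ultimately show "- (4 * lip_const N + 4 / s) * D q \<le> D' q"
        unfolding D'_def by linarith
    qed (use s in auto)
    then have "D s * exp (- (4 * lip_const N + 4 / s) * (r - s)) \<le> 0" by (simp add: D_def z)
    then have "D s \<le> 0" by (simp add: mult_le_0_iff)
    then show ?thesis unfolding D_def by (simp add: sum_power2_le_zero_iff)
  qed
  have "R \<in> closure {R<..<r}" using \<open>R < r\<close> by simp
  then have "f R = 0" "g R = 0"
    using continuous_constant_on_closure[of "{R<..<r}" f 0 R]
      continuous_constant_on_closure[of "{R<..<r}" g 0 R]
      orbit_cont(1,2)[OF orb, of R r] vanish \<open>R < r\<close> by auto
  then show False using orbitD(8)[OF orb] by simp
qed

lemma orbit_later:
  assumes "orbit R f g" "R \<le> S"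
  shows "orbit S f g"
proof -
  have "{S..} \<subseteq> {R..}" using assms(2) by auto
  then have "continuous_on {S..} f" "continuous_on {S..} g"
    using orbitD(2,3)[OF assms(1)] continuous_on_subset by metis+
  then show ?thesis
    unfolding orbit_def
    using orbitD(1,4,5,6)[OF assms(1)] assms(2) energy_less_energy_0_1[OF assms] orbit_nontrivial[OF assms]
    by simp
qed

section \<open>Zeros along an orbit\<close>

lemma energy_on_axis: "energy 0 g = g\<^sup>2 * (a * g\<^sup>2 - 2 * b) / 4"
  by (simp add: energy_def field_simps power2_eq_square power4_eq_xxxx)

lemma energy_pos_at_f_zero:
  assumes "0 < energy 0 g"
  shows "2 * b < a * g\<^sup>2"
  using assms by (simp add: energy_on_axis zero_less_mult_iff)

text \<open>
  If \<open>f\<close> vanishes on an interval, the orbit is an equilibrium there, and the equilibria with \<open>f = 0\<close> other than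
  the origin have negative energy.
\<close>
lemma f_nonzero_somewhere:
  assumes orb: "orbit R f g" and st: "R \<le> s" "s < t" and E: "0 \<le> energy (f t) (g t)"
  shows "\<exists>r. s < r \<and> r < t \<and> f r \<noteq> 0"
proof (rule ccontr)
  assume "\<not> ?thesis"
  then have z: "f r = 0" if "s < r" "r < t" for r using that by blast
  define r where "r = (s + t) / 2"
  have r: "s < r" "r < t" using st by (auto simp: r_def)
  have "(f has_real_derivative 0) (at r)"
  proof (rule has_field_derivative_transform_within_open[of "\<lambda>_. 0"])
    show "((\<lambda>_. 0) has_real_derivative 0) (at r)" by simp
    show "open {s<..<t}" "r \<in> {s<..<t}" "\<And>x. x \<in> {s<..<t} \<Longrightarrow> 0 = f x" using r z by auto
  qed
  moreover have "(f has_real_derivative force (f r) (g r) - 2 / r * f r) (at r)"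
    using orbitD(4)[OF orb, of r] r st by simp
  ultimately have "force (f r) (g r) - 2 / r * f r = 0" by (rule DERIV_unique[symmetric])
  then have "force 0 (g r) = 0" using z[OF r] by simp
  moreover have "g r \<noteq> 0" using orbit_nontrivial[OF orb, of r] z[OF r] r st by auto
  ultimately have eq: "a * (g r)\<^sup>2 = b" by (simp add: force_def)
  have "0 \<le> energy (f r) (g r)" using energy_antimono[OF orb, of r t] E r st by auto
  then have "0 \<le> (g r)\<^sup>2 * (b - 2 * b) / 4" using z[OF r] eq by (simp add: energy_on_axis)
  moreover have "(g r)\<^sup>2 * b > 0" using \<open>g r \<noteq> 0\<close> b_pos by simp
  ultimately show False by (simp add: algebra_simps)
qed

lemma energy_strict:
  assumes orb: "orbit R f g" and st: "R \<le> s" "s < t" and E: "energy (f s) (g s) \<le> 0"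
  shows "energy (f t) (g t) < 0"
proof (rule ccontr)
  assume "\<not> ?thesis"
  then have Et: "0 \<le> energy (f t) (g t)" by simp
  obtain r where r: "s < r" "r < t" "f r \<noteq> 0" using f_nonzero_somewhere[OF orb st Et] by blast
  have const: "energy (f q) (g q) = 0" if "s < q" "q < t" for q
    using energy_antimono[OF orb, of s q] energy_antimono[OF orb, of q t] that st E Et by auto
  have "((\<lambda>r. energy (f r) (g r)) has_real_derivative 0) (at r)"
  proof (rule has_field_derivative_transform_within_open[of "\<lambda>_. 0"])
    show "((\<lambda>_. 0) has_real_derivative 0) (at r)" by simp
    show "open {s<..<t}" "r \<in> {s<..<t}" "\<And>x. x \<in> {s<..<t} \<Longrightarrow> 0 = energy (f x) (g x)"
      using r const by auto
  qed
  moreover have "((\<lambda>r. energy (f r) (g r)) has_real_derivative - (2 / r * (f r)\<^sup>2 * (1 - (g r)\<^sup>2))) (at r)"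
    using orbit_energy_derivative[OF orb, of r] r st by simp
  ultimately have "- (2 / r * (f r)\<^sup>2 * (1 - (g r)\<^sup>2)) = 0" by (rule DERIV_unique[symmetric])
  moreover have "0 < 2 / r * (f r)\<^sup>2 * (1 - (g r)\<^sup>2)"
    using r st orbitD(1)[OF orb] one_minus_g2_pos[OF orbitD(6)[OF orb, of r]]
    by (intro mult_pos_pos) auto
  ultimately show False by linarith
qed

lemma g_zero_energy_pos:
  assumes "orbit R f g" "R \<le> r" "g r = 0"
  shows "0 < energy (f r) (g r)"
  using orbit_nontrivial[OF assms(1,2)] assms(3) by (simp add: energy_def)

text \<open>
  The energy on \<open>g = 0\<close> is \<open>f^2 / 2\<close>, which is positive because the orbit avoids the origin.
\<close>
lemma no_g_zero_after_nonpos_energy: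
  assumes "orbit R f g" "R \<le> s" "s \<le> r" "energy (f s) (g s) \<le> 0"
  shows "g r \<noteq> 0"
  using g_zero_energy_pos[OF assms(1), of r] energy_antimono[OF assms(1,2,3)] assms by fastforce

lemma g_mean_value:
  assumes orb: "orbit R f g" and uv: "R \<le> u" "u < v"
  shows "\<exists>z. u < z \<and> z < v \<and> g v - g u = (v - u) * (f z * (1 - (g z)\<^sup>2))"
proof -
  have "\<exists>l z. u < z \<and> z < v \<and> (g has_real_derivative l) (at z) \<and> g v - g u = (v - u) * l"
    by (rule MVT[OF \<open>u < v\<close> orbit_cont(2)[OF orb \<open>R \<le> u\<close>]])
      (use uv in \<open>auto simp: real_differentiable_def intro!: exI orbitD(5)[OF orb]\<close>)
  then obtain l z where z: "u < z" "z < v" "(g has_real_derivative l) (at z)" "g v - g u = (v - u) * l"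
    by blast
  then have "l = f z * (1 - (g z)\<^sup>2)"
    using DERIV_unique[OF z(3) orbitD(5)[OF orb, of z]] uv by simp
  then show ?thesis using z by blast
qed

lemma g_zeros_separated:
  assumes orb: "orbit R f g" and uv: "R \<le> u" "u < v" "g u = 0" "g v = 0"
  shows "\<exists>z. u < z \<and> z < v \<and> f z = 0"
proof -
  obtain z where z: "u < z" "z < v" "(v - u) * (f z * (1 - (g z)\<^sup>2)) = 0"
    using g_mean_value[OF orb uv(1,2)] uv by auto
  then show ?thesis using one_minus_g2_pos[OF orbitD(6)[OF orb, of z]] uv by auto
qed

text \<open>
  The product \<open>r^2 f\<close> has derivative \<open>r^2 force f g\<close>, without a singular term.  So the argument also covers
  the zero of \<open>f\<close> at the origin, where the equation itself is not available.
\<close>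
lemma f_negative_right_of_zero:
  assumes orb: "orbit R f g" and u: "R \<le> u" "f u = 0" "0 < g u" and E: "0 < energy (f u) (g u)"
  shows "\<exists>e>0. \<forall>r. u < r \<and> r < u + e \<longrightarrow> f r < 0"
proof -
  have "2 * b < a * (g u)\<^sup>2" using energy_pos_at_f_zero E u by simp
  then have neg: "force (f u) (g u) < 0"
    unfolding force_def using u b_pos by (simp add: mult_pos_neg)
  have "continuous_on {u..} (\<lambda>r. force (f r) (g r))"
    unfolding force_def
    using orbitD(2,3)[OF orb] u(1) by (intro continuous_intros) (auto intro: continuous_on_subset)
  then have "((\<lambda>r. force (f r) (g r)) \<longlongrightarrow> force (f u) (g u)) (at u within {u..})"
    by (simp add: continuous_on_def)
  then have "\<forall>\<^sub>F r in at u within {u..}. force (f r) (g r) < 0"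
    using neg by (rule order_tendstoD)
  then obtain e where e: "e > 0" "\<And>r. u < r \<Longrightarrow> r < u + e \<Longrightarrow> force (f r) (g r) < 0"
    unfolding eventually_at by (auto simp: dist_real_def)
  have "f r < 0" if r: "u < r" "r < u + e" for r
  proof -
    have "r\<^sup>2 * f r < u\<^sup>2 * f u"
    proof (rule DERIV_neg_imp_decreasing_open[of u r "\<lambda>r. r\<^sup>2 * f r"])
      fix q assume q: "u < q" "q < r"
      have q0: "0 < q" "R < q" using q u orbitD(1)[OF orb] by auto
      have "((\<lambda>r. r\<^sup>2 * f r) has_real_derivative q\<^sup>2 * force (f q) (g q)) (at q)"
        using q0 by (auto intro!: derivative_eq_intros orbitD(4)[OF orb] simp: field_simps power2_eq_square)
      moreover have "q\<^sup>2 * force (f q) (g q) < 0" using e(2)[of q] q r q0 by (simp add: mult_pos_neg)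
      ultimately show "\<exists>y. ((\<lambda>r. r\<^sup>2 * f r) has_real_derivative y) (at q) \<and> y < 0" by blast
    qed (use r in simp, intro continuous_intros orbit_cont[OF orb u(1)])
    then show "f r < 0" using u by (simp add: mult_less_0_iff)
  qed
  then show ?thesis using e(1) by blast
qed

lemma f_zeros_separated_aux:
  assumes orb: "orbit R f g" and uv: "R \<le> u" "u < v" "f u = 0" "f v = 0"
    and E: "0 < energy (f v) (g v)" and pos: "\<And>r. u \<le> r \<Longrightarrow> r \<le> v \<Longrightarrow> 0 < g r"
  shows False
proof -
  have Epos: "0 < energy (f r) (g r)" if "u \<le> r" "r \<le> v" for r
    using energy_antimono[OF orb, of r v] that uv E by auto
  obtain e where e: "e > 0" "\<And>r. u < r \<Longrightarrow> r < u + e \<Longrightarrow> f r < 0"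
    using f_negative_right_of_zero[OF orb uv(1,3)] pos[of u] Epos[of u] uv by auto
  define s where "s = min (u + e / 2) ((u + v) / 2)"
  have s: "u < s" "s < u + e" "s < v" using e(1) uv by (auto simp: s_def min_def)
  have "f s < 0" using e(2) s by simp
  have "continuous_on {s..v} f" using orbit_cont(1)[OF orb] uv s by auto
  then obtain w where w: "s < w" "w \<le> v" "f w = 0" "\<And>q. s \<le> q \<Longrightarrow> q < w \<Longrightarrow> f q < 0"
    using first_hit[of s v f 0] \<open>f s < 0\<close> s uv by auto
  have "2 * b < a * (g w)\<^sup>2" using energy_pos_at_f_zero[of "g w"] Epos[of w] w s by auto
  then have neg: "force (f w) (g w) - 2 / w * f w < 0"
    unfolding force_def using pos[of w] w s b_pos by (simp add: mult_pos_neg)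
  have "(f has_real_derivative force (f w) (g w) - 2 / w * f w) (at w)"
    using orbitD(4)[OF orb, of w] w s uv by auto
  from DERIV_neg_dec_left[OF this neg]
  obtain d where d: "d > 0" "\<And>h. 0 < h \<Longrightarrow> h < d \<Longrightarrow> f w < f (w - h)" by blast
  define h where "h = min (d / 2) (w - s)"
  have "0 < h" "h < d" "s \<le> w - h" using d w by (auto simp: h_def min_def)
  then show False using d(2)[of h] w(3) w(4)[of "w - h"] by simp
qed

text \<open>
  At a zero of \<open>f\<close> with positive energy the sign of \<open>f'\<close> is opposite to that of \<open>g\<close>.  So while \<open>g\<close> keeps
  its sign, \<open>f\<close> can cross zero in one direction only.
\<close>
lemma f_zeros_separated:
  assumes orb: "orbit R f g" and uv: "R \<le> u" "u < v" "f u = 0" "f v = 0"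
    and E: "0 < energy (f v) (g v)"
  shows "\<exists>z. u < z \<and> z < v \<and> g z = 0"
proof (rule ccontr)
  assume "\<not> ?thesis"
  then have "g z \<noteq> 0" if "u \<le> z" "z \<le> v" for z
    using orbit_nontrivial[OF orb, of u] orbit_nontrivial[OF orb, of v] uv that
    by (metis le_less less_imp_le order_trans)
  then consider "\<forall>r\<in>{u..v}. g r < 0" | "\<forall>r\<in>{u..v}. 0 < g r"
    using nonvanishing_sign[of "{u..v}" g] orbit_cont(2)[OF orb uv(1), of v]
    by (auto simp: is_interval_cc)
  then show False
  proof cases
    case 1
    then show ?thesis
      using f_zeros_separated_aux[OF orbit_uminus[OF orb] uv(1,2)] uv E by simp
  next
    case 2
    then show ?thesis
      using f_zeros_separated_aux[OF orb uv] E by simp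
  qed
qed

section \<open>Orbits that stop rotating\<close>

text \<open>
  Here \<open>g\<close> is monotone and the energy is monotone, so both converge; as the energy determines \<open>f^2\<close> from \<open>g\<close>,
  also \<open>f\<close> converges.  The limit must be an equilibrium, and of the candidates only the origin has
  nonnegative energy.
\<close>
lemma nonrotating_orbit_tendsto_aux:
  assumes orb: "orbit R f g" and neg: "\<And>r. R < r \<Longrightarrow> f r < 0"
    and E: "\<And>r. R < r \<Longrightarrow> 0 < energy (f r) (g r)"
  shows "(f \<longlongrightarrow> 0) at_top \<and> (g \<longlongrightarrow> 0) at_top"
proof -
  have big: "\<forall>\<^sub>F r in at_top. R < r" by (rule eventually_gt_at_top)
  have ganti: "g s \<le> g r" if "R < r" "r \<le> s" for r s
  proof (rule DERIV_nonpos_imp_decreasing_open[OF \<open>r \<le> s\<close>])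
    fix q assume q: "r < q" "q < s"
    have "f q * (1 - (g q)\<^sup>2) \<le> 0"
      using neg[of q] one_minus_g2_pos[OF orbitD(6)[OF orb, of q]] q that by (simp add: mult_le_0_iff)
    then show "\<exists>y. (g has_real_derivative y) (at q) \<and> y \<le> 0"
      using orbitD(5)[OF orb, of q] q that by auto
  qed (use orbit_cont(2)[OF orb] that in auto)
  have g_gt: "- 1 \<le> g r" if "R < r" for r using orbitD(6)[OF orb, of r] that by auto
  obtain l where l: "(g \<longlongrightarrow> l) at_top" "\<And>r. R < r \<Longrightarrow> l \<le> g r" "- 1 \<le> l"
    using antimono_bounded_tendsto_at_top[of R g "-1"] ganti g_gt by blast
  have Eanti: "energy (f s) (g s) \<le> energy (f r) (g r)" if "R < r" "r \<le> s" for r s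
    using energy_antimono[OF orb, of r s] that by simp
  have E0: "0 \<le> energy (f r) (g r)" if "R < r" for r using E[OF that] by simp
  obtain e where e: "((\<lambda>r. energy (f r) (g r)) \<longlongrightarrow> e) at_top"
    "\<And>r. R < r \<Longrightarrow> e \<le> energy (f r) (g r)" "0 \<le> e"
    using antimono_bounded_tendsto_at_top[of R "\<lambda>r. energy (f r) (g r)" 0] Eanti E0 by blast
  have "l < 1" using l(2)[of "R + 1"] orbitD(6)[OF orb, of "R + 1"] by auto
  \<comment> \<open>On \<open>g = - 1\<close> the energy is that of \<open>(0, 1)\<close>, which the orbit cannot regain.\<close>
  have "l \<noteq> - 1"
  proof
    assume "l = - 1"
    have "((\<lambda>r. 1 - (g r)\<^sup>2) \<longlongrightarrow> 1 - l\<^sup>2) at_top" by (intro tendsto_intros l)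
    then have lim: "((\<lambda>r. fmax\<^sup>2 * (1 - (g r)\<^sup>2)) \<longlongrightarrow> 0) at_top"
      using \<open>l = - 1\<close> tendsto_mult_right_zero by fastforce
    have "((\<lambda>r. (f r)\<^sup>2 * (1 - (g r)\<^sup>2)) \<longlongrightarrow> 0) at_top"
    proof (rule Lim_null_comparison[OF _ lim], rule eventually_mono[OF big])
      fix r assume "R < r"
      have "(f r)\<^sup>2 \<le> fmax\<^sup>2"
        using orbit_f_less[OF orb, of r] \<open>R < r\<close> fmax_pos by (simp add: abs_le_square_iff[symmetric])
      then show "norm ((f r)\<^sup>2 * (1 - (g r)\<^sup>2)) \<le> fmax\<^sup>2 * (1 - (g r)\<^sup>2)"
        using one_minus_g2_pos[OF orbitD(6)[OF orb, of r]] \<open>R < r\<close>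
        by (simp add: abs_mult mult_right_mono)
    qed
    then have "((\<lambda>r. energy (f r) (g r)) \<longlongrightarrow> 0 / 2 + a * l ^ 4 / 4 - b * l\<^sup>2 / 2) at_top"
      unfolding energy_def by (intro tendsto_intros l) auto
    then have "e = energy 0 1"
      using tendsto_unique[OF _ e(1)] \<open>l = - 1\<close> by (force simp: energy_def)
    then show False using e(2)[of "R + 1"] energy_less_energy_0_1[OF orb, of "R + 1"] by simp
  qed
  then have l1: "0 < 1 - l\<^sup>2"
    using l(3) \<open>l < 1\<close> by (intro one_minus_g2_pos) auto
  \<comment> \<open>The limit of \<open>f^2\<close>, read off from the limits of the energy and of \<open>g\<close>.\<close>
  define P where "P = 2 * (e - a * l ^ 4 / 4 + b * l\<^sup>2 / 2) / (1 - l\<^sup>2)"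
  have "((\<lambda>r. 2 * (energy (f r) (g r) - a * g r ^ 4 / 4 + b * (g r)\<^sup>2 / 2) / (1 - (g r)\<^sup>2)) \<longlongrightarrow> P) at_top"
    unfolding P_def using l1 by (intro tendsto_intros l e) auto
  then have f2: "((\<lambda>r. (f r)\<^sup>2) \<longlongrightarrow> P) at_top"
  proof (rule Lim_transform_eventually, intro eventually_mono[OF big])
    fix r assume "R < r"
    then have "1 - (g r)\<^sup>2 \<noteq> 0" using one_minus_g2_pos[OF orbitD(6)[OF orb, of r]] by auto
    then show "2 * (energy (f r) (g r) - a * g r ^ 4 / 4 + b * (g r)\<^sup>2 / 2) / (1 - (g r)\<^sup>2) = (f r)\<^sup>2"
      by (simp add: energy_def field_simps)
  qed
  have fP: "(f \<longlongrightarrow> - sqrt P) at_top"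
  proof (rule Lim_transform_eventually)
    show "((\<lambda>r. - sqrt ((f r)\<^sup>2)) \<longlongrightarrow> - sqrt P) at_top" by (intro tendsto_intros f2)
    show "\<forall>\<^sub>F r in at_top. - sqrt ((f r)\<^sup>2) = f r"
    proof (rule eventually_mono[OF big])
      fix r assume "R < r" then show "- sqrt ((f r)\<^sup>2) = f r" using neg[of r] by simp
    qed
  qed
  have "- sqrt P * (1 - l\<^sup>2) = 0"
  proof (rule derivative_limit_zero[OF l(1)])
    show "((\<lambda>r. f r * (1 - (g r)\<^sup>2)) \<longlongrightarrow> - sqrt P * (1 - l\<^sup>2)) at_top" by (intro tendsto_intros fP l)
  qed (rule orbitD(5)[OF orb])
  then have "sqrt P = 0" using l1 by simp
  then have f0: "(f \<longlongrightarrow> 0) at_top" using fP by simp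
  have "force 0 l - 0 * 0 = 0"
  proof (rule derivative_limit_zero[OF f0])
    have "((\<lambda>r. 2 / r :: real) \<longlongrightarrow> 0) at_top"
      by (intro tendsto_divide_0[OF tendsto_const] filterlim_at_top_imp_at_infinity filterlim_ident)
    then show "((\<lambda>r. force (f r) (g r) - 2 / r * f r) \<longlongrightarrow> force 0 l - 0 * 0) at_top"
      unfolding force_def by (intro tendsto_intros f0 l)
  qed (rule orbitD(4)[OF orb])
  then have fl: "l = 0 \<or> a * l\<^sup>2 = b" by (auto simp: force_def)
  have "((\<lambda>r. energy (f r) (g r)) \<longlongrightarrow> energy 0 l) at_top"
    unfolding energy_def by (intro tendsto_intros f0 l)  auto
  then have "0 \<le> energy 0 l"
    using tendsto_unique[OF _ e(1)] e(3) by fastforce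
  then have "\<not> a * l\<^sup>2 = b \<or> l = 0"
    using b_pos by (auto simp: energy_on_axis zero_le_mult_iff)
  then show ?thesis using fl f0 l(1) by auto
qed

lemma nonrotating_orbit_tendsto:
  assumes orb: "orbit R f g" and nz: "\<And>r. R < r \<Longrightarrow> f r \<noteq> 0"
    and E: "\<And>r. R < r \<Longrightarrow> 0 < energy (f r) (g r)"
  shows "(f \<longlongrightarrow> 0) at_top" "(g \<longlongrightarrow> 0) at_top"
proof -
  have "continuous_on {R<..} f" using orbitD(2)[OF orb] by (rule continuous_on_subset) auto
  then consider "\<forall>r\<in>{R<..}. f r < 0" | "\<forall>r\<in>{R<..}. 0 < f r"
    using nonvanishing_sign[of "{R<..}" f] nz by (auto simp: is_interval_oi)
  then have "(f \<longlongrightarrow> 0) at_top \<and> (g \<longlongrightarrow> 0) at_top"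
  proof cases
    case 1 then show ?thesis using nonrotating_orbit_tendsto_aux[OF orb] E by auto
  next
    case 2
    then have "((\<lambda>r. - f r) \<longlongrightarrow> 0) at_top \<and> ((\<lambda>r. - g r) \<longlongrightarrow> 0) at_top"
      using nonrotating_orbit_tendsto_aux[OF orbit_uminus[OF orb]] E by auto
    then show ?thesis using tendsto_minus_cancel_left[of f 0] tendsto_minus_cancel_left[of g 0] by simp
  qed
  then show "(f \<longlongrightarrow> 0) at_top" "(g \<longlongrightarrow> 0) at_top" by auto
qed

section \<open>Energy loss per half turn\<close>

lemma g_antimono_while_f_nonpos:
  assumes orb: "orbit R f g" and st: "R \<le> s" "s \<le> t"
    and neg: "\<And>r. s < r \<Longrightarrow> r < t \<Longrightarrow> f r \<le> 0"
  shows "g t \<le> g s"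
proof (rule DERIV_nonpos_imp_decreasing_open[OF \<open>s \<le> t\<close>])
  fix q assume q: "s < q" "q < t"
  have "f q * (1 - (g q)\<^sup>2) \<le> 0"
    using neg[OF q] one_minus_g2_pos[OF orbitD(6)[OF orb, of q]] q st by (simp add: mult_le_0_iff)
  then show "\<exists>y. (g has_real_derivative y) (at q) \<and> y \<le> 0"
    using orbitD(5)[OF orb, of q] q st by auto
qed (rule orbit_cont(2)[OF orb st(1)])

text \<open>
  Because \<open>g' = f (1 - g^2)\<close>, the derivative of the energy equals \<open>- (2 / r) f g'\<close>.  With \<open>\<bar>f\<bar> < fmax\<close> the loss is
  at most \<open>2 fmax / R\<close> times the change of the monotone function \<open>g\<close>, however long the passage takes.
\<close>
lemma energy_loss_bound_aux:
  assumes orb: "orbit R f g" and st: "0 < R" "R \<le> s" "s \<le> t"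
    and neg: "\<And>r. s < r \<Longrightarrow> r < t \<Longrightarrow> f r < 0"
  shows "energy (f s) (g s) - 4 * fmax / R \<le> energy (f t) (g t)"
proof -
  let ?h = "\<lambda>r. 2 * fmax / R * g r - energy (f r) (g r)"
  have "?h t \<le> ?h s"
  proof (rule DERIV_nonpos_imp_decreasing_open[of s t ?h])
    fix q assume q: "s < q" "q < t"
    have "R < q" using q st by simp
    let ?d = "f q * (1 - (g q)\<^sup>2) * (2 * fmax / R + 2 / q * f q)"
    have "(?h has_real_derivative
        2 * fmax / R * (f q * (1 - (g q)\<^sup>2)) - - (2 / q * (f q)\<^sup>2 * (1 - (g q)\<^sup>2))) (at q)"
      by (intro DERIV_diff DERIV_cmult orbitD(5)[OF orb \<open>R < q\<close>] orbit_energy_derivative[OF orb \<open>R < q\<close>])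
    moreover have "2 * fmax / R * (f q * (1 - (g q)\<^sup>2)) - - (2 / q * (f q)\<^sup>2 * (1 - (g q)\<^sup>2)) = ?d"
      by (simp add: power2_eq_square algebra_simps add_divide_distrib diff_divide_distrib)
    moreover have "?d \<le> 0"
    proof (rule mult_nonpos_nonneg)
      show "f q * (1 - (g q)\<^sup>2) \<le> 0"
        using neg[OF q] one_minus_g2_pos[OF orbitD(6)[OF orb, of q]] \<open>R < q\<close> by (simp add: mult_le_0_iff)
      have "2 / q * - f q \<le> 2 / R * fmax"
        using orbit_f_less[OF orb, of q] neg[OF q] \<open>R < q\<close> \<open>0 < R\<close> by (intro mult_mono divide_left_mono) auto
      then show "0 \<le> 2 * fmax / R + 2 / q * f q" by simp
    qed
    ultimately show "\<exists>y. (?h has_real_derivative y) (at q) \<and> y \<le> 0" by metis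
  qed (use st in simp, intro continuous_intros orbit_cont[OF orb st(2)])
  moreover have "2 * fmax / R * (g s - g t) \<le> 2 * fmax / R * 2"
    using orbitD(6)[OF orb, of s] orbitD(6)[OF orb, of t] st fmax_pos by (intro mult_left_mono) auto
  ultimately show ?thesis by (simp add: algebra_simps add_divide_distrib diff_divide_distrib)
qed

lemma energy_loss_bound:
  assumes orb: "orbit R f g" and st: "0 < R" "R \<le> s" "s \<le> t"
    and nz: "\<And>r. s < r \<Longrightarrow> r < t \<Longrightarrow> f r \<noteq> 0"
  shows "energy (f s) (g s) - 4 * fmax / R \<le> energy (f t) (g t)"
proof -
  have "continuous_on {s<..<t} f"
    using orbit_cont(1)[OF orb st(2), of t] by (rule continuous_on_subset) auto
  then consider "\<forall>r\<in>{s<..<t}. f r < 0" | "\<forall>r\<in>{s<..<t}. 0 < f r"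
    using nonvanishing_sign[of "{s<..<t}" f] nz by (auto simp: is_interval_oo)
  then show ?thesis
  proof cases
    case 1 then show ?thesis using energy_loss_bound_aux[OF orb st] by auto
  next
    case 2 then show ?thesis using energy_loss_bound_aux[OF orbit_uminus[OF orb] st] by auto
  qed
qed

text \<open>
  Without a further zero of \<open>f\<close> the orbit would tend to the origin and its energy to \<open>0\<close>, but until the next zero
  the energy cannot fall by more than \<open>4 fmax / R\<close>.
\<close>
lemma next_f_zero:
  assumes orb: "orbit R f g" and s: "0 < R" "R \<le> s" and "0 \<le> c"
    and E: "c + 4 * fmax / R < energy (f s) (g s)"
  shows "\<exists>t>s. f t = 0 \<and> c < energy (f t) (g t)"
proof -
  let ?E = "\<lambda>r. energy (f r) (g r)" and ?L = "4 * fmax / R"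
  have L: "0 < ?L" using s fmax_pos by simp
  have "(?E \<longlongrightarrow> ?E s) (at s within {s..s + 1})"
    using orbit_cont(3)[OF orb s(2), of "s + 1"] by (simp add: continuous_on_def)
  then have "\<forall>\<^sub>F r in at s within {s..s + 1}. c + ?L < ?E r"
    using E by (rule order_tendstoD)
  then obtain d where d: "d > 0" "\<And>r. s < r \<Longrightarrow> r \<le> s + 1 \<Longrightarrow> r < s + d \<Longrightarrow> c + ?L < ?E r"
    unfolding eventually_at by (auto simp: dist_real_def)
  define s1 where "s1 = s + min 1 (d / 2)"
  have s1: "s < s1" "c + ?L < ?E s1"
    using d(1) d(2)[of s1] by (auto simp: s1_def min_def)
  obtain s' where s': "s < s'" "s' < s1" "f s' \<noteq> 0"
    using f_nonzero_somewhere[OF orb s(2) s1(1)] s1(2) L \<open>0 \<le> c\<close> by force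
  have Es': "c + ?L < ?E s'" using energy_antimono[OF orb, of s' s1] s1 s' s by simp
  have loss: "c < ?E r" if "s' \<le> r" "\<And>q. s' < q \<Longrightarrow> q < r \<Longrightarrow> f q \<noteq> 0" for r
    using energy_loss_bound[OF orb s(1), of s' r] that s s' Es' by force
  have "\<exists>t>s'. f t = 0"
  proof (rule ccontr)
    assume "\<not> ?thesis"
    then have nz: "f r \<noteq> 0" if "s' < r" for r using that by blast
    have orb': "orbit s' f g" using orbit_later[OF orb, of s'] s s' by simp
    have pos: "0 < ?E r" if "s' < r" for r using loss[of r] nz that \<open>0 \<le> c\<close> by force
    have lim: "(f \<longlongrightarrow> 0) at_top" "(g \<longlongrightarrow> 0) at_top"
      by (rule nonrotating_orbit_tendsto[OF orb' nz pos]; assumption)+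
    have "(?E \<longlongrightarrow> energy 0 0) at_top"
      unfolding energy_def by (intro tendsto_intros lim) auto
    then have lim0: "(?E \<longlongrightarrow> 0) at_top" by (simp add: energy_def)
    have "\<forall>\<^sub>F r in at_top. ?E s' - ?L \<le> ?E r"
      using energy_loss_bound[OF orb s(1), of s'] nz s s'
      by (intro eventually_mono[OF eventually_gt_at_top[of s']]) auto
    then have "?E s' - ?L \<le> 0"
      by (rule tendsto_lowerbound[OF lim0]) simp
    then show False using Es' \<open>0 \<le> c\<close> by simp
  qed
  then obtain t0 where t0: "s' < t0" "f t0 = 0" by blast
  obtain t where t: "s' < t" "t \<le> t0" "f t = 0" "\<And>q. s' \<le> q \<Longrightarrow> q < t \<Longrightarrow> f q \<noteq> 0"
    using first_zero[of s' t0 f] orbit_cont(1)[OF orb, of s' t0] t0 s s' by auto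
  then show ?thesis using loss[of t] s' by (intro exI[of _ t]) simp
qed

lemma many_f_zeros:
  assumes orb: "orbit R f g" and "0 < R"
  shows "R \<le> s \<Longrightarrow> real n * (4 * fmax / R) < energy (f s) (g s) \<Longrightarrow>
    \<exists>T. finite T \<and> card T = n \<and> (\<forall>t\<in>T. s < t \<and> f t = 0 \<and> 0 < energy (f t) (g t))"
proof (induction n arbitrary: s)
  case 0
  then show ?case by (intro exI[of _ "{}"]) auto
next
  case (Suc n)
  have "real n * (4 * fmax / R) + 4 * fmax / R < energy (f s) (g s)"
    using Suc.prems(2) by (simp only: of_nat_Suc) (simp add: algebra_simps add_divide_distrib)
  moreover have n0: "0 \<le> real n * (4 * fmax / R)" using fmax_pos \<open>0 < R\<close> by simp
  ultimately obtain t where t: "s < t" "f t = 0" "real n * (4 * fmax / R) < energy (f t) (g t)"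
    using next_f_zero[OF orb \<open>0 < R\<close> Suc.prems(1)] by blast
  obtain T where T: "finite T" "card T = n" "\<And>u. u \<in> T \<Longrightarrow> t < u \<and> f u = 0 \<and> 0 < energy (f u) (g u)"
    using Suc.IH[of t] t Suc.prems(1) by auto
  have "t \<notin> T" using T(3) by blast
  show ?case
  proof (intro exI[of _ "insert t T"] conjI ballI)
    fix u assume "u \<in> insert t T"
    then consider "u = t" | "u \<in> T" by blast
    then show "s < u" "f u = 0" "0 < energy (f u) (g u)"
      using T(3)[of u] t n0 by (cases; simp)+
  qed (use T \<open>t \<notin> T\<close> in auto)
qed

lemma many_g_zeros:
  assumes orb: "orbit R f g" and "0 < R"
    and "real (n + 2) * (4 * fmax / R) < energy (f R) (g R)" and fin: "finite {r. R < r \<and> g r = 0}"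
  shows "n < card {r. R < r \<and> g r = 0}"
proof -
  obtain T where T: "finite T" "card T = n + 2" "\<And>t. t \<in> T \<Longrightarrow> R < t \<and> f t = 0 \<and> 0 < energy (f t) (g t)"
    using many_f_zeros[OF orb \<open>0 < R\<close> order_refl assms(3)] by blast
  have "card T \<le> card {r. R < r \<and> g r = 0} + 1"
  proof (rule interlaced_card[THEN conjunct2, OF fin])
    fix u v assume uv: "u \<in> T" "v \<in> T" "u < v"
    then obtain z where "u < z" "z < v" "g z = 0"
      using f_zeros_separated[OF orb, of u v] T(3)[of u] T(3)[of v] by auto
    then show "\<exists>z\<in>{r. R < r \<and> g r = 0}. u < z \<and> z < v"
      using T(3)[OF uv(1)] by (intro bexI[of _ z]) auto
  qed
  then show ?thesis using T by simp
qed

section \<open>Passage near the origin\<close>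

text \<open>
  Half of the eigenvalue \<open>sqrt b\<close> of the linearization at the saddle; the factor leaves room for the
  nonlinear terms in the whole region \<open>a g^2 \<le> b\<close>.
\<close>
definition rate :: real where "rate = sqrt b / 2"

lemma rate_pos: "0 < rate"
  using b_pos by (simp add: rate_def)

text \<open>
  For positive energy, \<open>f^2 (1 - g^2)\<close> exceeds \<open>g^2 (b - a g^2 / 2)\<close>; in the region \<open>a g^2 \<le> b\<close> this separates
  the orbit from the axis \<open>f = 0\<close> and gives \<open>\<bar>g'\<bar> \<ge> rate \<bar>g\<bar>\<close>, which is the source of all exponential rates.
\<close>
lemma small_g_estimates:
  assumes small: "a * g\<^sup>2 \<le> b" and E: "0 < energy f g"
  shows "1 / 2 \<le> 1 - g\<^sup>2" "rate * \<bar>g\<bar> \<le> \<bar>f\<bar> * (1 - g\<^sup>2)" "f \<noteq> 0"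
proof -
  show f0: "f \<noteq> 0"
  proof
    assume "f = 0"
    then have "2 * b < a * g\<^sup>2" using energy_pos_at_f_zero E by simp
    then show False using small b_pos by simp
  qed
  have "2 * b * g\<^sup>2 \<le> a * g\<^sup>2" using a_gt by (intro mult_right_mono) auto
  then have "b * (2 * g\<^sup>2) \<le> b * 1" using small by simp
  then show half: "1 / 2 \<le> 1 - g\<^sup>2"
    using b_pos by (simp only: mult_le_cancel_left_pos)
  have "g\<^sup>2 * (b / 2) \<le> g\<^sup>2 * (b - a * g\<^sup>2 / 2)"
    using small by (intro mult_left_mono) auto
  also have "\<dots> \<le> f\<^sup>2 * (1 - g\<^sup>2)"
    using E by (simp add: energy_def algebra_simps power2_eq_square power4_eq_xxxx
        add_divide_distrib diff_divide_distrib)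
  finally have "g\<^sup>2 * (b / 2) * (1 / 2) \<le> f\<^sup>2 * (1 - g\<^sup>2) * (1 - g\<^sup>2)"
    by (rule mult_mono) (use half b_pos in auto)
  moreover have "(rate * \<bar>g\<bar>)\<^sup>2 = g\<^sup>2 * (b / 2) * (1 / 2)"
    using b_pos by (simp add: rate_def power_mult_distrib power_divide)
  moreover have "(\<bar>f\<bar> * (1 - g\<^sup>2))\<^sup>2 = f\<^sup>2 * (1 - g\<^sup>2) * (1 - g\<^sup>2)"
    by (simp add: power_mult_distrib power2_eq_square)
  ultimately have "(rate * \<bar>g\<bar>)\<^sup>2 \<le> (\<bar>f\<bar> * (1 - g\<^sup>2))\<^sup>2" by simp
  then show "rate * \<bar>g\<bar> \<le> \<bar>f\<bar> * (1 - g\<^sup>2)"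
    by (rule power2_le_imp_le) (use half in auto)
qed

lemma f_negative_while_g_small:
  assumes orb: "orbit R f g" and st: "R \<le> s" and "f s < 0"
    and small: "\<And>r. s \<le> r \<Longrightarrow> r \<le> t \<Longrightarrow> a * (g r)\<^sup>2 \<le> b" and E: "0 < energy (f t) (g t)"
    and r: "s \<le> r" "r \<le> t"
  shows "f r < 0"
proof -
  have nz: "f q \<noteq> 0" if "q \<in> {s..t}" for q
    using small_g_estimates(3)[of "g q" "f q"] small[of q] energy_antimono[OF orb, of q t] that E st by auto
  have "(\<forall>q\<in>{s..t}. f q < 0) \<or> (\<forall>q\<in>{s..t}. 0 < f q)"
    by (rule nonvanishing_sign) (use orbit_cont(1)[OF orb st, of t] nz in \<open>auto simp: is_interval_cc\<close>)
  then show ?thesis using r \<open>f s < 0\<close> by force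
qed

text \<open>
  One constant that serves both the approach to the origin and the departure from it.
\<close>
definition decay_const :: real where "decay_const = (2 * exp 2 + fmax) * exp rate"

text \<open>
  The orbit runs towards the origin.  The function \<open>g\<close> decays by \<open>g' \<le> - rate g\<close>.  For \<open>f\<close> the energy bounds
  \<open>\<bar>f\<bar>\<close> only from below; the upper bound comes from the monotonicity of \<open>f\<close>, since \<open>\<bar>g'\<bar> \<ge> \<bar>f\<bar> / 2\<close>
  on \<open>{r - 1..r}\<close> and \<open>g\<close> stays nonnegative, whence \<open>\<bar>f r\<bar> \<le> 2 g (r - 1)\<close>.
\<close>
lemma decay_phase:
  assumes orb: "orbit R f g" and "f R < 0" and small: "a * (g R)\<^sup>2 \<le> b"
    and g0: "\<And>r. R \<le> r \<Longrightarrow> r \<le> T \<Longrightarrow> 0 \<le> g r" and E: "0 < energy (f T) (g T)"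
    and r: "R \<le> r" "r \<le> T"
  shows "f r < 0" "a * (g r)\<^sup>2 \<le> b" "g r \<le> exp (- rate * (r - R))"
    "- f r \<le> decay_const * exp (- rate * (r - R))" "- f r \<le> - f R"
proof -
  have Epos: "0 < energy (f q) (g q)" if "R \<le> q" "q \<le> T" for q
    using energy_antimono[OF orb, of q T] that E by auto
  have small_of: "a * (g q)\<^sup>2 \<le> b" if "R \<le> q" "q \<le> T" "\<And>p. R < p \<Longrightarrow> p < q \<Longrightarrow> f p \<le> 0" for q
  proof -
    have "g q \<le> g R" by (rule g_antimono_while_f_nonpos[OF orb order_refl]) (use that in auto)
    then have "(g q)\<^sup>2 \<le> (g R)\<^sup>2" using g0[of q] that by (intro power_mono) auto
    then have "a * (g q)\<^sup>2 \<le> a * (g R)\<^sup>2" using a_pos by simp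
    then show ?thesis using small by linarith
  qed
  have neg: "f q < 0" if q: "R \<le> q" "q \<le> T" for q
  proof (rule ccontr)
    assume "\<not> f q < 0"
    then have "0 \<le> f q" by simp
    with first_hit[OF q(1) orbit_cont(1)[OF orb order_refl] \<open>f R < 0\<close>]
    obtain t where t: "R < t" "t \<le> q" "f t = 0" "\<And>p. R \<le> p \<Longrightarrow> p < t \<Longrightarrow> f p < 0" by blast
    have "a * (g t)\<^sup>2 \<le> b" by (rule small_of) (use t q in \<open>auto intro: less_imp_le\<close>)
    then show False
      using small_g_estimates(3)[of "g t" "f t"] Epos[of t] t q by auto
  qed
  have small': "a * (g q)\<^sup>2 \<le> b" if q: "R \<le> q" "q \<le> T" for q
    by (rule small_of) (use neg q in \<open>auto intro: less_imp_le\<close>)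
  show "f r < 0" "a * (g r)\<^sup>2 \<le> b" using neg[OF r] small'[OF r] .
  have g_decay: "g q \<le> exp (- rate * (q - R))" if q: "R \<le> q" "q \<le> T" for q
  proof -
    have "g q \<le> g R * exp (- rate * (q - R))"
    proof (rule exp_comparison_le[OF q(1) orbit_cont(2)[OF orb order_refl]])
      fix p assume p: "R < p" "p < q"
      show "(g has_real_derivative f p * (1 - (g p)\<^sup>2)) (at p)" using orbitD(5)[OF orb p(1)] .
      have "rate * \<bar>g p\<bar> \<le> \<bar>f p\<bar> * (1 - (g p)\<^sup>2)"
        using small_g_estimates(2)[OF small' Epos, of p] p q by auto
      then show "f p * (1 - (g p)\<^sup>2) \<le> - rate * g p"
        using neg[of p] g0[of p] p q by auto
    qed
    also have "\<dots> \<le> 1 * exp (- rate * (q - R))"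
      using orbitD(6)[OF orb, of R] by (intro mult_right_mono) auto
    finally show ?thesis by simp
  qed
  then show "g r \<le> exp (- rate * (r - R))" using r by blast
  have f_incr: "f q \<le> f q'" if q: "R \<le> q" "q \<le> q'" "q' \<le> T" for q q'
  proof -
    have "- f q' \<le> - f q"
    proof (rule DERIV_nonpos_imp_decreasing_open[OF q(2)])
      fix p assume p: "q < p" "p < q'"
      have "((\<lambda>r. - f r) has_real_derivative - (force (f p) (g p) - 2 / p * f p)) (at p)"
        using orbitD(4)[OF orb, of p] p q by (auto intro!: derivative_eq_intros)
      moreover have "0 \<le> force (f p) (g p)"
        unfolding force_def using g0[of p] small'[of p] p q zero_le_power2[of "f p"]
        by (intro mult_nonneg_nonneg) linarith+
      moreover have "2 / p * f p \<le> 0"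
        using neg[of p] p q orbitD(1)[OF orb] by (intro mult_nonneg_nonpos) auto
      ultimately show "\<exists>y. ((\<lambda>r. - f r) has_real_derivative y) (at p) \<and> y \<le> 0" by force
    qed (intro continuous_intros orbit_cont(1)[OF orb q(1)])
    then show ?thesis by simp
  qed
  then show "- f r \<le> - f R" using r by simp
  show "- f r \<le> decay_const * exp (- rate * (r - R))"
  proof (cases "r \<le> R + 1")
    case True
    have "rate * (r - R) \<le> rate * 1" using True rate_pos by (intro mult_left_mono) auto
    then have "1 \<le> exp (rate - rate * (r - R))" by simp
    have "- f r \<le> fmax * 1" using orbit_f_less[OF orb r(1)] by simp
    also have "\<dots> \<le> (2 * exp 2 + fmax) * exp (rate - rate * (r - R))"
      using fmax_pos \<open>1 \<le> exp (rate - rate * (r - R))\<close> by (intro mult_mono) auto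
    also have "\<dots> = decay_const * exp (- rate * (r - R))"
      unfolding decay_const_def by (simp add: exp_add [symmetric])
    finally show ?thesis .
  next
    case False
    obtain z where z: "r - 1 < z" "z < r" "g r - g (r - 1) = f z * (1 - (g z)\<^sup>2)"
      using g_mean_value[OF orb, of "r - 1" r] False by auto
    have zr: "R \<le> z" "z \<le> T" using z r False by auto
    have "- f r \<le> - f z" using f_incr[of z r] z zr r by simp
    also have "- f z = 2 * (- f z * (1 / 2))" by simp
    also have "\<dots> \<le> 2 * (- f z * (1 - (g z)\<^sup>2))"
      using neg[OF zr] small_g_estimates(1)[OF small'[OF zr] Epos[OF zr]] by (intro mult_left_mono) auto
    also have "\<dots> = 2 * (g (r - 1) - g r)" using z(3) by simp
    also have "\<dots> \<le> 2 * g (r - 1)" using g0[OF r] by simp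
    also have "\<dots> \<le> 2 * exp (- rate * (r - 1 - R))"
      using g_decay[of "r - 1"] r False by simp
    also have "\<dots> = 2 * 1 * exp (rate - rate * (r - R))" by (simp add: algebra_simps)
    also have "\<dots> \<le> (2 * exp 2 + fmax) * exp (rate - rate * (r - R))"
    proof (rule mult_right_mono)
      have "(1::real) \<le> exp 2" by simp
      then show "2 * 1 \<le> 2 * exp 2 + fmax" using fmax_pos by linarith
    qed simp
    also have "\<dots> = decay_const * exp (- rate * (r - R))"
      unfolding decay_const_def by (simp add: exp_add [symmetric])
    finally show ?thesis .
  qed
qed

text \<open>
  The orbit leaves the neighbourhood of the origin after a zero of \<open>g\<close> at \<open>s\<close>.  During one unit of radius \<open>\<bar>g\<bar>\<close>
  grows to at least a multiple of \<open>\<bar>f s\<bar>\<close>, and then exponentially; since \<open>\<bar>g\<bar> < 1\<close>, this bounds \<open>\<bar>f s\<bar>\<close>.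
  The energy loss follows from \<open>\<bar>f\<bar> \<ge> rate \<bar>g\<bar>\<close>, which makes \<open>energy + (rate / t) g^2\<close> nonincreasing.
\<close>
lemma growth_phase:
  assumes orb: "orbit s f g" and "1 \<le> s" "s \<le> t" and init: "g s = 0" "f s < 0"
    and small: "\<And>r. s \<le> r \<Longrightarrow> r \<le> t \<Longrightarrow> a * (g r)\<^sup>2 \<le> b" and E: "0 < energy (f t) (g t)"
  shows "- f s \<le> decay_const * exp (- rate * (t - s))"
    and "energy (f t) (g t) + rate / t * (g t)\<^sup>2 \<le> energy (f s) (g s)"
proof -
  have neg: "f r < 0" if "s \<le> r" "r \<le> t" for r
    using f_negative_while_g_small[OF orb order_refl init(2) small E that] .
  have Epos: "0 < energy (f q) (g q)" if "s \<le> q" "q \<le> t" for q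
    using energy_antimono[OF orb, of q t] that E by auto
  have g_le: "g q \<le> g p" if "s \<le> p" "p \<le> q" "q \<le> t" for p q
  proof (rule g_antimono_while_f_nonpos[OF orb that(1,2)])
    fix r assume "p < r" "r < q"
    then show "f r \<le> 0" using neg[of r] that by simp
  qed
  have g0: "g q \<le> 0" if "s \<le> q" "q \<le> t" for q
    using g_le[of s q] that init by simp
  have est: "rate * - g q \<le> - f q * (1 - (g q)\<^sup>2)" "1 / 2 \<le> 1 - (g q)\<^sup>2" if q: "s \<le> q" "q \<le> t" for q
    using small_g_estimates(1,2)[OF small[OF q] Epos[OF q]] neg[OF q] g0[OF q] by auto
  show "energy (f t) (g t) + rate / t * (g t)\<^sup>2 \<le> energy (f s) (g s)"
  proof -
    let ?h = "\<lambda>r. energy (f r) (g r) + rate / t * (g r)\<^sup>2"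
    have "t \<noteq> 0" using \<open>1 \<le> s\<close> \<open>s \<le> t\<close> by simp
    have "?h t \<le> ?h s"
    proof (rule DERIV_nonpos_imp_decreasing_open[of s t ?h])
      fix q assume q: "s < q" "q < t"
      let ?d = "2 * (f q * (1 - (g q)\<^sup>2)) * (- f q / q + rate * g q / t)"
      have "(?h has_real_derivative
        - (2 / q * (f q)\<^sup>2 * (1 - (g q)\<^sup>2)) + rate / t * (2 * g q * (f q * (1 - (g q)\<^sup>2)))) (at q)"
        using \<open>t \<noteq> 0\<close>
        by (auto intro!: derivative_eq_intros orbitD(5)[OF orb q(1)] orbit_energy_derivative[OF orb q(1)])
      moreover have "- (2 / q * (f q)\<^sup>2 * (1 - (g q)\<^sup>2)) + rate / t * (2 * g q * (f q * (1 - (g q)\<^sup>2))) = ?d"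
        by (simp add: power2_eq_square algebra_simps add_divide_distrib diff_divide_distrib)
      moreover have "?d \<le> 0"
      proof (rule mult_nonpos_nonneg)
        show "2 * (f q * (1 - (g q)\<^sup>2)) \<le> 0"
          using neg[of q] est(2)[of q] q by (simp add: mult_le_0_iff)
        have "rate * - g q \<le> - f q * (1 - (g q)\<^sup>2)" using est(1) q by simp
        also have "\<dots> \<le> - f q * 1" using neg[of q] q by (intro mult_left_mono) auto
        finally have "rate * - g q / t \<le> - f q / q"
          using q \<open>1 \<le> s\<close> neg[of q] by (intro frac_le) auto
        then show "0 \<le> - f q / q + rate * g q / t" by simp
      qed
      ultimately show "\<exists>y. (?h has_real_derivative y) (at q) \<and> y \<le> 0" by metis
    qed (use \<open>s \<le> t\<close> in simp, intro continuous_intros orbit_cont[OF orb order_refl] \<open>t \<noteq> 0\<close>)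
    then show ?thesis using init by simp
  qed
  show "- f s \<le> decay_const * exp (- rate * (t - s))"
  proof (cases "t \<le> s + 1")
    case True
    have "rate * (t - s) \<le> rate * 1" using True rate_pos by (intro mult_left_mono) auto
    then have "1 \<le> exp (rate - rate * (t - s))" by simp
    have "- f s \<le> fmax * 1" using orbit_f_less[OF orb order_refl] by simp
    also have "\<dots> \<le> (2 * exp 2 + fmax) * exp (rate - rate * (t - s))"
      using fmax_pos \<open>1 \<le> exp (rate - rate * (t - s))\<close> by (intro mult_mono) auto
    also have "\<dots> = decay_const * exp (- rate * (t - s))"
      unfolding decay_const_def by (simp add: exp_add [symmetric])
    finally show ?thesis .
  next
    case False
    have f_le: "f q \<le> f s * exp (- 2)" if q: "s \<le> q" "q \<le> s + 1" for q
    proof -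
      have "f q \<le> f s * exp (- 2 * (q - s))"
      proof (rule exp_comparison_le[OF q(1) orbit_cont(1)[OF orb order_refl]])
        fix p assume p: "s < p" "p < q"
        show "(f has_real_derivative force (f p) (g p) - 2 / p * f p) (at p)" using orbitD(4)[OF orb p(1)] .
        have pt: "s \<le> p" "p \<le> t" using p q False by auto
        have "force (f p) (g p) \<le> 0"
          unfolding force_def using g0[OF pt] small[OF pt] zero_le_power2[of "f p"]
          by (intro mult_nonpos_nonneg) linarith+
        moreover have "2 / p * - f p \<le> 2 * - f p"
          using neg[OF pt] p \<open>1 \<le> s\<close> by (intro mult_right_mono) (auto simp: divide_simps)
        ultimately show "force (f p) (g p) - 2 / p * f p \<le> - 2 * f p" by simp
      qed
      also have "\<dots> \<le> f s * exp (- 2)"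
        using init q by (intro mult_left_mono_neg) auto
      finally show ?thesis .
    qed
    obtain z where z: "s < z" "z < s + 1" "g (s + 1) = f z * (1 - (g z)\<^sup>2)"
      using g_mean_value[OF orb order_refl, of "s + 1"] init by auto
    have zt: "s \<le> z" "z \<le> t" using z False by auto
    have "f z * (1 - (g z)\<^sup>2) \<le> f z * (1 / 2)"
      using neg[OF zt] est(2)[OF zt] by (intro mult_left_mono_neg) auto
    then have g1: "g (s + 1) \<le> f s * exp (- 2) / 2" using f_le[of z] z by simp
    have "- 1 < g t" using orbitD(6)[OF orb, of t] \<open>s \<le> t\<close> by auto
    also have "g t \<le> g (s + 1) * exp (rate * (t - (s + 1)))"
    proof (rule exp_comparison_le)
      fix p assume p: "s + 1 < p" "p < t"
      show "(g has_real_derivative f p * (1 - (g p)\<^sup>2)) (at p)" using orbitD(5)[OF orb, of p] p by simp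
      show "f p * (1 - (g p)\<^sup>2) \<le> rate * g p" using est(1)[of p] p by simp
    qed (use False orbit_cont(2)[OF orb] in auto)
    also have "\<dots> \<le> f s * exp (- 2) / 2 * exp (rate * (t - (s + 1)))"
      using g1 by (intro mult_right_mono) auto
    finally have "- f s * (exp (- 2) / 2 * exp (rate * (t - (s + 1)))) \<le> 1" by simp
    then have "- f s * (exp (- 2) / 2 * exp (rate * (t - (s + 1)))) * (2 * exp 2 * exp (- rate * (t - (s + 1))))
      \<le> 1 * (2 * exp 2 * exp (- rate * (t - (s + 1))))"
      by (intro mult_right_mono) auto
    moreover have "exp (- 2) / 2 * exp (rate * (t - (s + 1))) * (2 * exp 2 * exp (- rate * (t - (s + 1)))) = 1"
    proof -
      have "exp (- 2) / 2 * exp (rate * (t - (s + 1))) * (2 * exp 2 * exp (- rate * (t - (s + 1))))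
         = (exp (- 2) * exp 2) * (exp (rate * (t - (s + 1))) * exp (- rate * (t - (s + 1))))" by simp
      also have "\<dots> = 1" by (simp only: exp_add [symmetric]) simp
      finally show ?thesis .
    qed
    ultimately have "- f s \<le> 2 * exp 2 * exp (- rate * (t - (s + 1)))"
      by (metis mult.assoc mult_1 mult.right_neutral)
    also have "\<dots> = 2 * exp 2 * exp (rate - rate * (t - s))" by (simp add: algebra_simps)
    also have "\<dots> \<le> (2 * exp 2 + fmax) * exp (rate - rate * (t - s))"
      using fmax_pos by (intro mult_right_mono) auto
    also have "\<dots> = decay_const * exp (- rate * (t - s))"
      unfolding decay_const_def by (simp add: exp_add [symmetric])
    finally show ?thesis .
  qed
qed

lemma decay_const_pos: "0 < decay_const"
  unfolding decay_const_def using fmax_pos by (intro mult_pos_pos add_pos_pos) auto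

text \<open>
  The cube and the square appear because in \<open>at_most_one_late_g_zero\<close> the bound on \<open>p\<close> is a product of three
  factors, while the energy is quadratic in \<open>p\<close>: both sides are compared at \<open>p^6\<close>.
\<close>
lemma exp_beats_cube:
  obtains R0 where "1 \<le> R0" "\<And>t. R0 \<le> t \<Longrightarrow> Q\<^sup>2 * exp (- (2 * rate * t)) < (2 * rate * b / (a * t)) ^ 3"
proof -
  define e where "e = (4 * rate\<^sup>2 * b / a) ^ 3 / (Q\<^sup>2 + 1)"
  have "0 < Q\<^sup>2 + 1" by (simp add: add_nonneg_pos)
  then have "0 < e" unfolding e_def using rate_pos b_pos a_pos by simp
  moreover have "((\<lambda>t. (2 * rate * t) ^ 3 / exp (2 * rate * t)) \<longlongrightarrow> 0) at_top"
    by (rule filterlim_compose[OF tendsto_power_div_exp_0])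
      (use rate_pos in \<open>auto intro!: filterlim_tendsto_pos_mult_at_top[OF tendsto_const _ filterlim_ident]\<close>)
  ultimately have "\<forall>\<^sub>F t in at_top. (2 * rate * t) ^ 3 / exp (2 * rate * t) < e"
    by (intro order_tendstoD(2)) auto
  then obtain R1 where R1: "\<And>t. R1 \<le> t \<Longrightarrow> (2 * rate * t) ^ 3 / exp (2 * rate * t) < e"
    unfolding eventually_at_top_linorder by blast
  have "Q\<^sup>2 * exp (- (2 * rate * t)) < (2 * rate * b / (a * t)) ^ 3" if t: "max 1 R1 \<le> t" for t
  proof -
    have "0 < t" using t by simp
    then have p: "0 < (2 * rate * t) ^ 3" using rate_pos by simp
    have "(2 * rate * t) ^ 3 * exp (- (2 * rate * t)) < e"
      using R1[of t] t by (simp add: exp_minus divide_inverse)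
    then have "(2 * rate * t) ^ 3 * exp (- (2 * rate * t)) * (Q\<^sup>2 + 1) < (4 * rate\<^sup>2 * b / a) ^ 3"
      unfolding e_def using \<open>0 < Q\<^sup>2 + 1\<close> by (simp add: pos_less_divide_eq)
    then have "(2 * rate * t) ^ 3 * ((Q\<^sup>2 + 1) * exp (- (2 * rate * t))) < (4 * rate\<^sup>2 * b / a) ^ 3"
      by (simp add: mult.commute mult.left_commute)
    also have "(4 * rate\<^sup>2 * b / a) ^ 3 = (2 * rate * t) ^ 3 * (2 * rate * b / (a * t)) ^ 3"
      unfolding power_mult_distrib [symmetric] using \<open>0 < t\<close> a_pos
      by (intro arg_cong[of _ _ "\<lambda>x. x ^ 3"]) (simp add: field_simps power2_eq_square)
    finally have "(Q\<^sup>2 + 1) * exp (- (2 * rate * t)) < (2 * rate * b / (a * t)) ^ 3"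
      using p by (simp only: mult_less_cancel_left_pos)
    moreover have "Q\<^sup>2 * exp (- (2 * rate * t)) \<le> (Q\<^sup>2 + 1) * exp (- (2 * rate * t))"
      by (intro mult_right_mono) auto
    ultimately show ?thesis by linarith
  qed
  then show ?thesis using that[of "max 1 R1"] by simp
qed

text \<open>
  Let \<open>s\<close> be the first zero of \<open>g\<close> after \<open>R\<close> and \<open>p = - f s\<close>, so that the energy at \<open>s\<close> is \<open>p^2 / 2\<close>.  A second zero
  would require positive energy until \<open>g\<close> reaches \<open>a g^2 = b\<close> at some \<open>t\<close>, hence \<open>p^2 / 2\<close> would exceed the loss
  \<open>rate b / (a t)\<close>.  But \<open>p\<close> is bounded by constants times \<open>exp (- rate R)\<close>, \<open>exp (- rate (s - R))\<close> and
  \<open>exp (- rate (t - s))\<close>; the product of the three bounds is a constant times \<open>exp (- rate t)\<close>, which is too small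
  for large \<open>t\<close>.
\<close>
lemma at_most_one_late_g_zero:
  obtains R0 where "1 \<le> R0"
    "\<And>R f g u v. \<lbrakk>R0 \<le> R; orbit R f g; f R < 0; 0 < g R; a * (g R)\<^sup>2 \<le> b;
        - f R \<le> B * exp (- rate * R); R \<le> u; u < v; g u = 0; g v = 0\<rbrakk> \<Longrightarrow> False"
proof -
  define Q where "Q = decay_const * decay_const * B"
  obtain R0 where R0: "1 \<le> R0"
    "\<And>t. R0 \<le> t \<Longrightarrow> Q\<^sup>2 * exp (- (2 * rate * t)) < (2 * rate * b / (a * t)) ^ 3"
    by (rule exp_beats_cube[of Q]) blast
  have False
    if "R0 \<le> R" and orb: "orbit R f g" and init: "f R < 0" "0 < g R" "a * (g R)\<^sup>2 \<le> b"
      and fB: "- f R \<le> B * exp (- rate * R)" and uv: "R \<le> u" "u < v" "g u = 0" "g v = 0"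
    for R f g u v
  proof -
    have "g R \<noteq> 0" using init by simp
    obtain s where s: "R < s" "s \<le> u" "g s = 0" "\<And>q. R \<le> q \<Longrightarrow> q < s \<Longrightarrow> g q \<noteq> 0"
      using first_zero[OF uv(1) orbit_cont(2)[OF orb order_refl] \<open>g R \<noteq> 0\<close> uv(3)] by blast
    have "s < v" using s uv by simp
    have gpos: "0 \<le> g q" if q: "R \<le> q" "q \<le> s" for q
    proof (rule ccontr)
      assume "\<not> 0 \<le> g q"
      then have "- g R < 0" "0 \<le> - g q" using init by auto
      moreover have "continuous_on {R..q} (\<lambda>r. - g r)"
        by (intro continuous_intros orbit_cont(2)[OF orb order_refl])
      ultimately obtain p where "R < p" "p \<le> q" "- g p = 0"
        using first_hit[OF q(1), of "\<lambda>r. - g r" 0] by blast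
      then show False using s(3) s(4)[of p] q \<open>\<not> 0 \<le> g q\<close> by (cases "p = s") auto
    qed
    have Ev: "0 < energy (f v) (g v)"
      using g_zero_energy_pos[OF orb] uv by simp
    have Epos: "0 < energy (f q) (g q)" if "R \<le> q" "q \<le> v" for q
      using energy_antimono[OF orb, of q v] that Ev by auto
    have Rs: "R \<le> s" using s by simp
    note decay = decay_phase[OF orb init(1,3) gpos Epos[OF Rs] Rs order_refl]
    have "f s < 0" and p1: "- f s \<le> decay_const * exp (- rate * (s - R))"
      and p2: "- f s \<le> B * exp (- rate * R)"
      using decay(1,4,5) \<open>s < v\<close> fB by auto
    have orb': "orbit s f g" using orbit_later[OF orb Rs] .
    \<comment> \<open>Inside \<open>a g^2 \<le> b\<close> the function \<open>f\<close> keeps its sign, so \<open>g\<close> is monotone and must leave this region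
      before it can vanish again.\<close>
    have "\<exists>q. s \<le> q \<and> q \<le> v \<and> b < a * (g q)\<^sup>2"
    proof (rule ccontr)
      assume "\<not> ?thesis"
      then have small: "a * (g q)\<^sup>2 \<le> b" if "s \<le> q" "q \<le> v" for q using that by force
      have neg: "f q < 0" if "s \<le> q" "q \<le> v" for q
        using f_negative_while_g_small[OF orb' order_refl \<open>f s < 0\<close> small Ev that] .
      obtain z where "s < z" "z < v" "f z = 0"
        using g_zeros_separated[OF orb' order_refl \<open>s < v\<close> s(3) uv(4)] by blast
      then show False using neg[of z] by simp
    qed
    then obtain q where q: "s \<le> q" "q \<le> v" "b < a * (g q)\<^sup>2" by blast
    have "continuous_on {s..q} (\<lambda>r. a * (g r)\<^sup>2)"
      by (intro continuous_intros orbit_cont(2)[OF orb' order_refl])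
    moreover have "a * (g s)\<^sup>2 < b" using s(3) b_pos by simp
    ultimately obtain t where t: "s < t" "t \<le> q" "a * (g t)\<^sup>2 = b" "\<And>r. s \<le> r \<Longrightarrow> r < t \<Longrightarrow> a * (g r)\<^sup>2 < b"
      using first_hit[OF q(1), of "\<lambda>r. a * (g r)\<^sup>2" b] q(3) by (metis less_imp_le)
    have "R \<le> t" "1 \<le> s" "t \<le> v" using t s q R0(1) \<open>R0 \<le> R\<close> by auto
    have small: "a * (g r)\<^sup>2 \<le> b" if "s \<le> r" "r \<le> t" for r
      using t(3) t(4)[of r] that by (cases "r = t") auto
    note growth = growth_phase[OF orb' \<open>1 \<le> s\<close> less_imp_le[OF t(1)] s(3) \<open>f s < 0\<close> small
        Epos[OF \<open>R \<le> t\<close> \<open>t \<le> v\<close>]]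
    define p where "p = - f s"
    have p: "0 < p" "p \<le> decay_const * exp (- rate * (t - s))" "p \<le> decay_const * exp (- rate * (s - R))"
        "p \<le> B * exp (- rate * R)"
      using growth(1) p1 p2 \<open>f s < 0\<close> by (auto simp: p_def)
    have "p * p * p \<le> decay_const * exp (- rate * (t - s)) * (decay_const * exp (- rate * (s - R)))
        * (B * exp (- rate * R))"
      using p decay_const_pos by (intro mult_mono mult_nonneg_nonneg) auto
    also have "\<dots> = Q * (exp (- rate * (t - s)) * exp (- rate * (s - R)) * exp (- rate * R))"
      by (simp add: Q_def)
    also have "exp (- rate * (t - s)) * exp (- rate * (s - R)) * exp (- rate * R) = exp (- (rate * t))"
      by (simp only: exp_add [symmetric]) (simp add: algebra_simps)
    finally have "p * p * p \<le> Q * exp (- (rate * t))" .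
    then have "(p * p * p)\<^sup>2 \<le> (Q * exp (- (rate * t)))\<^sup>2"
      using p by (intro power_mono) auto
    also have "\<dots> = Q\<^sup>2 * exp (- (2 * rate * t))"
      by (simp add: power_mult_distrib exp_double [symmetric] mult.assoc)
    also have "\<dots> < (2 * rate * b / (a * t)) ^ 3"
      using R0(2)[of t] \<open>R \<le> t\<close> \<open>R0 \<le> R\<close> by simp
    also have "\<dots> \<le> (p\<^sup>2) ^ 3"
    proof (rule power_mono)
      have "energy (f s) (g s) = p\<^sup>2 / 2" by (simp add: p_def s(3) energy_def)
      moreover have "rate / t * (g t)\<^sup>2 = rate * b / (a * t)"
        using a_pos by (subst t(3) [symmetric]) simp
      ultimately have "rate * b / (a * t) \<le> p\<^sup>2 / 2"
        using growth(2) Epos[OF \<open>R \<le> t\<close> \<open>t \<le> v\<close>] by linarith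
      moreover have "2 * rate * b / (a * t) = 2 * (rate * b / (a * t))" by simp
      ultimately show "2 * rate * b / (a * t) \<le> p\<^sup>2" by linarith
      show "0 \<le> 2 * rate * b / (a * t)"
        using rate_pos b_pos a_pos t \<open>1 \<le> s\<close> by simp
    qed
    also have "(p\<^sup>2) ^ 3 = (p * p * p)\<^sup>2" by (simp add: power2_eq_square power3_eq_cube)
    finally show False by simp
  qed
  then show ?thesis using that[OF R0(1)] by blast
qed

section \<open>Orbits of positive energy with finitely many zeros\<close>

lemma finite_f_zeros:
  assumes orb: "orbit R f g" and E: "\<And>r. R \<le> r \<Longrightarrow> 0 < energy (f r) (g r)"
    and fin: "finite {r. R < r \<and> g r = 0}"
  shows "finite {r. R \<le> r \<and> f r = 0} \<and> card {r. R \<le> r \<and> f r = 0} \<le> card {r. R < r \<and> g r = 0} + 1"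
proof (rule interlaced_card[OF fin])
  fix u v assume uv: "u \<in> {r. R \<le> r \<and> f r = 0}" "v \<in> {r. R \<le> r \<and> f r = 0}" "u < v"
  then obtain z where "u < z" "z < v" "g z = 0"
    using f_zeros_separated[OF orb, of u v] E[of v] by auto
  then show "\<exists>z\<in>{r. R < r \<and> g r = 0}. u < z \<and> z < v"
    using uv by (intro bexI[of _ z]) auto
qed

text \<open>
  The orbit is on its final approach to the origin, along the branch of the stable manifold with
  \<open>f < 0 < g\<close>.
\<close>
definition settled :: "real \<Rightarrow> (real \<Rightarrow> real) \<Rightarrow> (real \<Rightarrow> real) \<Rightarrow> bool" where
  "settled S f g \<longleftrightarrow> (\<forall>r\<ge>S. f r < 0 \<and> 0 < g r \<and> a * (g r)\<^sup>2 < b)"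

lemma eventually_settled_aux:
  assumes orb: "orbit R f g" and neg: "\<And>r. R < r \<Longrightarrow> f r < 0" and g0: "(g \<longlongrightarrow> 0) at_top"
  obtains S where "R < S" "settled S f g"
proof -
  have "((\<lambda>r. a * (g r)\<^sup>2) \<longlongrightarrow> a * 0\<^sup>2) at_top" by (intro tendsto_intros g0)
  then have "\<forall>\<^sub>F r in at_top. a * (g r)\<^sup>2 < b" using b_pos by (intro order_tendstoD(2)) auto
  then obtain S0 where S0: "\<And>r. S0 \<le> r \<Longrightarrow> a * (g r)\<^sup>2 < b"
    unfolding eventually_at_top_linorder by blast
  have strict: "g t < g s" if "R < s" "s < t" for s t
  proof (rule DERIV_neg_imp_decreasing_open[OF \<open>s < t\<close>])
    fix q assume q: "s < q" "q < t"
    have "f q * (1 - (g q)\<^sup>2) < 0"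
      using neg[of q] one_minus_g2_pos[OF orbitD(6)[OF orb, of q]] q that by (simp add: mult_neg_pos)
    then show "\<exists>y. (g has_real_derivative y) (at q) \<and> y < 0"
      using orbitD(5)[OF orb, of q] q that by auto
  qed (use orbit_cont(2)[OF orb] that in auto)
  have pos: "0 < g r" if "R < r" for r
  proof -
    have "\<forall>\<^sub>F t in at_top. g t \<le> g (r + 1)"
    proof (rule eventually_mono[OF eventually_gt_at_top[of "r + 1"]])
      fix t assume "r + 1 < t" then show "g t \<le> g (r + 1)" using strict[of "r + 1" t] that by simp
    qed
    then have "0 \<le> g (r + 1)" by (rule tendsto_upperbound[OF g0]) simp
    then show ?thesis using strict[of r "r + 1"] that by simp
  qed
  have "settled (max S0 (R + 1)) f g"
    unfolding settled_def using neg pos S0 by auto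
  then show ?thesis using that[of "max S0 (R + 1)"] by auto
qed

lemma eventually_settled:
  assumes orb: "orbit R f g" and E: "\<And>r. R \<le> r \<Longrightarrow> 0 < energy (f r) (g r)"
    and fin: "finite {r. R < r \<and> g r = 0}"
  obtains S where "R < S" "settled S f g \<or> settled S (\<lambda>r. - f r) (\<lambda>r. - g r)"
proof -
  have "finite {r. R \<le> r \<and> f r = 0}" using finite_f_zeros[OF assms] by simp
  then have "bdd_above {r. R \<le> r \<and> f r = 0}" by simp
  then obtain T where T: "\<And>r. R \<le> r \<Longrightarrow> f r = 0 \<Longrightarrow> r \<le> T" unfolding bdd_above_def by blast
  define U where "U = max T R"
  have "R \<le> U" by (simp add: U_def)
  have nz: "f r \<noteq> 0" if "U < r" for r using T[of r] that by (auto simp: U_def)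
  have orb': "orbit U f g" using orbit_later[OF orb \<open>R \<le> U\<close>] .
  have EU: "0 < energy (f r) (g r)" if "U < r" for r using E[of r] that \<open>R \<le> U\<close> by simp
  have g0: "(g \<longlongrightarrow> 0) at_top" using nonrotating_orbit_tendsto(2)[OF orb' nz EU] .
  have "continuous_on {U<..} f" using orbitD(2)[OF orb'] by (rule continuous_on_subset) auto
  then consider "\<forall>r\<in>{U<..}. f r < 0" | "\<forall>r\<in>{U<..}. 0 < f r"
    using nonvanishing_sign[of "{U<..}" f] nz by (auto simp: is_interval_oi)
  then show ?thesis
  proof cases
    case 1
    then obtain S where "U < S" "settled S f g"
      using eventually_settled_aux[OF orb' _ g0] by auto
    then show ?thesis using that[of S] \<open>R \<le> U\<close> by simp
  next
    case 2
    have "((\<lambda>r. - g r) \<longlongrightarrow> 0) at_top" using tendsto_minus[OF g0] by simp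
    then obtain S where "U < S" "settled S (\<lambda>r. - f r) (\<lambda>r. - g r)"
      using eventually_settled_aux[OF orbit_uminus[OF orb'], of thesis] 2 by auto
    then show ?thesis using that[of S] \<open>R \<le> U\<close> by simp
  qed
qed

lemma settled_exp_decay:
  assumes orb: "orbit S f g" and set: "settled S f g" and E: "\<And>r. S \<le> r \<Longrightarrow> 0 < energy (f r) (g r)"
    and r: "S \<le> r"
  shows "\<bar>f r\<bar> \<le> decay_const * exp (- rate * (r - S))" "\<bar>g r\<bar> \<le> exp (- rate * (r - S))"
proof -
  have s: "f S < 0" "a * (g S)\<^sup>2 \<le> b" "\<And>q. S \<le> q \<Longrightarrow> q \<le> r \<Longrightarrow> 0 \<le> g q"
    using set by (auto simp: settled_def intro: less_imp_le)
  note d = decay_phase[OF orb s E[OF r] r order_refl]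
  show "\<bar>f r\<bar> \<le> decay_const * exp (- rate * (r - S))" "\<bar>g r\<bar> \<le> exp (- rate * (r - S))"
    using d(1,3,4) s(3)[OF r order_refl] by auto
qed

text \<open>
  By \<open>finite_f_zeros\<close>, \<open>f\<close> has a last zero, after which the orbit does not rotate and hence tends to the origin;
  the exponential rate is that of \<open>decay_phase\<close>.
\<close>
lemma positive_energy_orbit_decays:
  assumes orb: "orbit 0 f g" and E: "\<And>r. 0 \<le> r \<Longrightarrow> 0 < energy (f r) (g r)"
    and fin: "finite {r. 0 < r \<and> g r = 0}"
  shows "converges_exponentially_to_0 f g"
proof -
  obtain S where S: "0 < S" "settled S f g \<or> settled S (\<lambda>r. - f r) (\<lambda>r. - g r)"
    using eventually_settled[OF assms] by blast
  have orbS: "orbit S f g" using orbit_later[OF orb] S by simp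
  have ES: "0 < energy (f r) (g r)" if "S \<le> r" for r using E[of r] that S by simp
  have tail: "\<bar>f r\<bar> + \<bar>g r\<bar> \<le> (decay_const + 1) * exp (- rate * (r - S))" if r: "S \<le> r" for r
    using S(2)
  proof
    assume "settled S f g"
    from settled_exp_decay[OF orbS this ES r] show ?thesis by (simp add: algebra_simps)
  next
    assume "settled S (\<lambda>r. - f r) (\<lambda>r. - g r)"
    from settled_exp_decay[OF orbit_uminus[OF orbS] this _ r] ES show ?thesis by (simp add: algebra_simps)
  qed
  define C where "C = (decay_const + 1 + fmax) * exp (rate * S)"
  have "0 < C" unfolding C_def using decay_const_pos fmax_pos by (intro mult_pos_pos) auto
  have "\<bar>f r\<bar> + \<bar>g r\<bar> \<le> C * exp (- rate * r)" if "0 \<le> r" for r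
  proof -
    have Ceq: "C * exp (- rate * r) = (decay_const + 1 + fmax) * exp (- rate * (r - S))"
      unfolding C_def by (simp add: exp_add [symmetric] algebra_simps)
    show ?thesis
    proof (cases "S \<le> r")
      case True
      have "(decay_const + 1) * exp (- rate * (r - S)) \<le> (decay_const + 1 + fmax) * exp (- rate * (r - S))"
        using fmax_pos by (intro mult_right_mono) auto
      then show ?thesis using tail[OF True] Ceq by linarith
    next
      case False
      have "rate * (r - S) \<le> 0" using False rate_pos by (simp add: mult_nonneg_nonpos)
      then have "1 \<le> exp (- rate * (r - S))" by simp
      then have "(1 + fmax) * 1 \<le> (decay_const + 1 + fmax) * exp (- rate * (r - S))"
        using fmax_pos decay_const_pos by (intro mult_mono) auto
      then have "1 + fmax \<le> C * exp (- rate * r)" by (simp only: mult_1_right Ceq)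
      then show ?thesis using orbit_f_less[OF orb that] orbitD(6)[OF orb that] by linarith
    qed
  qed
  then show ?thesis
    unfolding converges_exponentially_to_0_def using \<open>0 < C\<close> rate_pos by blast
qed

text \<open>
  The zeros of \<open>f\<close> including the one at \<open>0\<close> are separated by zeros of \<open>g\<close>.  Conversely the zeros of \<open>g\<close> together
  with a large radius \<open>S\<close> are separated by zeros of \<open>f\<close>: after its last zero \<open>g\<close> has to turn back towards \<open>0\<close>.
  Counting both ways gives equality.
\<close>
lemma f_has_as_many_zeros:
  assumes orb: "orbit 0 f g" and "f 0 = 0" and E: "\<And>r. 0 \<le> r \<Longrightarrow> 0 < energy (f r) (g r)"
    and zg: "has_exactly_pos_zeros k g"
  shows "has_exactly_pos_zeros k f"
proof -
  let ?F = "{r. 0 < r \<and> f r = 0}" and ?G = "{r. 0 < r \<and> g r = 0}"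
  have G: "finite ?G" "card ?G = k" using zg by (auto simp: has_exactly_pos_zeros_def)
  have "{r. 0 \<le> r \<and> f r = 0} = insert 0 ?F" using \<open>f 0 = 0\<close> by auto
  then have fin: "finite (insert 0 ?F)" "card (insert 0 ?F) \<le> card ?G + 1"
    using finite_f_zeros[OF orb E G(1)] by auto
  then have F: "finite ?F" "card ?F \<le> k" using G by auto
  obtain S where S: "0 < S" "settled S f g \<or> settled S (\<lambda>r. - f r) (\<lambda>r. - g r)"
    using eventually_settled[OF orb E G(1)] by blast
  then have nzS: "f r \<noteq> 0 \<and> g r \<noteq> 0" if "S \<le> r" for r using that by (force simp: settled_def)
  have beforeS: "r < S" if "f r = 0 \<or> g r = 0" for r
    using nzS[of r] that by (cases "S \<le> r") auto
  have after: "\<exists>z>u. f z = 0" if "u \<in> ?G" for u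
  proof -
    have u: "0 < u" "g u = 0" using that by auto
    show ?thesis
    proof (rule ccontr)
      assume no: "\<not> ?thesis"
      have nz: "f z \<noteq> 0" if "u < z" for z using no that by blast
      have orbu: "orbit u f g" using orbit_later[OF orb] u by simp
      have Eu: "0 < energy (f r) (g r)" if "u < r" for r using E[of r] that u by simp
      have g0: "(g \<longlongrightarrow> 0) at_top" by (rule nonrotating_orbit_tendsto(2)[OF orbu nz Eu])
      have "continuous_on {u<..} f" using orbitD(2)[OF orbu] by (rule continuous_on_subset) auto
      then consider "\<forall>r\<in>{u<..}. f r < 0" | "\<forall>r\<in>{u<..}. 0 < f r"
        using nonvanishing_sign[of "{u<..}" f] nz by (auto simp: is_interval_oi)
      then show False
      proof cases
        case 1
        then obtain T where T: "u < T" "settled T f g"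
          using eventually_settled_aux[OF orbu _ g0] by auto
        have "g T \<le> g u"
          by (rule g_antimono_while_f_nonpos[OF orbu order_refl])
            (use 1 T(1) in \<open>auto intro: less_imp_le\<close>)
        then show False using T u by (auto simp: settled_def)
      next
        case 2
        have "((\<lambda>r. - g r) \<longlongrightarrow> 0) at_top" using tendsto_minus[OF g0] by simp
        then obtain T where T: "u < T" "settled T (\<lambda>r. - f r) (\<lambda>r. - g r)"
          using eventually_settled_aux[OF orbit_uminus[OF orbu], of thesis] 2 by auto
        have "- g T \<le> - g u"
          by (rule g_antimono_while_f_nonpos[OF orbit_uminus[OF orbu] order_refl])
            (use 2 T(1) in \<open>auto intro: less_imp_le\<close>)
        then show False using T u by (auto simp: settled_def)
      qed
    qed
  qed
  have "card (insert S ?G) \<le> card ?F + 1"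
  proof (rule interlaced_card[THEN conjunct2, OF F(1)])
    fix u v assume uv: "u \<in> insert S ?G" "v \<in> insert S ?G" "u < v"
    have uG: "u \<in> ?G" using uv beforeS[of v] by auto
    show "\<exists>z\<in>?F. u < z \<and> z < v"
    proof (cases "v \<in> ?G")
      case True
      then obtain z where "u < z" "z < v" "f z = 0"
        using g_zeros_separated[OF orb, of u v] uG uv(3) by auto
      then show ?thesis using uG by (intro bexI[of _ z]) auto
    next
      case False
      then have "v = S" using uv(2) by blast
      obtain z where "u < z" "f z = 0" using after[OF uG] by blast
      moreover have "z < S" using beforeS[of z] \<open>f z = 0\<close> by simp
      ultimately show ?thesis using uG \<open>v = S\<close> by (intro bexI[of _ z]) auto
    qed
  qed
  moreover have "S \<notin> ?G" using nzS[of S] by auto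
  ultimately have "card ?G \<le> card ?F" using G by simp
  then show ?thesis using F G by (auto simp: has_exactly_pos_zeros_def)
qed

section \<open>Shooting from the axis\<close>

definition shot :: "real \<Rightarrow> (real \<Rightarrow> real) \<Rightarrow> (real \<Rightarrow> real) \<Rightarrow> bool" where
  "shot x f g \<longleftrightarrow> 0 < x \<and> x < 1 \<and> orbit 0 f g \<and> f 0 = 0 \<and> g 0 = x"

lemma shot_orbit: "shot x f g \<Longrightarrow> orbit 0 f g"
  by (simp add: shot_def)

lemma shot_exists:
  assumes "0 < x" "x < 1"
  shows "\<exists>f g. shot x f g"
proof -
  obtain f g where "orbit 0 f g" "f 0 = 0" "g 0 = x"
    using orbit_is_maximal_solution[OF assms] by (elim exE conjE)
  then show ?thesis using assms unfolding shot_def by blast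
qed

lemma shots_diverge:
  assumes "shot x f g" "shot y p q" "0 \<le> r"
  shows "(p r - f r)\<^sup>2 + (q r - g r)\<^sup>2 \<le> (y - x)\<^sup>2 * exp (4 * lip_const (fmax + 1) * r)"
proof -
  have orb: "orbit 0 f g" "orbit 0 p q" using assms by (auto simp: shot_def)
  have "(p r - f r)\<^sup>2 + (q r - g r)\<^sup>2
      \<le> ((p 0 - f 0)\<^sup>2 + (q 0 - g 0)\<^sup>2) * exp (4 * lip_const (fmax + 1) * r)"
  proof (rule solutions_diverge_at_most_exponentially[OF \<open>0 \<le> r\<close>])
    fix s assume "0 < s" "s < r"
    then show "\<bar>p s\<bar> \<le> fmax + 1 \<and> \<bar>f s\<bar> \<le> fmax + 1 \<and> \<bar>q s\<bar> \<le> fmax + 1 \<and> \<bar>g s\<bar> \<le> fmax + 1"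
      using orbit_f_less[OF orb(1), of s] orbit_f_less[OF orb(2), of s]
        orbitD(6)[OF orb(1), of s] orbitD(6)[OF orb(2), of s] fmax_pos by auto
  qed (use orb orbit_cont orbitD in auto)
  then show ?thesis using assms by (simp add: shot_def)
qed

lemma shots_uniformly_close:
  assumes "shot x f g" "0 < e"
  obtains d where "0 < d"
    "\<And>y p q r. \<lbrakk>shot y p q; \<bar>y - x\<bar> < d; 0 \<le> r; r \<le> R\<rbrakk> \<Longrightarrow> \<bar>p r - f r\<bar> < e \<and> \<bar>q r - g r\<bar> < e"
proof -
  define L where "L = 4 * lip_const (fmax + 1)"
  have "0 \<le> L" unfolding L_def using lip_const_nonneg by simp
  define d where "d = e * exp (- (L * R) / 2)"
  have "0 < d" using assms by (simp add: d_def)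
  have d2: "d\<^sup>2 * exp (L * R) = e\<^sup>2"
    by (simp add: d_def power_mult_distrib exp_double [symmetric] mult.assoc flip: exp_add)
  have "\<bar>p r - f r\<bar> < e \<and> \<bar>q r - g r\<bar> < e"
    if "shot y p q" "\<bar>y - x\<bar> < d" "0 \<le> r" "r \<le> R" for y p q r
  proof -
    have "(p r - f r)\<^sup>2 + (q r - g r)\<^sup>2 \<le> (y - x)\<^sup>2 * exp (L * r)"
      using shots_diverge[OF assms(1) that(1,3)] by (simp add: L_def)
    also have "\<dots> \<le> (y - x)\<^sup>2 * exp (L * R)"
      using that \<open>0 \<le> L\<close> by (intro mult_left_mono) (auto intro: mult_left_mono)
    also have "\<dots> < d\<^sup>2 * exp (L * R)"
    proof (rule mult_strict_right_mono)
      have "\<bar>y - x\<bar>\<^sup>2 < d\<^sup>2" using that by (intro power_strict_mono) auto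
      then show "(y - x)\<^sup>2 < d\<^sup>2" by simp
    qed simp
    finally have "(p r - f r)\<^sup>2 + (q r - g r)\<^sup>2 < e\<^sup>2" using d2 by simp
    then have "\<bar>p r - f r\<bar>\<^sup>2 < e\<^sup>2" "\<bar>q r - g r\<bar>\<^sup>2 < e\<^sup>2"
      using zero_le_power2[of "p r - f r"] zero_le_power2[of "q r - g r"] unfolding power2_abs
      by linarith+
    then show ?thesis using assms(2) by (auto intro: power2_less_imp_less[OF _ less_imp_le])
  qed
  then show ?thesis using that \<open>0 < d\<close> by blast
qed

text \<open>
  Continuous dependence in the form used below: an open condition on the state at radius \<open>R\<close> persists for nearby
  initial values.
\<close>
lemma shot_open_condition:
  assumes x: "shot x f g" and "0 \<le> R" and U: "open U" "(f R, g R) \<in> U"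
  obtains d where "0 < d" "\<And>y p q. \<lbrakk>shot y p q; \<bar>y - x\<bar> < d\<rbrakk> \<Longrightarrow> (p R, q R) \<in> U"
proof -
  obtain e where e: "0 < e" "ball (f R, g R) e \<subseteq> U"
    using U open_contains_ball by blast
  obtain d where d: "0 < d" "\<And>y p q r. \<lbrakk>shot y p q; \<bar>y - x\<bar> < d; 0 \<le> r; r \<le> R\<rbrakk> \<Longrightarrow>
      \<bar>p r - f r\<bar> < e / 2 \<and> \<bar>q r - g r\<bar> < e / 2"
    using shots_uniformly_close[OF x, of "e / 2" R] e(1) by (metis half_gt_zero)
  have "(p R, q R) \<in> U" if "shot y p q" "\<bar>y - x\<bar> < d" for y p q
  proof -
    have "dist (f R, g R) (p R, q R) \<le> \<bar>p R - f R\<bar> + \<bar>q R - g R\<bar>"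
      using sqrt_sum_squares_le_sum_abs[of "f R - p R" "g R - q R"]
      by (simp add: dist_Pair_Pair dist_real_def abs_minus_commute)
    also have "\<dots> < e" using d(2)[OF that \<open>0 \<le> R\<close> order_refl] by linarith
    finally show ?thesis using e(2) by auto
  qed
  then show ?thesis using that d(1) by blast
qed

section \<open>Semicontinuity of the number of zeros\<close>

definition pos_zeros :: "(real \<Rightarrow> real) \<Rightarrow> real set" where
  "pos_zeros h = {r. 0 < r \<and> h r = 0}"

text \<open>
  At a zero of \<open>g\<close> one has \<open>g' = f \<noteq> 0\<close>, so \<open>g\<close> changes sign there.  The product \<open>f t * g\<close> is used to treat both
  directions of crossing at once.
\<close>
lemma shot_g_zero_persists:
  assumes x: "shot x f g" and t: "t \<in> pos_zeros g" and "0 < e"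
  obtains d where "0 < d"
    "\<And>y p q. \<lbrakk>shot y p q; \<bar>y - x\<bar> < d\<rbrakk> \<Longrightarrow> \<exists>z\<in>pos_zeros q. \<bar>z - t\<bar> < e"
proof -
  have t0: "0 < t" "g t = 0" using t by (auto simp: pos_zeros_def)
  note orb = shot_orbit[OF x]
  have ft: "f t \<noteq> 0" using orbit_nontrivial[OF orb, of t] t0 by auto
  have der: "((\<lambda>r. f t * g r) has_real_derivative f t * f t) (at t)"
    using orbitD(5)[OF orb t0(1)] t0 by (auto intro!: derivative_eq_intros)
  have pos: "0 < f t * f t" using ft by (simp add: zero_less_mult_iff) linarith
  obtain d1 where d1: "0 < d1" "\<And>h. 0 < h \<Longrightarrow> h < d1 \<Longrightarrow> f t * g t < f t * g (t + h)"
    using DERIV_pos_inc_right[OF der pos] by blast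
  obtain d2 where d2: "0 < d2" "\<And>h. 0 < h \<Longrightarrow> h < d2 \<Longrightarrow> f t * g (t - h) < f t * g t"
    using DERIV_pos_inc_left[OF der pos] by blast
  define h where "h = min (min d1 d2) (min e t) / 2"
  have h: "0 < h" "h < d1" "h < d2" "h < e" "h < t"
    using d1(1) d2(1) \<open>0 < e\<close> t0(1) by (auto simp: h_def min_def)
  have sg: "f t * g (t - h) < 0" "0 < f t * g (t + h)" using d1(2)[OF h(1,2)] d2(2)[OF h(1,3)] t0 by auto
  define U where "U s = {z :: real \<times> real. 0 < s * (f t * snd z)}" for s
  have "open (U s)" for s
    unfolding U_def by (intro open_Collect_less continuous_intros)
  moreover have "(f (t - h), g (t - h)) \<in> U (- 1)" "(f (t + h), g (t + h)) \<in> U 1"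
    using sg by (auto simp: U_def)
  ultimately obtain c1 c2 where
    c1: "0 < c1" "\<And>y p q. \<lbrakk>shot y p q; \<bar>y - x\<bar> < c1\<rbrakk> \<Longrightarrow> (p (t - h), q (t - h)) \<in> U (- 1)" and
    c2: "0 < c2" "\<And>y p q. \<lbrakk>shot y p q; \<bar>y - x\<bar> < c2\<rbrakk> \<Longrightarrow> (p (t + h), q (t + h)) \<in> U 1"
    using shot_open_condition[OF x, of "t - h"] shot_open_condition[OF x, of "t + h"] h t0
    by (metis add_nonneg_nonneg diff_ge_0_iff_ge less_imp_le)
  have "\<exists>z\<in>pos_zeros q. \<bar>z - t\<bar> < e" if y: "shot y p q" "\<bar>y - x\<bar> < min c1 c2" for y p q
  proof (rule ccontr)
    assume no: "\<not> ?thesis"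
    have "q z \<noteq> 0" if "z \<in> {t - h..t + h}" for z
    proof
      assume "q z = 0"
      moreover have "0 < z" "\<bar>z - t\<bar> < e" using that h by auto
      ultimately show False using no by (auto simp: pos_zeros_def)
    qed
    moreover have "continuous_on {t - h..t + h} q"
      using orbit_cont(2)[OF shot_orbit[OF y(1)]] h by simp
    ultimately have "(\<forall>z\<in>{t - h..t + h}. q z < 0) \<or> (\<forall>z\<in>{t - h..t + h}. 0 < q z)"
      by (intro nonvanishing_sign) (auto simp: is_interval_cc)
    moreover have "f t * q (t - h) < 0" "0 < f t * q (t + h)"
      using c1(2)[OF y(1)] c2(2)[OF y(1)] y(2) by (auto simp: U_def)
    moreover have "t - h \<in> {t - h..t + h}" "t + h \<in> {t - h..t + h}" using h by auto
    ultimately show False by (metis mult_less_0_iff not_less_iff_gr_or_eq zero_less_mult_iff)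
  qed
  then show ?thesis using that[of "min c1 c2"] c1(1) c2(1) by auto
qed

lemma shot_g_zeros_lower_semicontinuous:
  assumes x: "shot x f g" and T: "finite T" "T \<subseteq> pos_zeros g"
  obtains d where "0 < d"
    "\<And>y p q. \<lbrakk>shot y p q; \<bar>y - x\<bar> < d; finite (pos_zeros q)\<rbrakk> \<Longrightarrow> card T \<le> card (pos_zeros q)"
proof -
  have "\<forall>\<^sub>F e in at_right 0. \<forall>w\<in>T \<times> T. fst w \<noteq> snd w \<longrightarrow> 2 * e < \<bar>fst w - snd w\<bar>"
  proof (rule eventually_ball_finite)
    show "finite (T \<times> T)" using T by simp
    show "\<forall>w\<in>T \<times> T. \<forall>\<^sub>F e in at_right 0. fst w \<noteq> snd w \<longrightarrow> 2 * e < \<bar>fst w - snd w\<bar>"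
    proof
      fix w :: "real \<times> real"
      show "\<forall>\<^sub>F e in at_right 0. fst w \<noteq> snd w \<longrightarrow> 2 * e < \<bar>fst w - snd w\<bar>"
      proof (cases "fst w = snd w")
        case False
        then show ?thesis
          unfolding eventually_at_right_field by (intro exI[of _ "\<bar>fst w - snd w\<bar> / 2"]) auto
      qed simp
    qed
  qed
  then obtain e0 where e0: "0 < e0"
    "\<And>e w. 0 < e \<Longrightarrow> e < e0 \<Longrightarrow> w \<in> T \<times> T \<Longrightarrow> fst w \<noteq> snd w \<Longrightarrow> 2 * e < \<bar>fst w - snd w\<bar>"
    unfolding eventually_at_right_field by blast
  define e where "e = e0 / 2"
  have e: "0 < e" "\<And>t t'. t \<in> T \<Longrightarrow> t' \<in> T \<Longrightarrow> t \<noteq> t' \<Longrightarrow> 2 * e < \<bar>t - t'\<bar>"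
  proof -
    show "0 < e" using e0(1) by (simp add: e_def)
    fix t t' assume "t \<in> T" "t' \<in> T" "t \<noteq> t'"
    then show "2 * e < \<bar>t - t'\<bar>" using e0(2)[of e "(t, t')"] e0(1) by (simp add: e_def)
  qed
  let ?P = "\<lambda>d t. \<forall>y p q. shot y p q \<longrightarrow> \<bar>y - x\<bar> < d \<longrightarrow> (\<exists>z\<in>pos_zeros q. \<bar>z - t\<bar> < e)"
  have "\<forall>\<^sub>F d in at_right 0. \<forall>t\<in>T. ?P d t"
  proof (rule eventually_ball_finite[OF T(1)], rule ballI)
    fix t assume "t \<in> T"
    then have "t \<in> pos_zeros g" using T by blast
    then obtain d where d: "0 < d" "\<And>y p q. \<lbrakk>shot y p q; \<bar>y - x\<bar> < d\<rbrakk> \<Longrightarrow> \<exists>z\<in>pos_zeros q. \<bar>z - t\<bar> < e"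
      using shot_g_zero_persists[OF x _ e(1)] by blast
    have "?P d' t" if "0 < d'" "d' < d" for d' using d(2) that by force
    then show "\<forall>\<^sub>F d in at_right 0. ?P d t" using d(1) unfolding eventually_at_right_field by blast
  qed
  then obtain d0 where d0: "0 < d0" "\<And>d. 0 < d \<Longrightarrow> d < d0 \<Longrightarrow> \<forall>t\<in>T. ?P d t"
    unfolding eventually_at_right_field by blast
  have "card T \<le> card (pos_zeros q)"
    if y: "shot y p q" "\<bar>y - x\<bar> < d0 / 2" and fin: "finite (pos_zeros q)" for y p q
  proof -
    have "\<forall>t\<in>T. \<exists>z\<in>pos_zeros q. \<bar>z - t\<bar> < e"
      using d0(2)[of "d0 / 2"] d0(1) y by auto
    then obtain z where z: "\<And>t. t \<in> T \<Longrightarrow> z t \<in> pos_zeros q \<and> \<bar>z t - t\<bar> < e"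
      by metis
    have "inj_on z T"
    proof (rule inj_onI)
      fix t t' assume tt: "t \<in> T" "t' \<in> T" "z t = z t'"
      show "t = t'"
      proof (rule ccontr)
        assume "t \<noteq> t'"
        then show False using e(2)[OF tt(1,2)] z[OF tt(1)] z[OF tt(2)] tt(3) by linarith
      qed
    qed
    then show ?thesis using z by (intro card_inj_on_le[OF _ _ fin]) auto
  qed
  then show ?thesis using that[of "d0 / 2"] d0(1) by auto
qed

text \<open>
  Away from the zeros of \<open>g\<close> the function \<open>\<bar>g\<bar>\<close> is bounded below, so nearby solutions have no zero there.  Near a
  zero \<open>\<bar>f\<bar>\<close> is bounded below, so a nearby solution has a monotone \<open>g\<close> component and at most one zero.
\<close>
lemma shot_g_zeros_upper_semicontinuous:
  assumes x: "shot x f g" and fin: "finite (pos_zeros g)"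
  obtains d where "0 < d"
    "\<And>y p q. \<lbrakk>shot y p q; \<bar>y - x\<bar> < d\<rbrakk> \<Longrightarrow>
       finite (pos_zeros q \<inter> {..R}) \<and> card (pos_zeros q \<inter> {..R}) \<le> card (pos_zeros g)"
proof -
  note orb = shot_orbit[OF x]
  define T where "T = pos_zeros g"
  have T: "finite T" "\<And>r. 0 \<le> r \<Longrightarrow> g r = 0 \<Longrightarrow> r \<in> T"
  proof -
    show "finite T" using fin by (simp add: T_def)
    fix r assume "0 \<le> r" "g r = 0"
    moreover have "g 0 \<noteq> 0" using x by (simp add: shot_def)
    ultimately show "r \<in> T" unfolding T_def pos_zeros_def by (cases "r = 0") auto
  qed
  have fcont: "continuous_on {0..R} f" and gcont: "continuous_on {0..R} g"
    using orbit_cont(1,2)[OF orb order_refl] by auto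
  have "\<forall>\<^sub>F e in at_right 0. \<forall>t\<in>T. \<forall>r\<in>{0..R}. \<bar>r - t\<bar> \<le> e \<longrightarrow> f r \<noteq> 0"
  proof (rule eventually_ball_finite[OF T(1)], rule ballI)
    fix t assume "t \<in> T"
    then have t: "0 < t" "g t = 0" by (auto simp: T_def pos_zeros_def)
    have "f t \<noteq> 0" using orbit_nontrivial[OF orb, of t] t by auto
    have "isCont f t" using orbitD(4)[OF orb t(1)] DERIV_isCont by blast
    then have "\<forall>\<^sub>F r in at t. f r \<noteq> 0"
      using \<open>f t \<noteq> 0\<close> by (simp add: isCont_def tendsto_imp_eventually_ne)
    then obtain e where e: "0 < e" "\<And>r. r \<noteq> t \<Longrightarrow> \<bar>r - t\<bar> < e \<Longrightarrow> f r \<noteq> 0"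
      unfolding eventually_at by (auto simp: dist_real_def)
    have "\<forall>r\<in>{0..R}. \<bar>r - t\<bar> \<le> e' \<longrightarrow> f r \<noteq> 0" if "0 < e'" "e' < e" for e'
      using e(2) \<open>f t \<noteq> 0\<close> that by (metis le_less_trans)
    then show "\<forall>\<^sub>F e in at_right 0. \<forall>r\<in>{0..R}. \<bar>r - t\<bar> \<le> e \<longrightarrow> f r \<noteq> 0"
      using e(1) unfolding eventually_at_right_field by blast
  qed
  then obtain e0 where e0: "0 < e0"
    "\<And>e. 0 < e \<Longrightarrow> e < e0 \<Longrightarrow> \<forall>t\<in>T. \<forall>r\<in>{0..R}. \<bar>r - t\<bar> \<le> e \<longrightarrow> f r \<noteq> 0"
    unfolding eventually_at_right_field by blast
  define e where "e = e0 / 2"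
  have e: "0 < e" "\<And>t r. t \<in> T \<Longrightarrow> r \<in> {0..R} \<Longrightarrow> \<bar>r - t\<bar> \<le> e \<Longrightarrow> f r \<noteq> 0"
    using e0(2)[of e] e0(1) by (auto simp: e_def)
  define K1 where "K1 = {0..R} - (\<Union>t\<in>T. ball t e)"
  define K2 where "K2 = {0..R} \<inter> (\<Union>t\<in>T. cball t e)"
  have "compact K1" unfolding K1_def by (intro compact_diff) auto
  moreover have "continuous_on K1 g" using gcont by (rule continuous_on_subset) (auto simp: K1_def)
  moreover have "g r \<noteq> 0" if "r \<in> K1" for r
  proof -
    have "r \<notin> T" using that e(1) centre_in_ball unfolding K1_def by blast
    then show ?thesis using T(2)[of r] that by (auto simp: K1_def)
  qed
  ultimately obtain c1 where c1: "0 < c1" "\<And>r. r \<in> K1 \<Longrightarrow> c1 \<le> \<bar>g r\<bar>"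
    using compact_nonvanishing_bound by blast
  have "compact K2" unfolding K2_def using T(1) by (intro compact_Int compact_UN) auto
  moreover have "continuous_on K2 f" using fcont by (rule continuous_on_subset) (auto simp: K2_def)
  moreover have "f r \<noteq> 0" if "r \<in> K2" for r
    using e(2)[of _ r] that by (auto simp: K2_def dist_real_def abs_minus_commute)
  ultimately obtain c2 where c2: "0 < c2" "\<And>r. r \<in> K2 \<Longrightarrow> c2 \<le> \<bar>f r\<bar>"
    using compact_nonvanishing_bound by blast
  obtain d where d: "0 < d" "\<And>y p q r. \<lbrakk>shot y p q; \<bar>y - x\<bar> < d; 0 \<le> r; r \<le> R\<rbrakk> \<Longrightarrow>
      \<bar>p r - f r\<bar> < min c1 c2 \<and> \<bar>q r - g r\<bar> < min c1 c2"
    using shots_uniformly_close[OF x, of "min c1 c2" R] c1(1) c2(1) by (metis min_less_iff_conj)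
  have "finite (pos_zeros q \<inter> {..R}) \<and> card (pos_zeros q \<inter> {..R}) \<le> card T"
    if y: "shot y p q" "\<bar>y - x\<bar> < d" for y p q
  proof -
    have "\<exists>t\<in>T. r \<in> ball t e" if "r \<in> pos_zeros q \<inter> {..R}" for r
    proof -
      have r: "0 \<le> r" "r \<le> R" "q r = 0" using that by (auto simp: pos_zeros_def)
      have "\<bar>g r\<bar> < c1" using d(2)[OF y r(1,2)] r(3) by simp
      then have "r \<notin> K1" using c1(2)[of r] by auto
      then show ?thesis using r by (auto simp: K1_def)
    qed
    then obtain \<tau> where \<tau>: "\<And>r. r \<in> pos_zeros q \<inter> {..R} \<Longrightarrow> \<tau> r \<in> T \<and> r \<in> ball (\<tau> r) e"
      by metis
    have apart: "\<tau> u \<noteq> \<tau> v"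
      if uv: "u \<in> pos_zeros q \<inter> {..R}" "v \<in> pos_zeros q \<inter> {..R}" "u < v" for u v
    proof
      assume eq: "\<tau> u = \<tau> v"
      obtain z where z: "u < z" "z < v" "p z = 0"
        using g_zeros_separated[OF shot_orbit[OF y(1)], of u v] uv by (auto simp: pos_zeros_def)
      have zR: "0 \<le> z" "z \<le> R" using z uv by (auto simp: pos_zeros_def)
      have "z \<in> cball (\<tau> u) e"
        using \<tau>[OF uv(1)] \<tau>[OF uv(2)] eq z by (auto simp: dist_real_def)
      then have "z \<in> K2" using \<tau>[OF uv(1)] zR by (auto simp: K2_def)
      then show False using c2(2)[of z] d(2)[OF y zR] z(3) by simp
    qed
    have "inj_on \<tau> (pos_zeros q \<inter> {..R})"
      by (rule inj_onI) (metis apart linorder_neqE_linordered_idom)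
    moreover have "\<tau> ` (pos_zeros q \<inter> {..R}) \<subseteq> T" using \<tau> by blast
    ultimately show ?thesis using T(1) inj_on_finite card_inj_on_le by metis
  qed
  then show ?thesis using that d(1) by (auto simp: T_def)
qed

text \<open>
  Negative energy at \<open>R\<close> is an open condition, and beyond \<open>R\<close> it excludes zeros.
\<close>
lemma negative_energy_stable:
  assumes x: "shot x f g" and fin: "finite (pos_zeros g)" and R: "0 \<le> R" "energy (f R) (g R) < 0"
  obtains d where "0 < d"
    "\<And>y p q. \<lbrakk>shot y p q; \<bar>y - x\<bar> < d\<rbrakk> \<Longrightarrow> finite (pos_zeros q) \<and> card (pos_zeros q) \<le> card (pos_zeros g)"
proof -
  obtain d1 where d1: "0 < d1" "\<And>y p q. \<lbrakk>shot y p q; \<bar>y - x\<bar> < d1\<rbrakk> \<Longrightarrow>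
       finite (pos_zeros q \<inter> {..R}) \<and> card (pos_zeros q \<inter> {..R}) \<le> card (pos_zeros g)"
    using shot_g_zeros_upper_semicontinuous[OF x fin, of R] by blast
  define U where "U = {z. energy (fst z) (snd z) < 0}"
  have "open U" unfolding U_def energy_def by (intro open_Collect_less continuous_intros) auto
  then obtain d2 where d2: "0 < d2" "\<And>y p q. \<lbrakk>shot y p q; \<bar>y - x\<bar> < d2\<rbrakk> \<Longrightarrow> (p R, q R) \<in> U"
    using shot_open_condition[OF x R(1), of U] R(2) by (auto simp: U_def)
  have "finite (pos_zeros q) \<and> card (pos_zeros q) \<le> card (pos_zeros g)"
    if y: "shot y p q" "\<bar>y - x\<bar> < min d1 d2" for y p q
  proof -
    have "energy (p R) (q R) \<le> 0" using d2(2)[OF y(1)] y(2) by (simp add: U_def)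
    then have nz: "q r \<noteq> 0" if "R \<le> r" for r
      using no_g_zero_after_nonpos_energy[OF shot_orbit[OF y(1)] R(1) that] by blast
    have "r \<le> R" if "r \<in> pos_zeros q" for r
      using nz[of r] that by (cases "R \<le> r") (auto simp: pos_zeros_def)
    then have "pos_zeros q \<inter> {..R} = pos_zeros q" by auto
    then show ?thesis using d1(2)[OF y(1)] y(2) by simp
  qed
  then show ?thesis using that[of "min d1 d2"] d1(1) d2(1) by auto
qed

text \<open>
  Up to a large radius \<open>R\<close> the number of zeros is controlled by semicontinuity.  At \<open>R\<close> the orbit is so close to
  the origin that \<open>at_most_one_late_g_zero\<close> applies, and its hypotheses are open conditions.
\<close>
lemma positive_energy_gains_at_most_one_zero:
  assumes x: "shot x f g" and fin: "finite (pos_zeros g)"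
    and E: "\<And>r. 0 \<le> r \<Longrightarrow> 0 < energy (f r) (g r)"
  obtains d where "0 < d"
    "\<And>y p q. \<lbrakk>shot y p q; \<bar>y - x\<bar> < d\<rbrakk> \<Longrightarrow> finite (pos_zeros q) \<and> card (pos_zeros q) \<le> card (pos_zeros g) + 1"
proof -
  note orb = shot_orbit[OF x]
  obtain S where S: "0 < S" "settled S f g \<or> settled S (\<lambda>r. - f r) (\<lambda>r. - g r)"
    using eventually_settled[OF orb E] fin unfolding pos_zeros_def by blast
  have orbS: "orbit S f g" using orbit_later[OF orb] S(1) by simp
  have ES: "0 < energy (f r) (g r)" if "S \<le> r" for r using E[of r] that S by simp
  \<comment> \<open>The summand 1 makes the bound on \<open>f R\<close> strict and thus stable under small perturbations.\<close>
  define B where "B = decay_const * exp (rate * S) + 1"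
  obtain R0 where R0: "1 \<le> R0"
    "\<And>R f g u v. \<lbrakk>R0 \<le> R; orbit R f g; f R < 0; 0 < g R; a * (g R)\<^sup>2 \<le> b;
        - f R \<le> B * exp (- rate * R); R \<le> u; u < v; g u = 0; g v = 0\<rbrakk> \<Longrightarrow> False"
    using at_most_one_late_g_zero[of B] by blast
  define R where "R = max R0 S"
  have R: "R0 \<le> R" "S \<le> R" "0 \<le> R" using S(1) by (auto simp: R_def)
  \<comment> \<open>The sign that turns the branch of the stable manifold into \<open>f < 0 < g\<close>.\<close>
  define \<sigma> where "\<sigma> = (if settled S f g then 1 else - 1 :: real)"
  have \<sigma>: "\<sigma> = 1 \<or> \<sigma> = - 1" by (simp add: \<sigma>_def)
  define U where "U = {z :: real \<times> real. \<sigma> * fst z < 0 \<and> 0 < \<sigma> * snd z \<and> a * (snd z)\<^sup>2 < b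
      \<and> - (\<sigma> * fst z) < B * exp (- rate * R)}"
  have "open U"
    unfolding U_def by (intro open_Collect_conj open_Collect_less continuous_intros)
  moreover have "(f R, g R) \<in> U"
  proof -
    have "\<bar>f R\<bar> \<le> decay_const * exp (- rate * (R - S))"
      using settled_exp_decay(1)[OF orbS _ ES R(2)]
        settled_exp_decay(1)[OF orbit_uminus[OF orbS] _ _ R(2)] ES S(2) by auto
    also have "\<dots> = decay_const * exp (rate * S) * exp (- rate * R)"
      by (simp add: exp_add [symmetric] algebra_simps)
    also have "\<dots> < B * exp (- rate * R)" unfolding B_def by (intro mult_strict_right_mono) auto
    finally have "\<bar>f R\<bar> < B * exp (- rate * R)" .
    then show ?thesis
      using S(2) R(2) by (auto simp: U_def \<sigma>_def settled_def)
  qed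
  ultimately obtain d1 where d1: "0 < d1" "\<And>y p q. \<lbrakk>shot y p q; \<bar>y - x\<bar> < d1\<rbrakk> \<Longrightarrow> (p R, q R) \<in> U"
    using shot_open_condition[OF x R(3)] by blast
  obtain d2 where d2: "0 < d2" "\<And>y p q. \<lbrakk>shot y p q; \<bar>y - x\<bar> < d2\<rbrakk> \<Longrightarrow>
       finite (pos_zeros q \<inter> {..R}) \<and> card (pos_zeros q \<inter> {..R}) \<le> card (pos_zeros g)"
    using shot_g_zeros_upper_semicontinuous[OF x fin, of R] by blast
  have "finite (pos_zeros q) \<and> card (pos_zeros q) \<le> card (pos_zeros g) + 1"
    if y: "shot y p q" "\<bar>y - x\<bar> < min d1 d2" for y p q
  proof -
    have U: "(p R, q R) \<in> U" using d1(2)[OF y(1)] y(2) by simp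
    have orbR: "orbit R p q" using orbit_later[OF shot_orbit[OF y(1)] R(3)] .
    have "finite (pos_zeros q \<inter> {R<..}) \<and> card (pos_zeros q \<inter> {R<..}) \<le> 1"
    proof (rule finite_card_le_1I)
      fix u v assume "u \<in> pos_zeros q \<inter> {R<..}" "v \<in> pos_zeros q \<inter> {R<..}" "u < v"
      then have uv: "R \<le> u" "u < v" "q u = 0" "q v = 0" by (auto simp: pos_zeros_def)
      from \<sigma> show False
      proof
        assume "\<sigma> = 1"
        then show False using R0(2)[OF R(1) orbR _ _ _ _ uv] U by (simp add: U_def)
      next
        assume "\<sigma> = - 1"
        then show False using R0(2)[OF R(1) orbit_uminus[OF orbR] _ _ _ _ uv(1,2)] U uv by (simp add: U_def)
      qed
    qed
    moreover have "finite (pos_zeros q \<inter> {..R}) \<and> card (pos_zeros q \<inter> {..R}) \<le> card (pos_zeros g)"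
      using d2(2)[OF y(1)] y(2) by simp
    moreover have "pos_zeros q = (pos_zeros q \<inter> {..R}) \<union> (pos_zeros q \<inter> {R<..})" by auto
    ultimately show ?thesis
      using card_Un_le[of "pos_zeros q \<inter> {..R}" "pos_zeros q \<inter> {R<..}"] by (metis add_mono finite_Un le_trans)
  qed
  then show ?thesis using that[of "min d1 d2"] d1(1) d2(1) by auto
qed

text \<open>
  The quantity \<open>1 - g\<close> grows at most by \<open>exp (2 fmax R)\<close> up to radius \<open>R\<close>, so for \<open>x\<close> near \<open>1\<close> the energy at \<open>R\<close>
  is still above half of that of \<open>(0, 1)\<close>.  With \<open>R\<close> large this pays for \<open>k + 2\<close> half turns.
\<close>
lemma shots_near_1_have_many_zeros:
  obtains x1 where "x1 < 1" "\<And>x f g. \<lbrakk>shot x f g; x1 < x; finite (pos_zeros g)\<rbrakk> \<Longrightarrow> k < card (pos_zeros g)"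
proof -
  define e1 where "e1 = energy 0 1"
  have "0 < e1" using a_gt by (simp add: e1_def energy_def)
  define R where "R = 8 * real (k + 2) * fmax / e1 + 1"
  have q0: "0 \<le> 8 * real (k + 2) * fmax / e1" using fmax_pos \<open>0 < e1\<close> by simp
  then have "0 < R" by (simp add: R_def)
  have "8 * real (k + 2) * fmax / e1 < R" by (simp add: R_def)
  then have "8 * real (k + 2) * fmax < R * e1" using \<open>0 < e1\<close> by (simp add: pos_divide_less_eq)
  then have loss: "real (k + 2) * (4 * fmax / R) < e1 / 2"
    using \<open>0 < R\<close> by (simp add: field_simps)
  define x1 where "x1 = 1 - e1 / (2 * a * exp (2 * fmax * R))"
  have "x1 < 1" unfolding x1_def using \<open>0 < e1\<close> a_pos by simp
  have "k < card (pos_zeros g)" if x: "shot x f g" "x1 < x" "finite (pos_zeros g)" for x f g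
  proof -
    note orb = shot_orbit[OF x(1)]
    have "1 - g R \<le> (1 - g 0) * exp (2 * fmax * (R - 0))"
    proof (rule exp_comparison_le)
      show "continuous_on {0..R} (\<lambda>r. 1 - g r)" by (intro continuous_intros orbit_cont[OF orb]) simp
      fix r :: real assume r: "0 < r" "r < R"
      show "((\<lambda>r. 1 - g r) has_real_derivative - (f r * (1 - (g r)\<^sup>2))) (at r)"
        using orbitD(5)[OF orb r(1)] by (auto intro!: derivative_eq_intros)
      have g: "\<bar>g r\<bar> < 1" using orbitD(6)[OF orb] r by simp
      have "- f r * (1 + g r) \<le> fmax * 2"
      proof (rule mult_mono)
        show "- f r \<le> fmax" using orbit_f_less[OF orb, of r] r by simp
      qed (use g fmax_pos in auto)
      then have "(- f r * (1 + g r)) * (1 - g r) \<le> (fmax * 2) * (1 - g r)"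
        using g by (intro mult_right_mono) auto
      then show "- (f r * (1 - (g r)\<^sup>2)) \<le> 2 * fmax * (1 - g r)"
        by (simp add: power2_eq_square algebra_simps)
    qed (use \<open>0 < R\<close> in simp)
    also have "\<dots> = (1 - x) * exp (2 * fmax * R)" using x(1) by (simp add: shot_def)
    also have "\<dots> < e1 / (2 * a * exp (2 * fmax * R)) * exp (2 * fmax * R)"
      using x(2) by (intro mult_strict_right_mono) (auto simp: x1_def)
    also have "\<dots> = e1 / (2 * a)" by simp
    finally have gR: "1 - g R < e1 / (2 * a)" .
    have g1: "\<bar>g R\<bar> < 1" using orbitD(6)[OF orb] \<open>0 < R\<close> by simp
    have g2: "(g R)\<^sup>2 < 1" using g1 by (simp add: abs_square_less_1)
    have "e1 - energy (f R) (g R) = (1 - (g R)\<^sup>2) * (a * (1 + (g R)\<^sup>2) / 2 - b - (f R)\<^sup>2) / 2"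
      unfolding e1_def by (rule energy_gap)
    also have "\<dots> \<le> (1 - (g R)\<^sup>2) * a / 2"
    proof (intro divide_right_mono mult_left_mono)
      have "a * (1 + (g R)\<^sup>2) \<le> a * 2" using g2 a_pos by (intro mult_left_mono) auto
      then show "a * (1 + (g R)\<^sup>2) / 2 - b - (f R)\<^sup>2 \<le> a" using b_pos zero_le_power2[of "f R"] by linarith
    qed (use g2 in auto)
    also have "(1 - (g R)\<^sup>2) * a / 2 = (1 - g R) * a * ((1 + g R) / 2)"
      by (simp add: power2_eq_square algebra_simps)
    also have "\<dots> \<le> (1 - g R) * a * 1"
      using g1 a_pos by (intro mult_left_mono) auto
    also have "\<dots> < e1 / (2 * a) * a * 1"
      using mult_strict_right_mono[OF gR a_pos] by (simp only: mult_1_right)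
    also have "\<dots> = e1 / 2" using a_pos by simp
    finally have ER: "e1 / 2 < energy (f R) (g R)" by simp
    have sub: "{r. R < r \<and> g r = 0} \<subseteq> pos_zeros g" using \<open>0 < R\<close> by (auto simp: pos_zeros_def)
    have "k < card {r. R < r \<and> g r = 0}"
      using orbit_later[OF orb, of R] \<open>0 < R\<close> loss ER finite_subset[OF sub x(3)]
      by (intro many_g_zeros) auto
    also have "\<dots> \<le> card (pos_zeros g)" using sub x(3) by (rule card_mono[rotated])
    finally show ?thesis .
  qed
  then show ?thesis using that \<open>x1 < 1\<close> by blast
qed

section \<open>Critical initial values\<close>

text \<open>
  The quantification over all shots avoids a choice of one of them; on \<open>{0..}\<close> there is only one, by
  \<open>shots_diverge\<close>.
\<close>
definition few_zeros :: "nat \<Rightarrow> real set" where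
  "few_zeros k = {x. 0 < x \<and> x < 1 \<and> (\<forall>f g. shot x f g \<longrightarrow> finite (pos_zeros g) \<and> card (pos_zeros g) \<le> k)}"

lemma few_zeros_Sup:
  defines "s \<equiv> \<lambda>k. Sup (few_zeros k)"
  shows "s k \<in> few_zeros k" and "\<And>y. s k < y \<Longrightarrow> y \<notin> few_zeros k"
proof -
  \<comment> \<open>The bottom of the well: a constant solution of negative energy.\<close>
  define x0 where "x0 = sqrt (b / a)"
  have x0: "0 < x0" "x0 < 1" "a * x0\<^sup>2 = b" using a_gt b_pos a_pos by (auto simp: x0_def)
  have "x0 \<in> few_zeros k"
    unfolding few_zeros_def
  proof (intro CollectI conjI allI impI)
    fix f g assume sh: "shot x0 f g"
    have "energy 0 x0 \<le> 0" using x0 b_pos by (simp add: energy_on_axis mult_nonneg_nonpos)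
    then have "g r \<noteq> 0" if "0 \<le> r" for r
      using no_g_zero_after_nonpos_energy[OF shot_orbit[OF sh] order_refl that] sh by (simp add: shot_def)
    then have "pos_zeros g = {}" by (auto simp: pos_zeros_def)
    then show "finite (pos_zeros g)" "card (pos_zeros g) \<le> k" by auto
  qed (use x0 in auto)
  then have ne: "few_zeros k \<noteq> {}" by blast
  obtain x1 where x1: "x1 < 1" "\<And>x f g. \<lbrakk>shot x f g; x1 < x; finite (pos_zeros g)\<rbrakk> \<Longrightarrow> k < card (pos_zeros g)"
    using shots_near_1_have_many_zeros[of k] by blast
  have le_x1: "x \<le> x1" if "x \<in> few_zeros k" for x
  proof (rule ccontr)
    assume "\<not> x \<le> x1"
    have "0 < x" "x < 1" using that by (auto simp: few_zeros_def)
    then obtain f g where sh: "shot x f g" using shot_exists by blast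
    have "k < card (pos_zeros g)" "card (pos_zeros g) \<le> k"
      using x1(2)[OF sh] that sh \<open>\<not> x \<le> x1\<close> by (auto simp: few_zeros_def)
    then show False by simp
  qed
  have bdd: "bdd_above (few_zeros k)" using le_x1 by (auto simp: bdd_above_def)
  show above: "y \<notin> few_zeros k" if "s k < y" for y
    using cSup_upper[OF _ bdd, of y] that unfolding s_def by auto
  have "x0 \<le> s k" unfolding s_def using \<open>x0 \<in> few_zeros k\<close> bdd by (rule cSup_upper)
  moreover have "s k \<le> x1" unfolding s_def using ne le_x1 by (rule cSup_least)
  ultimately have s01: "0 < s k" "s k < 1" using x0 x1(1) by auto
  show "s k \<in> few_zeros k"
    unfolding few_zeros_def
  proof (intro CollectI conjI allI impI s01, rule_tac [!] ccontr)
    have contra: False if sh: "shot (s k) f g" and T: "finite T" "T \<subseteq> pos_zeros g" "card T = Suc k" for f g T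
    proof -
      obtain d where d: "0 < d" "\<And>y p q. \<lbrakk>shot y p q; \<bar>y - s k\<bar> < d; finite (pos_zeros q)\<rbrakk> \<Longrightarrow>
          card T \<le> card (pos_zeros q)"
        using shot_g_zeros_lower_semicontinuous[OF sh T(1,2)] by blast
      obtain y where y: "y \<in> few_zeros k" "s k - d < y"
        using less_cSupD[OF ne, of "s k - d"] d(1) unfolding s_def by auto
      have "y \<le> s k" unfolding s_def using y(1) bdd by (rule cSup_upper)
      have "0 < y" "y < 1" using y(1) by (auto simp: few_zeros_def)
      then obtain p q where pq: "shot y p q" using shot_exists by blast
      then have "finite (pos_zeros q)" "card (pos_zeros q) \<le> k" using y(1) by (auto simp: few_zeros_def)
      then show False using d(2)[OF pq] y(2) \<open>y \<le> s k\<close> T(3) by simp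
    qed
    fix f g assume sh: "shot (s k) f g"
    { assume "infinite (pos_zeros g)"
      then obtain T where "finite T" "card T = Suc k" "T \<subseteq> pos_zeros g"
        using infinite_arbitrarily_large by blast
      then show False using contra[OF sh] by blast
    }
    { assume "\<not> card (pos_zeros g) \<le> k"
      then have "Suc k \<le> card (pos_zeros g)" by simp
      then obtain T where "T \<subseteq> pos_zeros g" "card T = Suc k" "finite T"
        using obtain_subset_with_card_n by metis
      then show False using contra[OF sh] by blast
    }
  qed
qed

text \<open>
  No neighbourhood of the supremum consists of values with at most \<open>k\<close> zeros.  By \<open>negative_energy_stable\<close> this
  excludes nonpositive energy, and by \<open>positive_energy_gains_at_most_one_zero\<close> it excludes fewer than \<open>k\<close> zeros.
\<close>
lemma critical_shot:
  assumes sh: "shot (Sup (few_zeros k)) f g"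
  shows "\<And>r. 0 \<le> r \<Longrightarrow> 0 < energy (f r) (g r)" and "finite (pos_zeros g)" and "card (pos_zeros g) = k"
proof -
  define s where "s = Sup (few_zeros k)"
  have sh: "shot s f g" using assms by (simp add: s_def)
  have "s \<in> few_zeros k" using few_zeros_Sup(1)[of k] by (simp only: s_def)
  have s1: "s < 1" "0 < s" using sh by (auto simp: shot_def)
  have fin: "finite (pos_zeros g)" and le: "card (pos_zeros g) \<le> k"
    using \<open>s \<in> few_zeros k\<close> sh by (simp_all add: few_zeros_def)
  have no_nbhd: False
    if d: "0 < d" "\<And>y p q. \<lbrakk>shot y p q; \<bar>y - s\<bar> < d\<rbrakk> \<Longrightarrow> finite (pos_zeros q) \<and> card (pos_zeros q) \<le> k" for d
  proof -
    define y where "y = s + min d (1 - s) / 2"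
    have y: "s < y" "y < 1" "\<bar>y - s\<bar> < d" using d(1) s1 by (auto simp: y_def min_def field_simps)
    have "y \<in> few_zeros k" unfolding few_zeros_def using y s1 d(2) by auto
    then show False using few_zeros_Sup(2)[of k y] y(1) by (simp add: s_def)
  qed
  show E: "0 < energy (f r) (g r)" if "0 \<le> r" for r
  proof (rule ccontr)
    assume "\<not> 0 < energy (f r) (g r)"
    then have neg: "energy (f (r + 1)) (g (r + 1)) < 0"
      using energy_strict[OF shot_orbit[OF sh] that, of "r + 1"] by simp
    have "0 \<le> r + 1" using that by simp
    then obtain d where d: "0 < d" "\<And>y p q. \<lbrakk>shot y p q; \<bar>y - s\<bar> < d\<rbrakk> \<Longrightarrow>
        finite (pos_zeros q) \<and> card (pos_zeros q) \<le> card (pos_zeros g)"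
      using negative_energy_stable[OF sh fin _ neg] by blast
    show False by (rule no_nbhd[OF d(1)]) (use d(2) le in force)
  qed
  show "finite (pos_zeros g)" by (rule fin)
  show "card (pos_zeros g) = k"
  proof (rule ccontr)
    assume "card (pos_zeros g) \<noteq> k"
    then have less: "card (pos_zeros g) + 1 \<le> k" using le by simp
    obtain d where d: "0 < d" "\<And>y p q. \<lbrakk>shot y p q; \<bar>y - s\<bar> < d\<rbrakk> \<Longrightarrow>
        finite (pos_zeros q) \<and> card (pos_zeros q) \<le> card (pos_zeros g) + 1"
      using positive_energy_gains_at_most_one_zero[OF sh fin E] by blast
    show False by (rule no_nbhd[OF d(1)]) (use d(2) less in force)
  qed
qed

end

theorem theorem1p1:
  fixes a b :: real
  assumes "a > 2 * b" and "2 * b > 0"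
  shows "\<exists>x :: nat \<Rightarrow> real. strict_mono x \<and> (\<forall>k. x k \<in> {0<..<1}) \<and>
    (\<forall>k.
      (\<exists>I f g. maximal_cauchy_solution a b (x k) I f g) \<and>
      (\<forall>I f g. maximal_cauchy_solution a b (x k) I f g \<longrightarrow>
         I = {0..} \<and>
         has_exactly_pos_zeros k f \<and> has_exactly_pos_zeros k g \<and>
         converges_exponentially_to_0 f g))"
proof -
  interpret mean_field a b by unfold_locales (use assms in auto)
  define x where "x k = Sup (few_zeros k)" for k
  have x_few: "x k \<in> few_zeros k" for k unfolding x_def by (rule few_zeros_Sup)
  then have x01: "0 < x k" "x k < 1" for k by (auto simp: few_zeros_def)
  have "strict_mono x"
    unfolding strict_mono_Suc_iff
  proof
    fix k
    obtain f g where sh: "shot (x k) f g" using shot_exists x01 by blast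
    have "x k \<noteq> x (Suc k)"
    proof
      assume eq: "x k = x (Suc k)"
      have "card (pos_zeros g) = k" using critical_shot(3) sh unfolding x_def by blast
      moreover have "card (pos_zeros g) = Suc k"
        using critical_shot(3) sh unfolding eq unfolding x_def by blast
      ultimately show False by simp
    qed
    moreover have "x k \<in> few_zeros (Suc k)" using x_few[of k] by (auto simp: few_zeros_def intro: le_SucI)
    then have "x k \<le> x (Suc k)" using few_zeros_Sup(2)[of "Suc k" "x k"] unfolding x_def by force
    ultimately show "x k < x (Suc k)" by simp
  qed
  moreover have "(\<exists>I f g. maximal_cauchy_solution a b (x k) I f g) \<and>
      (\<forall>I f g. maximal_cauchy_solution a b (x k) I f g \<longrightarrow>
         I = {0..} \<and> has_exactly_pos_zeros k f \<and> has_exactly_pos_zeros k g \<and>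
         converges_exponentially_to_0 f g)" for k
  proof -
    obtain F G where FG: "orbit 0 F G" "F 0 = 0" "G 0 = x k"
      and max: "maximal_cauchy_solution a b (x k) {0..} F G"
      and unique': "\<forall>I f g. maximal_cauchy_solution a b (x k) I f g \<longrightarrow>
        I = {0..} \<and> (\<forall>r\<ge>0. f r = F r \<and> g r = G r)"
      using orbit_is_maximal_solution[OF x01(1)[of k] x01(2)[of k]] by (elim exE conjE)
    have unique: "I = {0..} \<and> (\<forall>r\<ge>0. f r = F r \<and> g r = G r)"
      if "maximal_cauchy_solution a b (x k) I f g" for I f g using unique' that by simp
    have sh: "shot (x k) F G" using FG x01 by (simp add: shot_def)
    note crit = critical_shot[OF sh[unfolded x_def]]
    have zG: "has_exactly_pos_zeros k G"
      using crit(2,3) by (simp add: has_exactly_pos_zeros_def pos_zeros_def)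
    have zF: "has_exactly_pos_zeros k F" by (rule f_has_as_many_zeros[OF FG(1,2) crit(1) zG])
    have conv: "converges_exponentially_to_0 F G"
      using positive_energy_orbit_decays[OF FG(1) crit(1)] crit(2) by (simp add: pos_zeros_def)
    have "I = {0..} \<and> has_exactly_pos_zeros k f \<and> has_exactly_pos_zeros k g \<and>
         converges_exponentially_to_0 f g" if "maximal_cauchy_solution a b (x k) I f g" for I f g
    proof -
      have agree: "f r = F r" "g r = G r" if "0 \<le> r" for r using unique[OF \<open>maximal_cauchy_solution a b (x k) I f g\<close>] that by auto
      have "{r. 0 < r \<and> f r = 0} = {r. 0 < r \<and> F r = 0}" "{r. 0 < r \<and> g r = 0} = {r. 0 < r \<and> G r = 0}"
        using agree by auto
      then have "has_exactly_pos_zeros k f" "has_exactly_pos_zeros k g"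
        using zF zG by (simp_all add: has_exactly_pos_zeros_def)
      moreover have "converges_exponentially_to_0 f g"
        using conv agree by (simp add: converges_exponentially_to_0_def)
      ultimately show ?thesis using unique[OF that] by simp
    qed
    then show ?thesis using max by blast
  qed
  ultimately show ?thesis using x01 by (intro exI[of _ x]) simp
qed

end
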